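(* Let $d\ge2$ be an integer, let $\Omega$ be a domain in $\mathbb{S}^d$, and let $\lambda_1(\Omega)<\lambda_2(\Omega)\le\cdots$ be the eigenvalues of the Dirichlet Laplacian on $\Omega$, repeated according to multiplicity. Put $z_d=\frac{(2d-1)d}{12}$. Then for all $z\ge0$ $$ R_1^D(z)=\sum_{j\geq1}(z-\lambda_j(\Omega))_+\leq L_{1,d}^{class}|\Omega|(z+z_d)^{\frac d2+1}. $$ Equivalently, for all integers $k\ge1$, $$ \frac1k\sum_{j=1}^k\lambda_j(\Omega)\geq\frac{d}{d+2}\,\frac{4\pi^2}{\omega_d^{2/d}}\left(\frac{k}{|\Omega|}\right)^{2/d}-z_d . $$
   Context: $\mathbb{S}^d$ is the round unit sphere in $\mathbb{R}^{d+1}$. A domain is an open connected set; $|\Omega|$ is its $d$-dimensional measure; $\omega_d$ is the volume of the unit ball in $\mathbb{R}^d$; $a_+=\max(a,0)$. The semiclassical constant is $L_{\gamma,d}^{class}=(4\pi)^{-d/2}\frac{\Gamma(\gamma+1)}{\Gamma(\gamma+1+d/2)}$. Dirichlet eigenvalues are understood in the weak sense: $\lambda$ is an eigenvalue if there is $0\ne u\in H_0^1(\Omega)$ (closure of $C_c^\infty(\Omega)$ in $H^1(\Omega)$) with $\int_\Omega\nabla u\cdot\nabla\phi=\lambda\int_\Omega u\phi$ for all $\phi\in H_0^1(\Omega)$. *)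

theory Defs
  imports "HOL-Analysis.Analysis"
begin

section \<open>The round unit sphere\<close>

text \<open>
  The unit sphere \<open>S\<^sup>d\<close> is \<^term>\<open>sphere 0 1\<close> in a Euclidean space of dimension \<open>d + 1\<close>.
  A function on the sphere is represented by any function on the ambient space; only its values on
  the sphere matter. Differential notions on the sphere are obtained from the \<open>0\<close>-homogeneous
  extension \<open>y \<mapsto> f (y / |y|)\<close>, which is written \<^term>\<open>\<lambda>y. f (sgn y)\<close>: a function is smooth on the
  sphere iff this extension is smooth away from the origin. The extension is constant along rays, so
  at a point of the sphere its derivative only sees tangential directions and its Euclidean gradient
  is the Riemannian gradient of \<open>f\<close>.
\<close>

text \<open>
  Surface measure, as the cone measure normalised by the ambient dimension \<open>d + 1\<close>
  (polar coordinates): the area of \<open>A\<close> is \<open>d + 1\<close> times the volume of \<open>{r x | 0 < r < 1, x \<in> A}\<close>.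
  The exceptional value \<^term>\<open>sgn 0 = 0\<close> carries no mass.
\<close>

definition sphere_measure :: "'a::euclidean_space measure" where
  "sphere_measure =
     scale_measure (ennreal (real DIM('a))) (distr (restrict_space lborel (ball 0 1)) borel sgn)"

lemma sgn_borel_measurable: "(sgn :: 'a::euclidean_space \<Rightarrow> 'a) \<in> borel_measurable borel"
  unfolding sgn_div_norm by measurable

lemma emeasure_sphere_measure:
  fixes A :: "'a::euclidean_space set"
  assumes "A \<in> sets borel"
  shows "emeasure sphere_measure A = ennreal (real DIM('a)) * emeasure lborel {x \<in> ball 0 1. sgn x \<in> A}"
proof -
  have m: "sgn \<in> measurable (restrict_space lborel (ball (0::'a) 1)) borel"
    by (intro measurable_restrict_space1) (simp add: sgn_borel_measurable)
  have eq: "sgn -` A \<inter> space (restrict_space lborel (ball (0::'a) 1)) = {x \<in> ball 0 1. sgn x \<in> A}"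
    by (auto simp: space_restrict_space)
  have "emeasure sphere_measure A = ennreal (real DIM('a)) *
      emeasure (restrict_space lborel (ball 0 1)) {x \<in> ball (0::'a) 1. sgn x \<in> A}"
    unfolding sphere_measure_def by (simp only: emeasure_scale_measure emeasure_distr[OF m assms] eq)
  then show ?thesis
    by (subst (asm) emeasure_restrict_space) auto
qed

lemma emeasure_sphere_measure_sphere:
  "emeasure sphere_measure (sphere (0::'a::euclidean_space) 1) =
     ennreal (real DIM('a) * unit_ball_vol (real DIM('a)))"
proof -
  have eq: "{x \<in> ball (0::'a) 1. sgn x \<in> sphere 0 1} = ball 0 1 - {0}"
    by (auto simp: norm_sgn)
  have "emeasure lborel (ball (0::'a) 1 - {0}) = emeasure lborel (ball (0::'a) 1)"
    by (subst emeasure_Diff) auto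
  then show ?thesis
    using emeasure_sphere_measure[of "sphere (0::'a) 1"]
    by (simp only: eq borel_closed closed_sphere) (simp add: emeasure_ball ennreal_mult)
qed

definition sphere_domain :: "'a::euclidean_space set \<Rightarrow> bool" where
  "sphere_domain \<Omega> \<longleftrightarrow> openin (top_of_set (sphere 0 1)) \<Omega> \<and> connected \<Omega> \<and> \<Omega> \<noteq> {}"

text \<open>\<^term>\<open>Ck_on k f S\<close>: \<open>f\<close> is \<open>k\<close> times continuously differentiable on the open set \<open>S\<close>.\<close>

fun Ck_on :: "nat \<Rightarrow> ('a::euclidean_space \<Rightarrow> 'b::real_normed_vector) \<Rightarrow> 'a set \<Rightarrow> bool" where
  "Ck_on 0 f S \<longleftrightarrow> continuous_on S f"
| "Ck_on (Suc k) f S \<longleftrightarrow>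
     (\<forall>x\<in>S. f differentiable (at x)) \<and> (\<forall>v. Ck_on k (\<lambda>x. frechet_derivative f (at x) v) S)"

definition sphere_smooth :: "('a::euclidean_space \<Rightarrow> 'b::real_normed_vector) \<Rightarrow> bool" where
  "sphere_smooth f \<longleftrightarrow> (\<forall>k. Ck_on k (\<lambda>y. f (sgn y)) (- {0}))"

definition sphere_grad :: "('a::euclidean_space \<Rightarrow> real) \<Rightarrow> 'a \<Rightarrow> 'a" where
  "sphere_grad f x = (\<Sum>b\<in>Basis. frechet_derivative (\<lambda>y. f (sgn y)) (at x) b *\<^sub>R b)"

text \<open>For a tangential vector field this is the Riemannian divergence.\<close>

definition sphere_div :: "('a::euclidean_space \<Rightarrow> 'a) \<Rightarrow> 'a \<Rightarrow> real" where
  "sphere_div X x = (\<Sum>b\<in>Basis. frechet_derivative (\<lambda>y. X (sgn y)) (at x) b \<bullet> b)"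

section \<open>Sobolev spaces on a domain of the sphere\<close>

text \<open>Smooth functions and vector fields with compact support in \<open>\<Omega>\<close>.\<close>

definition test_functions ::
  "'a::euclidean_space set \<Rightarrow> ('a \<Rightarrow> 'b::real_normed_vector) set" where
  "test_functions \<Omega> =
     {f. sphere_smooth f \<and> (\<exists>K. compact K \<and> K \<subseteq> \<Omega> \<and> (\<forall>x\<in>sphere 0 1 - K. f x = 0))}"

definition test_fields :: "'a::euclidean_space set \<Rightarrow> ('a \<Rightarrow> 'a) set" where
  "test_fields \<Omega> = {X \<in> test_functions \<Omega>. \<forall>x\<in>sphere 0 1. X x \<bullet> x = 0}"

abbreviation domain_measure :: "'a::euclidean_space set \<Rightarrow> 'a measure" where
  "domain_measure \<Omega> \<equiv> restrict_space sphere_measure \<Omega>"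

definition L2 :: "'a::euclidean_space set \<Rightarrow> ('a \<Rightarrow> 'b::euclidean_space) set" where
  "L2 \<Omega> = {f \<in> borel_measurable (domain_measure \<Omega>).
             integrable (domain_measure \<Omega>) (\<lambda>x. (norm (f x))\<^sup>2)}"

text \<open>
  An element \<open>u\<close> of a Sobolev space is carried along with its weak gradient \<open>g\<close>, which is a tangential
  field determined by \<open>u\<close> up to null sets. Elements are functions, not classes modulo null sets.
\<close>

definition H1 :: "'a::euclidean_space set \<Rightarrow> (('a \<Rightarrow> real) \<times> ('a \<Rightarrow> 'a)) set" where
  "H1 \<Omega> = {(u, g). u \<in> L2 \<Omega> \<and> g \<in> L2 \<Omega> \<and> (\<forall>x\<in>\<Omega>. g x \<bullet> x = 0) \<and>
     (\<forall>X\<in>test_fields \<Omega>. (LINT x|domain_measure \<Omega>. g x \<bullet> X x) =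
                          - (LINT x|domain_measure \<Omega>. u x * sphere_div X x))}"

definition H1_norm :: "'a::euclidean_space set \<Rightarrow> ('a \<Rightarrow> real) \<times> ('a \<Rightarrow> 'a) \<Rightarrow> real" where
  "H1_norm \<Omega> = (\<lambda>(u, g). sqrt ((LINT x|domain_measure \<Omega>. (u x)\<^sup>2) +
                                (LINT x|domain_measure \<Omega>. (norm (g x))\<^sup>2)))"

text \<open>The closure of the test functions in \<^term>\<open>H1 \<Omega>\<close>.\<close>

definition H10 :: "'a::euclidean_space set \<Rightarrow> (('a \<Rightarrow> real) \<times> ('a \<Rightarrow> 'a)) set" where
  "H10 \<Omega> = {(u, g) \<in> H1 \<Omega>. \<exists>\<phi>::nat \<Rightarrow> 'a \<Rightarrow> real. (\<forall>n. \<phi> n \<in> test_functions \<Omega>) \<and>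
     (\<lambda>n. H1_norm \<Omega> (\<lambda>x. u x - \<phi> n x, \<lambda>x. g x - sphere_grad (\<phi> n) x)) \<longlonglongrightarrow> 0}"

section \<open>Dirichlet eigenvalues\<close>

definition dirichlet_eigenspace :: "'a::euclidean_space set \<Rightarrow> real \<Rightarrow> ('a \<Rightarrow> real) set" where
  "dirichlet_eigenspace \<Omega> \<mu> = {u. \<exists>g. (u, g) \<in> H10 \<Omega> \<and>
     (\<forall>(\<phi>, h)\<in>H10 \<Omega>. (LINT x|domain_measure \<Omega>. g x \<bullet> h x) =
                        \<mu> * (LINT x|domain_measure \<Omega>. u x * \<phi> x))}"

definition dirichlet_eigenvalue :: "'a::euclidean_space set \<Rightarrow> real \<Rightarrow> bool" where
  "dirichlet_eigenvalue \<Omega> \<mu> \<longleftrightarrow>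
     (\<exists>u\<in>dirichlet_eigenspace \<Omega> \<mu>. \<not> (AE x in domain_measure \<Omega>. u x = 0))"

text \<open>
  \<open>\<mu>\<close> has multiplicity \<open>m\<close>: the eigenspace, taken modulo equality almost everywhere, has a basis of
  \<open>m\<close> elements.
\<close>

definition has_multiplicity :: "'a::euclidean_space set \<Rightarrow> real \<Rightarrow> nat \<Rightarrow> bool" where
  "has_multiplicity \<Omega> \<mu> m \<longleftrightarrow> (\<exists>b::nat \<Rightarrow> 'a \<Rightarrow> real.
     (\<forall>i<m. b i \<in> dirichlet_eigenspace \<Omega> \<mu>) \<and>
     (\<forall>c::nat \<Rightarrow> real. (AE x in domain_measure \<Omega>. (\<Sum>i<m. c i * b i x) = 0) \<longrightarrow> (\<forall>i<m. c i = 0)) \<and>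
     (\<forall>u\<in>dirichlet_eigenspace \<Omega> \<mu>. \<exists>c::nat \<Rightarrow> real.
        AE x in domain_measure \<Omega>. u x = (\<Sum>i<m. c i * b i x)))"

text \<open>
  \<open>ev 1 \<le> ev 2 \<le> \<dots>\<close> lists the Dirichlet eigenvalues of \<open>\<Omega>\<close> repeated according to multiplicity.
  The value \<open>ev 0\<close> is irrelevant.
\<close>

definition dirichlet_eigenvalue_sequence :: "'a::euclidean_space set \<Rightarrow> (nat \<Rightarrow> real) \<Rightarrow> bool" where
  "dirichlet_eigenvalue_sequence \<Omega> ev \<longleftrightarrow>
     mono_on {1..} ev \<and>
     ev ` {1..} = {\<mu>. dirichlet_eigenvalue \<Omega> \<mu>} \<and>
     (\<forall>\<mu>. dirichlet_eigenvalue \<Omega> \<mu> \<longrightarrow>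
        finite {j\<in>{1..}. ev j = \<mu>} \<and> has_multiplicity \<Omega> \<mu> (card {j\<in>{1..}. ev j = \<mu>}))"

section \<open>The semiclassical constant\<close>

definition L_class :: "real \<Rightarrow> nat \<Rightarrow> real" where
  "L_class \<gamma> d = (4 * pi) powr (- real d / 2) * Gamma (\<gamma> + 1) / Gamma (\<gamma> + 1 + real d / 2)"

end

theory Submission
  imports Defs
begin

text \<open>
  The eigenfunctions \<open>u\<^sub>j\<close> of \<open>\<Omega>\<close>, extended by zero, are expanded in spherical harmonics \<open>Y\<^sub>i\<close>.
  Let \<open>\<Lambda>\<^sub>n = n (n + d - 1)\<close> be the eigenvalue of the harmonics of degree \<open>n\<close>. Completeness of the
  harmonics for \<open>u\<^sub>j\<close> and Bessel's inequality for its gradient give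
  \<open>z - \<lambda>\<^sub>j = z \<parallel>u\<^sub>j\<parallel>\<^sup>2 - \<parallel>\<nabla>u\<^sub>j\<parallel>\<^sup>2 \<le> \<Sum>\<^sub>i (z - \<Lambda>\<^sub>n\<^sub>(\<^sub>i\<^sub>))\<^sub>+ \<langle>u\<^sub>j, Y\<^sub>i\<rangle>\<^sup>2\<close>
  (\<open>H10_spectral_inequality\<close>). Summing over \<open>j\<close> and applying Bessel's inequality once more, now to
  \<open>Y\<^sub>i\<close> and the orthonormal \<open>u\<^sub>j\<close> in \<open>L\<^sup>2(\<Omega>)\<close>, replaces the coefficients by the mass of \<open>Y\<^sub>i\<close> on
  \<open>\<Omega>\<close>. By the addition theorem (\<open>harmonic_sum_squares_constant\<close>) the harmonics up to a given degree
  are equidistributed, so that the Riesz mean of \<open>\<Omega>\<close> is at most \<open>|\<Omega>| / |S\<^sup>d|\<close> times that of the whole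
  sphere (\<open>Riesz_mean_le_sphere\<close>).

  The spectrum of the sphere is explicit. There are \<open>M\<^sub>N = (2 N + d) (N + 1) \<cdots> (N + d - 1) / d!\<close>
  eigenvalues up to degree \<open>N\<close>, with mean \<open>d / (d + 2) N (N + d)\<close>. The claim for the sphere reduces to
  \<open>(M\<^sub>N d! / 2)\<^bsup>2/d\<^esup> \<le> N (N + d) + (2 d - 1) (d + 2) / 12\<close>. Squaring the product and pairing the
  factors \<open>N + i\<close> and \<open>N + d - i\<close>, whose product is \<open>N (N + d) + i (d - i)\<close>, turns this into the
  inequality between geometric and arithmetic mean (\<open>harm_count_AM_GM\<close>). The shift \<open>z\<^sub>d\<close> is
  \<open>d / (d + 2)\<close> times the mean of the \<open>i (d - i)\<close> and of \<open>d\<^sup>2 / 4\<close>.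

  The analysis on the sphere rests on the invariance of the surface measure under orthogonal maps.
  Differentiating it along rotations yields integration by parts, hence the eigenvalue equation for
  the harmonics. Applied to reflections, it yields the addition theorem. Harmonics are polynomials
  orthonormalised in order of degree. The number of generating monomials bounds the counting function
  from above, and the Riesz mean is a combination of its values with nonnegative coefficients.

  The eigenvalue sum is bounded below by evaluating the bound on \<open>\<Sum>\<^sub>j (z - \<lambda>\<^sub>j)\<close> over the first \<open>k\<close>
  eigenvalues at the optimal \<open>z\<close>.
\<close>

section \<open>Square-integrable functions\<close>

definition sqint :: "'a measure \<Rightarrow> ('a \<Rightarrow> 'b::euclidean_space) \<Rightarrow> bool" where
  "sqint M f \<longleftrightarrow> f \<in> borel_measurable M \<and> integrable M (\<lambda>x. (norm (f x))\<^sup>2)"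

definition ip :: "'a measure \<Rightarrow> ('a \<Rightarrow> 'b::euclidean_space) \<Rightarrow> ('a \<Rightarrow> 'b) \<Rightarrow> real" where
  "ip M f g = (LINT x|M. f x \<bullet> g x)"

lemma sqint_integrable_inner:
  assumes "sqint M f" "sqint M g"
  shows "integrable M (\<lambda>x. f x \<bullet> g x)"
proof (rule Bochner_Integration.integrable_bound)
  show "integrable M (\<lambda>x. (norm (f x))\<^sup>2 + (norm (g x))\<^sup>2)"
    using assms by (auto simp: sqint_def)
  show "(\<lambda>x. f x \<bullet> g x) \<in> borel_measurable M"
    using assms by (auto simp: sqint_def)
  have "\<bar>a \<bullet> b\<bar> \<le> (norm a)\<^sup>2 + (norm b)\<^sup>2" for a b :: 'b
  proof -
    have "\<bar>a \<bullet> b\<bar> \<le> norm a * norm b" by (rule Cauchy_Schwarz_ineq2)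
    also have "\<dots> \<le> (norm a)\<^sup>2 + (norm b)\<^sup>2"
      using sum_squares_bound[of "norm a" "norm b"] mult_nonneg_nonneg[OF norm_ge_zero[of a] norm_ge_zero[of b]]
      by linarith
    finally show ?thesis .
  qed
  then show "AE x in M. norm (f x \<bullet> g x) \<le> norm ((norm (f x))\<^sup>2 + (norm (g x))\<^sup>2)"
    by auto
qed

lemma sqint_scale: "sqint M f \<Longrightarrow> sqint M (\<lambda>x. c *\<^sub>R f x)"
  by (auto simp: sqint_def power_mult_distrib)

lemma sqint_add:
  assumes "sqint M f" "sqint M g"
  shows "sqint M (\<lambda>x. f x + g x)"
proof -
  have "integrable M (\<lambda>x. (norm (f x))\<^sup>2 + 2 * (f x \<bullet> g x) + (norm (g x))\<^sup>2)"
    using assms sqint_integrable_inner[OF assms] by (auto simp: sqint_def)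
  moreover have "(norm (f x))\<^sup>2 + 2 * (f x \<bullet> g x) + (norm (g x))\<^sup>2 = (norm (f x + g x))\<^sup>2" for x
    by (simp add: power2_norm_eq_inner inner_add inner_commute)
  ultimately show ?thesis using assms by (auto simp: sqint_def)
qed

lemma sqint_zero: "sqint M (\<lambda>x. 0)"
  by (auto simp: sqint_def)

lemma sqint_diff: "sqint M f \<Longrightarrow> sqint M g \<Longrightarrow> sqint M (\<lambda>x. f x - g x)"
  using sqint_add[of M f "\<lambda>x. (-1) *\<^sub>R g x"] sqint_scale[of M g "-1"] by simp

lemma sqint_sum: "(\<And>i. i \<in> I \<Longrightarrow> sqint M (f i)) \<Longrightarrow> sqint M (\<lambda>x. \<Sum>i\<in>I. f i x)"
  by (induction I rule: infinite_finite_induct) (auto intro: sqint_zero sqint_add)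

lemma ip_commute: "ip M f g = ip M g f"
  by (simp add: ip_def inner_commute)

lemma ip_add_left:
  "sqint M f \<Longrightarrow> sqint M g \<Longrightarrow> sqint M h \<Longrightarrow> ip M (\<lambda>x. f x + g x) h = ip M f h + ip M g h"
  by (simp add: ip_def inner_add_left sqint_integrable_inner)

lemma ip_diff_left:
  "sqint M f \<Longrightarrow> sqint M g \<Longrightarrow> sqint M h \<Longrightarrow> ip M (\<lambda>x. f x - g x) h = ip M f h - ip M g h"
  by (simp add: ip_def inner_diff_left sqint_integrable_inner)

lemma ip_scale_left: "ip M (\<lambda>x. c *\<^sub>R f x) h = c * ip M f h"
  by (simp add: ip_def)

lemma ip_sum_left:
  assumes "\<And>i. i \<in> I \<Longrightarrow> sqint M (f i)" "sqint M h"
  shows "ip M (\<lambda>x. \<Sum>i\<in>I. f i x) h = (\<Sum>i\<in>I. ip M (f i) h)"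
  using assms by (simp add: ip_def inner_sum_left sqint_integrable_inner)

lemma ip_lincomb_left:
  assumes "\<And>i. i \<in> I \<Longrightarrow> sqint M (f i)" "sqint M h"
  shows "ip M (\<lambda>x. \<Sum>i\<in>I. c i *\<^sub>R f i x) h = (\<Sum>i\<in>I. c i * ip M (f i) h)"
  using assms by (subst ip_sum_left) (auto intro: sqint_scale simp: ip_scale_left)

lemma ip_add_right:
  "sqint M f \<Longrightarrow> sqint M g \<Longrightarrow> sqint M h \<Longrightarrow> ip M h (\<lambda>x. f x + g x) = ip M h f + ip M h g"
  by (simp add: ip_commute[of M h] ip_add_left)

lemma ip_diff_right:
  "sqint M f \<Longrightarrow> sqint M g \<Longrightarrow> sqint M h \<Longrightarrow> ip M h (\<lambda>x. f x - g x) = ip M h f - ip M h g"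
  by (simp add: ip_commute[of M h] ip_diff_left)

lemma ip_scale_right: "ip M h (\<lambda>x. c *\<^sub>R f x) = c * ip M h f"
  by (simp add: ip_def)

lemma ip_lincomb_right:
  assumes "\<And>i. i \<in> I \<Longrightarrow> sqint M (f i)" "sqint M h"
  shows "ip M h (\<lambda>x. \<Sum>i\<in>I. c i *\<^sub>R f i x) = (\<Sum>i\<in>I. c i * ip M h (f i))"
  using assms by (simp add: ip_commute[of M h] ip_lincomb_left)

lemma ip_self: "ip M f f = (LINT x|M. (norm (f x))\<^sup>2)"
  by (simp add: ip_def power2_norm_eq_inner)

lemma ip_self_nonneg: "0 \<le> ip M f f"
  by (simp add: ip_self)

lemma ip_self_diff:
  assumes "sqint M f" "sqint M g"
  shows "ip M (\<lambda>x. f x - g x) (\<lambda>x. f x - g x) = ip M f f - 2 * ip M f g + ip M g g"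
  using assms by (simp add: ip_diff_left ip_diff_right sqint_diff ip_commute[of M g f])

lemma ip_cong:
  "(\<And>x. x \<in> space M \<Longrightarrow> f x = f' x) \<Longrightarrow> (\<And>x. x \<in> space M \<Longrightarrow> g x = g' x) \<Longrightarrow> ip M f g = ip M f' g'"
  by (auto simp: ip_def intro!: Bochner_Integration.integral_cong)

lemma ip_Cauchy_Schwarz:
  assumes f: "sqint M f" and g: "sqint M g"
  shows "(ip M f g)\<^sup>2 \<le> ip M f f * ip M g g"
proof -
  have q: "0 \<le> ip M f f - 2 * t * ip M f g + t\<^sup>2 * ip M g g" for t
  proof -
    have "0 \<le> ip M (\<lambda>x. f x - t *\<^sub>R g x) (\<lambda>x. f x - t *\<^sub>R g x)" by (rule ip_self_nonneg)
    also have "\<dots> = ip M f f - 2 * t * ip M f g + t\<^sup>2 * ip M g g"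
      using f g by (subst ip_self_diff)
        (auto intro: sqint_scale simp: ip_scale_left ip_scale_right power2_eq_square)
    finally show ?thesis .
  qed
  show ?thesis
  proof (cases "ip M g g = 0")
    case True
    have "ip M f g = 0"
    proof (rule ccontr)
      assume "ip M f g \<noteq> 0"
      then show False using q[of "(ip M f f + 1) / (2 * ip M f g)"] True by simp
    qed
    then show ?thesis using True by simp
  next
    case False
    then have pos: "ip M g g > 0" using ip_self_nonneg[of M g] by linarith
    have "0 \<le> ip M f f - (ip M f g)\<^sup>2 / ip M g g"
      using q[of "ip M f g / ip M g g"] False by (simp add: power2_eq_square field_simps)
    then show ?thesis using pos by (simp add: field_simps)
  qed
qed

lemma ip_eq_zero_if_norm_zero:
  assumes "sqint M f" "sqint M g" "ip M g g = 0"
  shows "ip M f g = 0"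
  using ip_Cauchy_Schwarz[OF assms(1,2)] assms(3) by simp

text \<open>
  The weights allow \<open>e\<close> to be the gradients of an orthonormal family of eigenfunctions, for which
  \<open>s\<close> lists the eigenvalues. The norms are bounded rather than given because families produced by
  orthonormalisation may contain zero functions.
\<close>

lemma weighted_Bessel:
  assumes I: "finite I" and f: "sqint M f" and e: "\<And>i. i \<in> I \<Longrightarrow> sqint M (e i)"
    and orth: "\<And>i j. i \<in> I \<Longrightarrow> j \<in> I \<Longrightarrow> i \<noteq> j \<Longrightarrow> ip M (e i) (e j) = 0"
    and fe: "\<And>i. i \<in> I \<Longrightarrow> ip M f (e i) = s i * a i"
    and ee: "\<And>i. i \<in> I \<Longrightarrow> ip M (e i) (e i) \<le> s i"
  shows "(\<Sum>i\<in>I. s i * (a i)\<^sup>2) \<le> ip M f f"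
proof -
  define h where "h = (\<lambda>x. \<Sum>i\<in>I. a i *\<^sub>R e i x)"
  have h: "sqint M h" unfolding h_def by (intro sqint_sum sqint_scale e)
  have fh: "ip M f h = (\<Sum>i\<in>I. s i * (a i)\<^sup>2)"
    unfolding h_def using e f
    by (subst ip_lincomb_right) (auto simp: fe power2_eq_square mult_ac intro!: sum.cong)
  have eh: "ip M (e i) h = a i * ip M (e i) (e i)" if "i \<in> I" for i
  proof -
    have "ip M (e i) h = (\<Sum>j\<in>I. a j * ip M (e i) (e j))"
      unfolding h_def using e that by (subst ip_lincomb_right) auto
    also have "\<dots> = (\<Sum>j\<in>I. if j = i then a i * ip M (e i) (e i) else 0)"
      using orth that by (intro sum.cong) auto
    finally show ?thesis using that I by simp
  qed
  have "ip M h h = (\<Sum>i\<in>I. a i * ip M (e i) h)"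
    using h e by (subst (1) h_def, subst ip_lincomb_left) auto
  also have "\<dots> \<le> (\<Sum>i\<in>I. s i * (a i)\<^sup>2)"
  proof (rule sum_mono)
    fix i assume i: "i \<in> I"
    have "a i * ip M (e i) h = (a i)\<^sup>2 * ip M (e i) (e i)"
      using eh[OF i] by (simp add: power2_eq_square)
    also have "\<dots> \<le> (a i)\<^sup>2 * s i" by (intro mult_left_mono ee i) auto
    finally show "a i * ip M (e i) h \<le> s i * (a i)\<^sup>2" by (simp add: mult_ac)
  qed
  finally have "ip M h h \<le> (\<Sum>i\<in>I. s i * (a i)\<^sup>2)" .
  moreover have "0 \<le> ip M f f - 2 * ip M f h + ip M h h"
    using ip_self_nonneg[of M "\<lambda>x. f x - h x"] ip_self_diff[OF f h] by simp
  ultimately show ?thesis using fh by simp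
qed

lemma ip_tendsto:
  assumes f: "sqint M f" and h: "\<And>n. sqint M (h n)" and k: "sqint M k"
    and lim: "(\<lambda>n. ip M (\<lambda>x. f x - h n x) (\<lambda>x. f x - h n x)) \<longlonglongrightarrow> 0"
  shows "(\<lambda>n. ip M (h n) k) \<longlonglongrightarrow> ip M f k"
proof -
  have "(\<lambda>n. ip M f k - ip M (h n) k) \<longlonglongrightarrow> 0"
  proof (rule tendsto_0_le[where K = 1 and f = "\<lambda>n. sqrt (ip M (\<lambda>x. f x - h n x) (\<lambda>x. f x - h n x) * ip M k k)"])
    show "(\<lambda>n. sqrt (ip M (\<lambda>x. f x - h n x) (\<lambda>x. f x - h n x) * ip M k k)) \<longlonglongrightarrow> 0"
      using tendsto_real_sqrt[OF tendsto_mult_left_zero[OF lim, of "ip M k k"]] by simp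
    have "\<bar>ip M f k - ip M (h n) k\<bar> \<le> sqrt (ip M (\<lambda>x. f x - h n x) (\<lambda>x. f x - h n x) * ip M k k)" for n
      using ip_Cauchy_Schwarz[OF sqint_diff[OF f h] k, of n] ip_diff_left[OF f h k, of n]
      by (intro real_le_rsqrt) simp
    then show "\<forall>\<^sub>F n in sequentially. norm (ip M f k - ip M (h n) k)
        \<le> norm (sqrt (ip M (\<lambda>x. f x - h n x) (\<lambda>x. f x - h n x) * ip M k k)) * 1"
      by (intro always_eventually allI)
        (simp add: order_trans[OF _ abs_ge_self])
  qed
  from tendsto_diff[OF tendsto_const[of "ip M f k"] this] show ?thesis by simp
qed

lemma ip_self_tendsto:
  assumes f: "sqint M f" and h: "\<And>n. sqint M (h n)"
    and lim: "(\<lambda>n. ip M (\<lambda>x. f x - h n x) (\<lambda>x. f x - h n x)) \<longlonglongrightarrow> 0"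
  shows "(\<lambda>n. ip M (h n) (h n)) \<longlonglongrightarrow> ip M f f"
proof -
  have eq: "ip M (h n) (h n) = ip M (\<lambda>x. f x - h n x) (\<lambda>x. f x - h n x) + 2 * ip M (h n) f - ip M f f" for n
    using ip_self_diff[OF f h, of n] by (simp add: ip_commute[of M "h n" f])
  have "(\<lambda>n. ip M (h n) (h n)) \<longlonglongrightarrow> 0 + 2 * ip M f f - ip M f f"
    unfolding eq by (intro tendsto_intros lim ip_tendsto[OF f h f lim])
  then show ?thesis by simp
qed

subsection \<open>Gram--Schmidt orthonormalisation\<close>

text \<open>
  A function that depends on the earlier ones contributes the zero function instead of being
  dropped, so that the indexing of the sequence is kept.
\<close>

fun gram_schmidt :: "'a measure \<Rightarrow> (nat \<Rightarrow> 'a \<Rightarrow> real) \<Rightarrow> nat \<Rightarrow> 'a \<Rightarrow> real" where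
  "gram_schmidt M f i =
     (let r = (\<lambda>x. f i x - (\<Sum>k<i. ip M (f i) (gram_schmidt M f k) *\<^sub>R gram_schmidt M f k x)) in
      if ip M r r = 0 then (\<lambda>x. 0) else (\<lambda>x. (1 / sqrt (ip M r r)) *\<^sub>R r x))"

declare gram_schmidt.simps [simp del]

definition gs_residual :: "'a measure \<Rightarrow> (nat \<Rightarrow> 'a \<Rightarrow> real) \<Rightarrow> nat \<Rightarrow> 'a \<Rightarrow> real" where
  "gs_residual M f i =
     (\<lambda>x. f i x - (\<Sum>k<i. ip M (f i) (gram_schmidt M f k) *\<^sub>R gram_schmidt M f k x))"

lemma gram_schmidt_eq:
  "gram_schmidt M f i =
     (if ip M (gs_residual M f i) (gs_residual M f i) = 0 then (\<lambda>x. 0)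
      else (\<lambda>x. (1 / sqrt (ip M (gs_residual M f i) (gs_residual M f i))) *\<^sub>R gs_residual M f i x))"
  by (subst gram_schmidt.simps) (simp add: gs_residual_def Let_def)

text \<open>
  Every linear property of the \<open>f k\<close> is inherited: polynomials of bounded degree, eigenspaces, and
  spans are closed under the operations of the algorithm.
\<close>

lemma gram_schmidt_induct:
  assumes zero: "P (\<lambda>x. 0)" and add: "\<And>u v. P u \<Longrightarrow> P v \<Longrightarrow> P (\<lambda>x. u x + v x)"
    and scale: "\<And>c u. P u \<Longrightarrow> P (\<lambda>x. c * u x)" and f: "\<And>k. k \<le> i \<Longrightarrow> P (f k)"
  shows "P (gs_residual M f i)" "P (gram_schmidt M f i)"
proof -
  have sum: "P (\<lambda>x. \<Sum>k<m. c k * u k x)" if "\<And>k. k < m \<Longrightarrow> P (u k)" for m :: nat and c u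
    using that
  proof (induction m)
    case (Suc m)
    have "P (\<lambda>x. (\<Sum>k<m. c k * u k x) + c m * u m x)"
      by (rule add[OF Suc.IH scale]) (use Suc.prems in auto)
    then show ?case by simp
  qed (simp add: zero)
  have "P (gs_residual M f i) \<and> P (gram_schmidt M f i)"
    using f
  proof (induction i rule: less_induct)
    case (less i)
    have "P (\<lambda>x. f i x + (-1) * (\<Sum>k<i. ip M (f i) (gram_schmidt M f k) * gram_schmidt M f k x))"
      using less by (intro add scale sum) auto
    then have r: "P (gs_residual M f i)" by (simp add: gs_residual_def)
    then show ?case
      using scale[OF r, of "1 / sqrt (ip M (gs_residual M f i) (gs_residual M f i))"] zero
      by (subst gram_schmidt_eq) simp
  qed
  then show "P (gs_residual M f i)" "P (gram_schmidt M f i)" by auto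
qed

lemma sqint_gram_schmidt:
  assumes "\<And>k. k \<le> i \<Longrightarrow> sqint M (f k)"
  shows "sqint M (gs_residual M f i)" "sqint M (gram_schmidt M f i)"
proof -
  note * = sqint_zero sqint_add sqint_scale[where 'b = real, simplified]
  show "sqint M (gs_residual M f i)"
    by (rule gram_schmidt_induct(1)[where P = "sqint M"]) (use assms in \<open>auto intro: *\<close>)
  show "sqint M (gram_schmidt M f i)"
    by (rule gram_schmidt_induct(2)[where P = "sqint M"]) (use assms in \<open>auto intro: *\<close>)
qed

lemma gram_schmidt_normed:
  assumes "\<And>k. k \<le> i \<Longrightarrow> sqint M (f k)"
  shows "ip M (gram_schmidt M f i) (gram_schmidt M f i) = 1 \<or> gram_schmidt M f i = (\<lambda>x. 0)"
proof (cases "ip M (gs_residual M f i) (gs_residual M f i) = 0")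
  case False
  then have "ip M (gs_residual M f i) (gs_residual M f i) > 0"
    using ip_self_nonneg[of M "gs_residual M f i"] by linarith
  moreover have "gram_schmidt M f i =
      (\<lambda>x. (1 / sqrt (ip M (gs_residual M f i) (gs_residual M f i))) *\<^sub>R gs_residual M f i x)"
    using False by (subst gram_schmidt_eq) simp
  ultimately have "ip M (gram_schmidt M f i) (gram_schmidt M f i) = 1"
    by (simp only: ip_scale_left ip_scale_right) simp
  then show ?thesis ..
qed (simp add: gram_schmidt_eq)

lemma gram_schmidt_orthogonal_less:
  assumes "\<And>k. k \<le> i \<Longrightarrow> sqint M (f k)" "j < i"
  shows "ip M (gram_schmidt M f i) (gram_schmidt M f j) = 0"
  using assms
proof (induction i arbitrary: j rule: less_induct)
  case (less i)
  let ?e = "gram_schmidt M f"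
  have s: "sqint M (?e k)" if "k \<le> i" for k
    using that less.prems(1) by (intro sqint_gram_schmidt) auto
  have orth: "ip M (?e k) (?e j) = 0" if "k < i" "k \<noteq> j" for k
    using less.IH[of k j] less.IH[of j k] less.prems that
    by (cases "j < k") (auto simp: ip_commute[of M "?e k"])
  have "ip M (gs_residual M f i) (?e j) =
      ip M (f i) (?e j) - (\<Sum>k<i. ip M (f i) (?e k) * ip M (?e k) (?e j))"
    unfolding gs_residual_def using less.prems s
    by (subst ip_diff_left)
      (auto intro!: sqint_sum sqint_scale ip_lincomb_left simp del: real_scaleR_def)
  also have "(\<Sum>k<i. ip M (f i) (?e k) * ip M (?e k) (?e j)) = 
      (\<Sum>k<i. if k = j then ip M (f i) (?e j) * ip M (?e j) (?e j) else 0)"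
    using orth by (intro sum.cong) auto
  also have "\<dots> = ip M (f i) (?e j) * ip M (?e j) (?e j)" using less.prems by simp
  also have "\<dots> = ip M (f i) (?e j)"
    using gram_schmidt_normed[of j M f] less.prems by (auto simp: ip_def)
  finally have "ip M (gs_residual M f i) (?e j) = 0" by simp
  then show ?case
    by (subst gram_schmidt_eq) (simp add: ip_scale_left del: real_scaleR_def, simp add: ip_def)
qed

lemma gram_schmidt_orthogonal:
  assumes "\<And>k. k \<le> max i j \<Longrightarrow> sqint M (f k)" "i \<noteq> j"
  shows "ip M (gram_schmidt M f i) (gram_schmidt M f j) = 0"
proof (cases "j < i")
  case True
  then show ?thesis using assms(1) by (intro gram_schmidt_orthogonal_less) auto
next
  case False
  then have "ip M (gram_schmidt M f j) (gram_schmidt M f i) = 0"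
    using assms by (intro gram_schmidt_orthogonal_less) auto
  then show ?thesis by (subst ip_commute)
qed

section \<open>The surface measure\<close>

lemma nn_integral_lborel_translate:
  fixes c :: "'a::euclidean_space"
  assumes "f \<in> borel_measurable borel"
  shows "(\<integral>\<^sup>+x. f (c + x) \<partial>lborel) = (\<integral>\<^sup>+x. f x \<partial>lborel)"
proof -
  have "(\<integral>\<^sup>+x. f x \<partial>lborel) = (\<integral>\<^sup>+x. f x \<partial>(distr lborel borel ((+) c)))"
    by (simp add: lborel_distr_plus)
  also have "\<dots> = (\<integral>\<^sup>+x. f (c + x) \<partial>lborel)"
    using assms by (intro nn_integral_distr) auto
  finally show ?thesis by simp
qed

lemma orthogonal_transformation_continuous_on:
  "orthogonal_transformation T \<Longrightarrow> continuous_on A T"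
  for T :: "'a::euclidean_space \<Rightarrow> 'a"
  by (intro linear_continuous_on linear_conv_bounded_linear[THEN iffD1] orthogonal_transformation_linear)

lemma orthogonal_transformation_measurable:
  "orthogonal_transformation T \<Longrightarrow> T \<in> borel_measurable borel"
  for T :: "'a::euclidean_space \<Rightarrow> 'a"
  by (intro borel_measurable_continuous_onI orthogonal_transformation_continuous_on)

text \<open>
  Uniqueness of translation invariant measures, by Fubini: with the unit ball \<open>B\<close>, the double
  integral of \<open>1\<^sub>A(T x + y) 1\<^sub>B(y)\<close> is the mass of \<open>A\<close> under the image measure times the volume of \<open>B\<close>
  if \<open>x\<close> is integrated first. After the translation \<open>y \<mapsto> y - T x\<close> it is the volume of \<open>A\<close> times that of
  \<open>B\<close>, because \<open>T\<close> preserves balls.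
\<close>

lemma lborel_distr_orthogonal:
  fixes T :: "'a::euclidean_space \<Rightarrow> 'a"
  assumes T: "orthogonal_transformation T"
  shows "distr lborel borel T = lborel"
proof (rule measure_eqI)
  fix A assume "A \<in> sets (distr lborel borel T)"
  then have A: "A \<in> sets borel" by simp
  note [measurable] = A orthogonal_transformation_measurable[OF T]
  let ?B = "ball (0::'a) 1"
  have [measurable]: "?B \<in> sets borel" by simp
  have lin: "linear T" using T by (rule orthogonal_transformation_linear)
  have surj: "T (inv T y) = y" for y
    using orthogonal_transformation_surj[OF T] by (simp add: surj_f_inv_f)
  have 1: "(\<integral>\<^sup>+x. indicator A (T x + y) \<partial>lborel) = emeasure (distr lborel borel T) A" for y
  proof -
    have "(\<integral>\<^sup>+x. indicator A (T x + y) \<partial>lborel) = (\<integral>\<^sup>+x. indicator A (T (inv T y + x)) \<partial>lborel)"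
      by (simp add: linear_add[OF lin] surj add.commute)
    also have "\<dots> = (\<integral>\<^sup>+x. indicator A (T x) \<partial>lborel)"
      by (rule nn_integral_lborel_translate[where f = "\<lambda>x. indicator A (T x)"]) simp
    also have "\<dots> = (\<integral>\<^sup>+x. indicator A x \<partial>distr lborel borel T)"
      by (subst nn_integral_distr) auto
    finally show ?thesis by simp
  qed
  have 2: "(\<integral>\<^sup>+y. indicator A (T x + y) * indicator ?B y \<partial>lborel)
      = (\<integral>\<^sup>+y. indicator A y * indicator ?B (y - T x) \<partial>lborel)" for x
  proof -
    have "(\<lambda>y. indicator A y * indicator ?B (y - T x) :: ennreal) \<in> borel_measurable borel"
      by measurable
    from nn_integral_lborel_translate[OF this, of "T x"] show ?thesis by simp
  qed
  have 3: "(\<integral>\<^sup>+x. indicator ?B (y - T x) \<partial>lborel) = emeasure lborel ?B" for y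
  proof -
    have "norm (y - T x) = norm (inv T y - x)" for x
      using orthogonal_transformation_norm[OF T, of "inv T y - x"]
      by (simp add: linear_diff[OF lin] surj)
    then have "indicator ?B (y - T x) = (indicator ?B (- (inv T y) + x) :: ennreal)" for x
      by (simp add: indicator_def norm_minus_commute)
    then have "(\<integral>\<^sup>+x. indicator ?B (y - T x) \<partial>lborel) = (\<integral>\<^sup>+x. indicator ?B (- (inv T y) + x) \<partial>lborel)"
      by simp
    also have "\<dots> = (\<integral>\<^sup>+x. indicator ?B x \<partial>lborel)"
      by (rule nn_integral_lborel_translate) simp
    finally show ?thesis by simp
  qed
  have "emeasure (distr lborel borel T) A * emeasure lborel ?B =
      (\<integral>\<^sup>+y. emeasure (distr lborel borel T) A * indicator ?B y \<partial>lborel)"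
    by (subst nn_integral_cmult) auto
  also have "\<dots> = (\<integral>\<^sup>+y. (\<integral>\<^sup>+x. indicator A (T x + y) * indicator ?B y \<partial>lborel) \<partial>lborel)"
  proof (rule nn_integral_cong)
    fix y :: 'a
    show "emeasure (distr lborel borel T) A * indicator ?B y =
        (\<integral>\<^sup>+x. indicator A (T x + y) * indicator ?B y \<partial>lborel)"
      by (subst nn_integral_multc) (auto simp: 1)
  qed
  also have "\<dots> = (\<integral>\<^sup>+x. (\<integral>\<^sup>+y. indicator A (T x + y) * indicator ?B y \<partial>lborel) \<partial>lborel)"
    by (rule lborel_pair.Fubini') simp
  also have "\<dots> = (\<integral>\<^sup>+x. (\<integral>\<^sup>+y. indicator A y * indicator ?B (y - T x) \<partial>lborel) \<partial>lborel)"
    by (simp add: 2)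
  also have "\<dots> = (\<integral>\<^sup>+y. (\<integral>\<^sup>+x. indicator A y * indicator ?B (y - T x) \<partial>lborel) \<partial>lborel)"
    by (rule lborel_pair.Fubini'[symmetric]) simp
  also have "\<dots> = (\<integral>\<^sup>+y. indicator A y * emeasure lborel ?B \<partial>lborel)"
    by (subst nn_integral_cmult) (auto simp: 3)
  also have "\<dots> = emeasure lborel A * emeasure lborel ?B"
    by (subst nn_integral_multc) auto
  finally have "emeasure (distr lborel borel T) A * emeasure lborel ?B = emeasure lborel A * emeasure lborel ?B" .
  moreover have "emeasure lborel ?B \<noteq> 0" "emeasure lborel ?B \<noteq> \<infinity>"
    by (auto simp: emeasure_ball ennreal_eq_0_iff not_le)
  ultimately show "emeasure (distr lborel borel T) A = emeasure lborel A"
    by (simp add: mult.commute[of _ "emeasure lborel ?B"] ennreal_mult_cancel_left)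
qed simp

abbreviation surface_measure :: "'a::euclidean_space measure" where
  "surface_measure \<equiv> domain_measure (sphere 0 1)"

lemma sets_sphere_measure [simp, measurable_cong]: "sets sphere_measure = sets borel"
  by (simp add: sphere_measure_def)

lemma space_sphere_measure [simp]: "space sphere_measure = UNIV"
  using sets_eq_imp_space_eq[OF sets_sphere_measure] by simp

lemma finite_sphere_measure: "finite_measure (sphere_measure :: 'a::euclidean_space measure)"
proof
  have "{x \<in> ball 0 1. sgn x \<in> (UNIV :: 'a set)} = ball 0 1" by auto
  then have "emeasure lborel {x \<in> ball 0 1. sgn x \<in> (UNIV :: 'a set)} < \<infinity>"
    using emeasure_lborel_ball_finite by metis
  then show "emeasure (sphere_measure :: 'a measure) (space sphere_measure) \<noteq> \<infinity>"
    by (simp add: emeasure_sphere_measure ennreal_mult_eq_top_iff)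
qed

lemma openin_sphere_borel:
  assumes "openin (top_of_set (sphere (0::'a::euclidean_space) 1)) \<Omega>"
  shows "\<Omega> \<subseteq> sphere 0 1" "\<Omega> \<in> sets borel"
proof -
  obtain U where U: "open U" "\<Omega> = sphere 0 1 \<inter> U" using assms by (auto simp: openin_open)
  then show "\<Omega> \<subseteq> sphere 0 1" "\<Omega> \<in> sets borel" by auto
qed

lemma space_domain_measure [simp]: "space (domain_measure \<Omega>) = \<Omega>"
  by (simp add: space_restrict_space)

lemma finite_domain_measure:
  "\<Omega> \<in> sets borel \<Longrightarrow> finite_measure (domain_measure \<Omega>)"
  by (intro finite_measure_restrict_space finite_sphere_measure) simp

lemma distr_sphere_measure_orthogonal:
  fixes T :: "'a::euclidean_space \<Rightarrow> 'a"
  assumes T: "orthogonal_transformation T"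
  shows "distr sphere_measure borel T = sphere_measure"
proof (rule measure_eqI)
  fix A assume "A \<in> sets (distr sphere_measure borel T)"
  then have A: "A \<in> sets borel" by simp
  note [measurable] = A orthogonal_transformation_measurable[OF T] sgn_borel_measurable
  have TA: "T -` A \<in> sets borel" using measurable_sets[OF orthogonal_transformation_measurable[OF T] A] by simp
  have sgn: "sgn (T x) = T (sgn x)" for x
    by (simp add: sgn_div_norm orthogonal_transformation_norm[OF T] orthogonal_transformation_scaleR[OF T])
  have "emeasure (distr sphere_measure borel T) A = emeasure sphere_measure (T -` A)"
    by (subst emeasure_distr) auto
  also have "\<dots> = ennreal (real DIM('a)) * emeasure lborel {x \<in> ball 0 1. sgn x \<in> T -` A}"
    by (rule emeasure_sphere_measure[OF TA])
  also have "{x \<in> ball 0 1. sgn x \<in> T -` A} = T -` {x \<in> ball 0 1. sgn x \<in> A}"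
    by (auto simp: sgn orthogonal_transformation_norm[OF T])
  also have "emeasure lborel \<dots> = emeasure (distr lborel borel T) {x \<in> ball 0 1. sgn x \<in> A}"
    by (subst emeasure_distr) auto
  also have "\<dots> = emeasure lborel {x \<in> ball 0 1. sgn x \<in> A}"
    by (simp add: lborel_distr_orthogonal[OF T])
  finally show "emeasure (distr sphere_measure borel T) A = emeasure sphere_measure A"
    by (simp add: emeasure_sphere_measure[OF A])
qed simp

lemma borel_measurable_domain_measure:
  fixes f :: "'a::euclidean_space \<Rightarrow> 'b::euclidean_space"
  assumes "continuous_on (sphere 0 1) f" "\<Omega> \<subseteq> sphere 0 1"
  shows "f \<in> borel_measurable (domain_measure \<Omega>)"
proof -
  have "f \<in> borel_measurable (restrict_space borel \<Omega>)"
    using assms by (intro borel_measurable_continuous_on_restrict continuous_on_subset[OF assms(1)])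
  also have "borel_measurable (restrict_space borel \<Omega>) = borel_measurable (domain_measure \<Omega>)"
    by (intro measurable_cong_sets) (simp_all add: sets_restrict_space)
  finally show ?thesis .
qed

lemma continuous_on_sphere_integrable:
  fixes f :: "'a::euclidean_space \<Rightarrow> 'b::euclidean_space"
  assumes f: "continuous_on (sphere 0 1) f" and \<Omega>: "\<Omega> \<subseteq> sphere 0 1" "\<Omega> \<in> sets borel"
  shows "integrable (domain_measure \<Omega>) f"
proof -
  have "compact (f ` sphere 0 1)" using f by (intro compact_continuous_image) auto
  then obtain B where B: "\<And>x. x \<in> sphere 0 1 \<Longrightarrow> norm (f x) \<le> B"
    using compact_imp_bounded by (fastforce simp: bounded_iff)
  show ?thesis
    by (rule finite_measure.integrable_const_bound[OF finite_domain_measure[OF \<Omega>(2)], of _ B])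
      (use B \<Omega> f in \<open>auto intro!: AE_I2 borel_measurable_domain_measure\<close>)
qed

lemma continuous_on_sphere_sqint:
  fixes f :: "'a::euclidean_space \<Rightarrow> 'b::euclidean_space"
  assumes f: "continuous_on (sphere 0 1) f" and \<Omega>: "\<Omega> \<subseteq> sphere 0 1" "\<Omega> \<in> sets borel"
  shows "sqint (domain_measure \<Omega>) f"
  unfolding sqint_def
  using assms by (auto intro!: borel_measurable_domain_measure continuous_on_sphere_integrable continuous_intros)

lemmas continuous_on_surface_sqint =
  continuous_on_sphere_sqint[OF _ order_refl borel_closed[OF closed_sphere]]

lemma integral_domain_eq_surface:
  fixes f :: "'a::euclidean_space \<Rightarrow> real"
  assumes \<Omega>: "\<Omega> \<subseteq> sphere 0 1" "\<Omega> \<in> sets borel"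
    and zero: "\<And>x. x \<in> sphere 0 1 - \<Omega> \<Longrightarrow> f x = 0"
  shows "(LINT x|domain_measure \<Omega>. f x) = (LINT x|surface_measure. f x)"
proof -
  have "indicator \<Omega> x *\<^sub>R f x = indicator (sphere 0 1) x *\<^sub>R f x" for x
    using zero[of x] \<Omega> by (auto simp: indicator_def)
  then show ?thesis
    using \<Omega> by (simp only: integral_restrict_space sets_sphere_measure space_sphere_measure
        Int_UNIV_right borel_closed closed_sphere)
qed

lemma surface_integral_orthogonal:
  fixes f :: "'a::euclidean_space \<Rightarrow> real" and T :: "'a \<Rightarrow> 'a"
  assumes T: "orthogonal_transformation T" and f: "continuous_on (sphere 0 1) f"
  shows "(LINT x|surface_measure. f (T x)) = (LINT x|surface_measure. f x)"
proof -
  have "f \<in> borel_measurable (restrict_space borel (sphere 0 1))"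
    using f by (rule borel_measurable_continuous_on_restrict)
  then have m: "(\<lambda>x. indicator (sphere 0 1) x *\<^sub>R f x) \<in> borel_measurable borel"
    by (subst (asm) borel_measurable_restrict_space_iff) auto
  have "(LINT x|surface_measure. f x) = (LINT x|sphere_measure. indicator (sphere 0 1) x *\<^sub>R f x)"
    by (subst integral_restrict_space) auto
  also have "\<dots> = (LINT x|distr sphere_measure borel T. indicator (sphere 0 1) x *\<^sub>R f x)"
    by (simp add: distr_sphere_measure_orthogonal[OF T])
  also have "\<dots> = (LINT x|sphere_measure. indicator (sphere 0 1) (T x) *\<^sub>R f (T x))"
    using m orthogonal_transformation_measurable[OF T] by (intro integral_distr) auto
  also have "\<dots> = (LINT x|sphere_measure. indicator (sphere 0 1) x *\<^sub>R f (T x))"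
    by (simp add: indicator_def orthogonal_transformation_norm[OF T])
  also have "\<dots> = (LINT x|surface_measure. f (T x))"
    by (subst integral_restrict_space) auto
  finally show ?thesis by simp
qed

text \<open>
  If \<open>f x0\<close> were not zero, \<open>f\<close> would not vanish on a neighbourhood of \<open>x0\<close>, and the cone over it
  contains a ball. This makes functions of norm zero vanish everywhere, so that
  orthonormalised polynomials span pointwise.
\<close>

lemma surface_integral_zero_imp:
  fixes f :: "'a::euclidean_space \<Rightarrow> real"
  assumes f: "continuous_on (sphere 0 1) f" "\<And>x. x \<in> sphere 0 1 \<Longrightarrow> 0 \<le> f x"
    and zero: "(LINT x|surface_measure. f x) = 0" and x0: "x0 \<in> sphere 0 1"
  shows "f x0 = 0"
proof (rule ccontr)
  assume ne: "f x0 \<noteq> 0"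
  define W where "W = {x \<in> ball 0 1 - {0}. f (sgn x) \<noteq> 0}"
  have cs: "continuous_on (- {0}) (sgn :: 'a \<Rightarrow> 'a)"
    by (intro continuous_intros) auto
  have "continuous_on (ball 0 1 - {0}) (\<lambda>x. f (sgn x))"
  proof (rule continuous_on_compose2[OF f(1)])
    show "continuous_on (ball 0 1 - {0 :: 'a}) sgn" by (rule continuous_on_subset[OF cs]) auto
  qed (auto simp: norm_sgn split: if_splits)
  then have "open ((\<lambda>x. f (sgn x)) -` (- {0}) \<inter> (ball 0 1 - {0}))"
    by (subst (asm) continuous_on_open_vimage) (auto intro: open_delete)
  also have "(\<lambda>x. f (sgn x)) -` (- {0}) \<inter> (ball 0 1 - {0}) = W" by (auto simp: W_def)
  finally have "open W" .
  moreover have "(1/2) *\<^sub>R x0 \<in> W" using x0 ne by (simp add: W_def sgn_scaleR) (auto simp: sgn_div_norm)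
  ultimately obtain r where r: "r > 0" "ball ((1/2) *\<^sub>R x0) r \<subseteq> W"
    by (meson openE)
  have AE: "AE x in surface_measure. f x = 0"
    using zero f by (subst (asm) integral_nonneg_eq_0_iff_AE)
      (auto intro!: continuous_on_sphere_integrable AE_I2)
  then obtain N where N: "{x \<in> sphere 0 1. f x \<noteq> 0} \<subseteq> N" "N \<in> null_sets surface_measure"
    by (auto elim!: AE_E simp: null_sets_def)
  then have N': "N \<in> sets borel" "emeasure sphere_measure N = 0"
    by (auto simp: null_sets_def sets_restrict_space emeasure_restrict_space)
  then have "emeasure lborel {x \<in> ball 0 1. sgn x \<in> N} = 0"
    by (simp add: emeasure_sphere_measure)
  moreover have "ball ((1/2) *\<^sub>R x0) r \<subseteq> {x \<in> ball 0 1. sgn x \<in> N}"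
    using r N(1) by (auto simp: W_def subset_iff norm_sgn)
  moreover have "{x \<in> ball 0 1. sgn x \<in> N} \<in> sets lborel"
  proof -
    have "ball 0 1 \<inter> sgn -` N \<in> sets borel"
      using measurable_sets[OF sgn_borel_measurable N'(1)] by (intro sets.Int) auto
    also have "ball 0 1 \<inter> sgn -` N = {x \<in> ball 0 1. sgn x \<in> N}" by auto
    finally show ?thesis by simp
  qed
  ultimately have "emeasure lborel (ball ((1/2) *\<^sub>R x0) r) \<le> 0"
    by (metis emeasure_mono)
  moreover have "unit_ball_vol (real DIM('a)) * r ^ DIM('a) > 0" using r by simp
  ultimately show False using r by (simp add: emeasure_ball ennreal_eq_0_iff)
qed

section \<open>Integration by parts on the sphere\<close>

lemma Ck_on_1_I:
  assumes "\<And>x. x \<in> S \<Longrightarrow> (f has_derivative f' x) (at x)" "\<And>v. continuous_on S (\<lambda>x. f' x v)"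
  shows "Ck_on (Suc 0) f S"
proof -
  have "frechet_derivative f (at x) = f' x" if "x \<in> S" for x
    using frechet_derivative_at[OF assms(1)[OF that]] by simp
  then have "continuous_on S (\<lambda>x. frechet_derivative f (at x) v)" for v
    using assms(2)[of v] by (simp cong: continuous_on_cong)
  then show ?thesis using assms(1) by (auto simp: differentiable_def)
qed

lemma Ck_on_1_has_derivative:
  "Ck_on (Suc 0) f S \<Longrightarrow> x \<in> S \<Longrightarrow> (f has_derivative frechet_derivative f (at x)) (at x)"
  by (simp add: frechet_derivative_works[symmetric])

lemma Ck_on_1_continuous_on:
  assumes "Ck_on (Suc 0) f S"
  shows "continuous_on S f"
  using Ck_on_1_has_derivative[OF assms]
  by (meson has_derivative_at_withinI has_derivative_continuous_on)

lemma Ck_on_1_mult: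
  fixes f g :: "'a::euclidean_space \<Rightarrow> real"
  assumes f: "Ck_on (Suc 0) f S" and g: "Ck_on (Suc 0) g S"
  shows "Ck_on (Suc 0) (\<lambda>x. f x * g x) S"
    and "x \<in> S \<Longrightarrow> frechet_derivative (\<lambda>x. f x * g x) (at x) =
      (\<lambda>v. f x * frechet_derivative g (at x) v + frechet_derivative f (at x) v * g x)"
proof -
  have d: "((\<lambda>x. f x * g x) has_derivative
      (\<lambda>v. f x * frechet_derivative g (at x) v + frechet_derivative f (at x) v * g x)) (at x)"
    if "x \<in> S" for x
    by (intro has_derivative_mult Ck_on_1_has_derivative[OF f that] Ck_on_1_has_derivative[OF g that])
  show "Ck_on (Suc 0) (\<lambda>x. f x * g x) S"
    using f g Ck_on_1_continuous_on[OF f] Ck_on_1_continuous_on[OF g]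
    by (intro Ck_on_1_I[OF d]) (auto intro!: continuous_intros)
  show "x \<in> S \<Longrightarrow> frechet_derivative (\<lambda>x. f x * g x) (at x) =
      (\<lambda>v. f x * frechet_derivative g (at x) v + frechet_derivative f (at x) v * g x)"
    using frechet_derivative_at[OF d] by simp
qed

lemma Ck_on_1_linear:
  fixes L :: "'a::euclidean_space \<Rightarrow> real"
  assumes "bounded_linear L"
  shows "Ck_on (Suc 0) L S" "frechet_derivative L (at x) = L"
proof -
  have d: "(L has_derivative L) (at x)" for x
    using assms by (rule bounded_linear_imp_has_derivative)
  show "Ck_on (Suc 0) L S" by (intro Ck_on_1_I[OF d]) auto
  show "frechet_derivative L (at x) = L" using frechet_derivative_at[OF d] by simp
qed

lemma Ck_on_1_derivative_linear:
  fixes G :: "'a::euclidean_space \<Rightarrow> real"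
  assumes "Ck_on (Suc 0) G (- {0})" "x \<in> sphere 0 1"
  shows "linear (frechet_derivative G (at x))"
proof -
  have "x \<noteq> 0" using assms(2) by auto
  then show ?thesis
    using Ck_on_1_has_derivative[OF assms(1), of x] by (auto intro: has_derivative_linear)
qed

lemma continuous_on_sphere_derivative:
  fixes G :: "'a::euclidean_space \<Rightarrow> real"
  assumes G: "Ck_on (Suc 0) G (- {0})" and v: "continuous_on (sphere 0 1) v"
  shows "continuous_on (sphere 0 1) (\<lambda>x. frechet_derivative G (at x) (v x))"
proof -
  have "continuous_on (sphere 0 1) (\<lambda>x. frechet_derivative G (at x) b)" for b
    using G by (auto intro: continuous_on_subset)
  then have "continuous_on (sphere 0 1) (\<lambda>x. \<Sum>b\<in>Basis. (v x \<bullet> b) * frechet_derivative G (at x) b)"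
    by (intro continuous_intros v)
  then show ?thesis
  proof (rule continuous_on_eq)
    fix x :: 'a assume x: "x \<in> sphere 0 1"
    have lin: "linear (frechet_derivative G (at x))"
      using G x by (rule Ck_on_1_derivative_linear)
    have "frechet_derivative G (at x) (v x) = frechet_derivative G (at x) (\<Sum>b\<in>Basis. (v x \<bullet> b) *\<^sub>R b)"
      by (simp add: euclidean_representation)
    then show "(\<Sum>b\<in>Basis. (v x \<bullet> b) * frechet_derivative G (at x) b) = frechet_derivative G (at x) (v x)"
      by (simp add: linear_sum[OF lin] linear_scale[OF lin])
  qed
qed

text \<open>
  Rotations in the plane of \<open>a\<close> and \<open>b\<close> do not change the integral of \<open>G\<close>. Differentiating this
  invariance along the rotation group at the identity gives the claim.
\<close>

lemma surface_integral_rotation_field: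
  fixes G :: "'a::euclidean_space \<Rightarrow> real"
  assumes G: "Ck_on (Suc 0) G (- {0})" and ab: "a \<in> Basis" "b \<in> Basis" "a \<noteq> b"
  shows "(LINT x|surface_measure. frechet_derivative G (at x) ((x \<bullet> a) *\<^sub>R b - (x \<bullet> b) *\<^sub>R a)) = 0"
proof -
  define R where "R = (\<lambda>t (x::'a). x + ((cos t - 1) * (x \<bullet> a) - sin t * (x \<bullet> b)) *\<^sub>R a
      + ((cos t - 1) * (x \<bullet> b) + sin t * (x \<bullet> a)) *\<^sub>R b)"
  define A where "A = (\<lambda>y::'a. (y \<bullet> a) *\<^sub>R b - (y \<bullet> b) *\<^sub>R a)"
  have ip: "a \<bullet> a = 1" "b \<bullet> b = 1" "a \<bullet> b = 0" "b \<bullet> a = 0"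
    using ab by (auto simp: inner_Basis)
  have R_ip: "R t x \<bullet> a = cos t * (x \<bullet> a) - sin t * (x \<bullet> b)" "R t x \<bullet> b = cos t * (x \<bullet> b) + sin t * (x \<bullet> a)" for t x
    by (auto simp: R_def inner_add_left ip algebra_simps)
  have identity: "z + (((c - 1) * p - s * q) * p' + ((c - 1) * q + s * p) * q' +
      ((c - 1) * p' - s * q') * (c * p - s * q) + ((c - 1) * q' + s * p') * (c * q + s * p)) =
      z + (c\<^sup>2 + s\<^sup>2 - 1) * (p * p' + q * q')" for c s p q p' q' z :: real
    by (simp add: algebra_simps power2_eq_square)
  have R0: "R 0 x = x" for x by (simp add: R_def)
  have ot: "orthogonal_transformation (R t)" for t
    unfolding orthogonal_transformation_def
  proof (intro conjI allI)
    show "linear (R t)"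
      by (auto simp: linear_iff R_def inner_add_left algebra_simps)
    fix v w
    have "R t v \<bullet> R t w = v \<bullet> w + (((cos t - 1) * (v \<bullet> a) - sin t * (v \<bullet> b)) * (w \<bullet> a) +
        ((cos t - 1) * (v \<bullet> b) + sin t * (v \<bullet> a)) * (w \<bullet> b) +
        ((cos t - 1) * (w \<bullet> a) - sin t * (w \<bullet> b)) * (R t v \<bullet> a) +
        ((cos t - 1) * (w \<bullet> b) + sin t * (w \<bullet> a)) * (R t v \<bullet> b))"
      by (subst (2) R_def, simp add: inner_add_right, subst R_def)
        (simp add: inner_add_left inner_commute[of a] inner_commute[of b])
    also have "\<dots> = v \<bullet> w + ((cos t)\<^sup>2 + (sin t)\<^sup>2 - 1) * ((v \<bullet> a) * (w \<bullet> a) + (v \<bullet> b) * (w \<bullet> b))"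
      unfolding R_ip by (simp only: identity)
    finally show "R t v \<bullet> R t w = v \<bullet> w" by simp
  qed
  have RS: "R t x \<in> sphere 0 1" if "x \<in> sphere 0 1" for t x
    using that orthogonal_transformation_norm[OF ot] by simp
  have dR: "((\<lambda>t. R t x) has_vector_derivative A (R t x)) (at t)" for x t
    unfolding A_def R_ip unfolding R_def
    by (rule derivative_eq_intros refl has_vector_derivative_scaleR has_vector_derivative_add
        has_vector_derivative_const | simp)+ (simp add: algebra_simps)
  have cA: "continuous_on (sphere 0 1) (\<lambda>x. frechet_derivative G (at x) (A x))"
    unfolding A_def by (intro continuous_on_sphere_derivative G continuous_intros)
  then have "compact ((\<lambda>x. frechet_derivative G (at x) (A x)) ` sphere 0 1)"
    by (intro compact_continuous_image) auto
  then obtain B where B: "\<And>x. x \<in> sphere 0 1 \<Longrightarrow> \<bar>frechet_derivative G (at x) (A x)\<bar> \<le> B"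
    using compact_imp_bounded by (fastforce simp: bounded_iff)
  have dG: "((\<lambda>t. G (R t x)) has_real_derivative frechet_derivative G (at (R t x)) (A (R t x))) (at t)"
    if "x \<in> sphere 0 1" for x t
  proof -
    have "R t x \<noteq> 0" using RS[OF that, of t] by auto
    then have "(G has_derivative frechet_derivative G (at (R t x))) (at (R t x))"
      using Ck_on_1_has_derivative[OF G] by auto
    from vector_derivative_diff_chain_within[OF dR has_derivative_at_withinI[OF this]]
    show ?thesis by (simp add: o_def has_real_derivative_iff_has_vector_derivative)
  qed
  define s where "s = (\<lambda>n x. (G (R (inverse (real (Suc n))) x) - G x) * real (Suc n))"
  have cG: "continuous_on (sphere 0 1) G"
    using Ck_on_1_continuous_on[OF G] by (rule continuous_on_subset) auto
  have cGR: "continuous_on (sphere 0 1) (\<lambda>x. G (R t x))" for t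
    by (rule continuous_on_compose2[OF cG orthogonal_transformation_continuous_on[OF ot]])
      (use RS in auto)
  have "(\<lambda>n. LINT x|surface_measure. s n x) \<longlonglongrightarrow>
      (LINT x|surface_measure. frechet_derivative G (at x) (A x))"
  proof (rule integral_dominated_convergence[where w = "\<lambda>_. B"])
    show "integrable surface_measure (\<lambda>_::'a. B)"
      by (intro continuous_on_sphere_integrable) auto
    show "(\<lambda>x. frechet_derivative G (at x) (A x)) \<in> borel_measurable surface_measure"
      by (intro borel_measurable_domain_measure cA order_refl)
    show "s n \<in> borel_measurable surface_measure" for n
      unfolding s_def by (intro borel_measurable_domain_measure continuous_intros cG cGR order_refl)
    show "AE x in surface_measure. (\<lambda>n. s n x) \<longlonglongrightarrow> frechet_derivative G (at x) (A x)"
    proof (rule AE_I2)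
      fix x :: 'a assume "x \<in> space surface_measure"
      then have x: "x \<in> sphere 0 1" by simp
      have "(\<lambda>h. (G (R (0 + h) x) - G x) / h) \<midarrow>0\<rightarrow> frechet_derivative G (at x) (A x)"
        using DERIV_D[OF dG[OF x, of 0]] by (simp add: R0)
      moreover have "filterlim (\<lambda>n. inverse (real (Suc n))) (at 0) sequentially"
        using LIMSEQ_inverse_real_of_nat by (auto simp: filterlim_at)
      ultimately have "(\<lambda>n. (G (R (0 + inverse (real (Suc n))) x) - G x) / inverse (real (Suc n)))
          \<longlonglongrightarrow> frechet_derivative G (at x) (A x)"
        by (rule filterlim_compose)
      then show "(\<lambda>n. s n x) \<longlonglongrightarrow> frechet_derivative G (at x) (A x)"
        by (simp add: s_def divide_inverse)
    qed
    show "AE x in surface_measure. norm (s n x) \<le> B" for n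
    proof (rule AE_I2)
      fix x :: 'a assume "x \<in> space surface_measure"
      then have x: "x \<in> sphere 0 1" by simp
      define h where "h = inverse (real (Suc n))"
      have h: "h > 0" by (simp add: h_def)
      have "\<exists>t>0. t < h \<and> G (R h x) - G (R 0 x) =
          (h - 0) * frechet_derivative G (at (R t x)) (A (R t x))"
        by (rule MVT2[OF h]) (rule dG[OF x])
      then obtain t where "G (R h x) - G (R 0 x) = (h - 0) * frechet_derivative G (at (R t x)) (A (R t x))"
        by blast
      then have "s n x = (h * real (Suc n)) * frechet_derivative G (at (R t x)) (A (R t x))"
        by (simp only: s_def h_def[symmetric]) (simp add: R0)
      also have "h * real (Suc n) = 1" by (simp add: h_def)
      finally show "norm (s n x) \<le> B" using B[OF RS[OF x, of t]] by simp
    qed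
  qed
  moreover have "(LINT x|surface_measure. s n x) = 0" for n
  proof -
    have "(LINT x|surface_measure. s n x) = ((LINT x|surface_measure. G (R (inverse (real (Suc n))) x))
        - (LINT x|surface_measure. G x)) * real (Suc n)"
      unfolding s_def using cG cGR
      by (simp add: continuous_on_sphere_integrable)
    then show ?thesis by (simp add: surface_integral_orthogonal[OF ot cG])
  qed
  ultimately have "(\<lambda>n. 0) \<longlonglongrightarrow> (LINT x|surface_measure. frechet_derivative G (at x) (A x))"
    by simp
  then show ?thesis unfolding A_def by (simp add: LIMSEQ_const_iff)
qed

text \<open>
  The rotation fields \<open>x\<^sub>j e\<^sub>i - x\<^sub>i e\<^sub>j\<close>, applied to the functions \<open>x\<^sub>j H\<close> and summed over \<open>j\<close>, give
  the derivative of \<open>H\<close> along the tangential part of \<open>e\<^sub>i\<close> and a multiple of \<open>x\<^sub>i H\<close>.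
\<close>

lemma surface_integration_by_parts:
  fixes H :: "'a::euclidean_space \<Rightarrow> real"
  assumes H: "Ck_on (Suc 0) H (- {0})" and i: "i \<in> Basis"
  shows "(LINT x|surface_measure. frechet_derivative H (at x) (i - (x \<bullet> i) *\<^sub>R x)) =
    (real DIM('a) - 1) * (LINT x|surface_measure. (x \<bullet> i) * H x)"
proof -
  define G where "G = (\<lambda>j (y::'a). (y \<bullet> j) * H y)"
  let ?v = "\<lambda>x j. (x \<bullet> j) *\<^sub>R i - (x \<bullet> i) *\<^sub>R j"
  have lin: "Ck_on (Suc 0) (\<lambda>y::'a. y \<bullet> j) (- {0})"
    "frechet_derivative (\<lambda>y::'a. y \<bullet> j) (at x) = (\<lambda>y. y \<bullet> j)" for j x
    by (intro Ck_on_1_linear bounded_linear_inner_left)+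
  have G: "Ck_on (Suc 0) (G j) (- {0})" for j
    unfolding G_def by (intro Ck_on_1_mult H lin)
  have dG: "frechet_derivative (G j) (at x) v =
      (x \<bullet> j) * frechet_derivative H (at x) v + (v \<bullet> j) * H x" if "x \<in> sphere 0 1" for j x v
  proof -
    have "x \<noteq> 0" using that by auto
    then show ?thesis
      using Ck_on_1_mult(2)[OF lin(1)[of j] H, of x] by (simp add: G_def lin(2))
  qed
  have "0 = (\<Sum>j\<in>Basis. (LINT x|surface_measure. frechet_derivative (G j) (at x) (?v x j)))"
  proof (rule sum.neutral[symmetric], rule ballI)
    fix j :: 'a assume j: "j \<in> Basis"
    show "(LINT x|surface_measure. frechet_derivative (G j) (at x) (?v x j)) = 0"
    proof (cases "j = i")
      case True
      have "frechet_derivative (G i) (at x) 0 = 0" if "x \<in> sphere 0 1" for x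
        using Ck_on_1_derivative_linear[OF G that] by (rule linear_0)
      then have "(LINT x|surface_measure. frechet_derivative (G i) (at x) 0) = integral\<^sup>L surface_measure (\<lambda>x::'a. 0)"
        by (intro Bochner_Integration.integral_cong) auto
      then show ?thesis using True by simp
    qed (use surface_integral_rotation_field[OF G j i] in auto)
  qed
  also have "\<dots> = (LINT x|surface_measure. (\<Sum>j\<in>Basis. frechet_derivative (G j) (at x) (?v x j)))"
    by (intro Bochner_Integration.integral_sum[symmetric] continuous_on_sphere_integrable
        continuous_on_sphere_derivative G continuous_intros) auto
  also have "\<dots> = (LINT x|surface_measure. frechet_derivative H (at x) (i - (x \<bullet> i) *\<^sub>R x)
      - (real DIM('a) - 1) * ((x \<bullet> i) * H x))"
  proof (rule Bochner_Integration.integral_cong[OF refl])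
    fix x :: 'a assume "x \<in> space surface_measure"
    then have x: "x \<in> sphere 0 1" by simp
    have linH: "linear (frechet_derivative H (at x))"
      using H x by (rule Ck_on_1_derivative_linear)
    have "(\<Sum>j\<in>Basis. frechet_derivative (G j) (at x) (?v x j)) =
        (\<Sum>j\<in>Basis. frechet_derivative H (at x) ((x \<bullet> j) *\<^sub>R ?v x j)) + (\<Sum>j\<in>Basis. (?v x j \<bullet> j)) * H x"
      by (simp add: dG[OF x] sum.distrib linear_scale[OF linH] sum_distrib_right)
    also have "(\<Sum>j\<in>Basis. frechet_derivative H (at x) ((x \<bullet> j) *\<^sub>R ?v x j)) =
        frechet_derivative H (at x) (\<Sum>j\<in>Basis. (x \<bullet> j) *\<^sub>R ?v x j)"
      by (simp add: linear_sum[OF linH])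
    also have "(\<Sum>j\<in>Basis. (x \<bullet> j) *\<^sub>R ?v x j) = i - (x \<bullet> i) *\<^sub>R x"
    proof -
      have "(\<Sum>j\<in>Basis. (x \<bullet> j) *\<^sub>R ?v x j) =
          (\<Sum>j\<in>Basis. ((x \<bullet> j) * (x \<bullet> j)) *\<^sub>R i) - (\<Sum>j\<in>Basis. (x \<bullet> i) *\<^sub>R ((x \<bullet> j) *\<^sub>R j))"
        by (subst sum_subtractf[symmetric]) (simp add: algebra_simps)
      also have "\<dots> = (x \<bullet> x) *\<^sub>R i - (x \<bullet> i) *\<^sub>R x"
        by (simp only: scaleR_sum_left[symmetric] scaleR_sum_right[symmetric]
            euclidean_inner[of x x, symmetric] euclidean_representation)
      finally show ?thesis using x by (simp add: norm_eq_1)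
    qed
    also have "(\<Sum>j\<in>Basis. (?v x j \<bullet> j)) = - (real DIM('a) - 1) * (x \<bullet> i)"
    proof -
      have "(\<Sum>j\<in>Basis. (?v x j \<bullet> j)) = (\<Sum>j\<in>Basis. (x \<bullet> j) * (i \<bullet> j)) - (\<Sum>j\<in>(Basis::'a set). x \<bullet> i)"
        by (simp only: sum_subtractf[symmetric] inner_diff_left inner_scaleR_left)
          (simp add: inner_same_Basis cong: sum.cong)
      also have "\<dots> = (x \<bullet> i) - real DIM('a) * (x \<bullet> i)"
        by (simp add: euclidean_inner[of x i])
      finally show ?thesis by (simp add: algebra_simps)
    qed
    finally show "(\<Sum>j\<in>Basis. frechet_derivative (G j) (at x) (?v x j)) =
        frechet_derivative H (at x) (i - (x \<bullet> i) *\<^sub>R x) - (real DIM('a) - 1) * ((x \<bullet> i) * H x)"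
      by (simp add: algebra_simps)
  qed
  also have "\<dots> = (LINT x|surface_measure. frechet_derivative H (at x) (i - (x \<bullet> i) *\<^sub>R x))
      - (real DIM('a) - 1) * (LINT x|surface_measure. (x \<bullet> i) * H x)"
  proof -
    have "continuous_on (sphere 0 1) H"
      using Ck_on_1_continuous_on[OF H] by (rule continuous_on_subset) auto
    then have "integrable surface_measure (\<lambda>x. (x \<bullet> i) * H x)"
      by (intro continuous_on_sphere_integrable continuous_intros) auto
    moreover have "integrable surface_measure (\<lambda>x. frechet_derivative H (at x) (i - (x \<bullet> i) *\<^sub>R x))"
      by (intro continuous_on_sphere_integrable continuous_on_sphere_derivative H continuous_intros) auto
    ultimately show ?thesis by simp
  qed
  finally show ?thesis by simp
qed

section \<open>Polynomials restricted to the sphere\<close>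

text \<open>
  \<open>poly_below n f\<close>: \<open>f\<close> is a polynomial of degree less than \<open>n\<close>. With the strict bound the zero
  function is the only case of \<open>n = 0\<close>, and differentiation lowers \<open>n\<close> without exception.
\<close>

inductive poly_below :: "nat \<Rightarrow> ('a::euclidean_space \<Rightarrow> real) \<Rightarrow> bool" where
  zero: "poly_below n (\<lambda>x. 0)"
| const: "poly_below (Suc n) (\<lambda>x. c)"
| add: "poly_below n f \<Longrightarrow> poly_below n g \<Longrightarrow> poly_below n (\<lambda>x. f x + g x)"
| coord: "b \<in> Basis \<Longrightarrow> poly_below n f \<Longrightarrow> poly_below (Suc n) (\<lambda>x. (x \<bullet> b) * f x)"

lemma poly_below_0: "poly_below 0 f \<Longrightarrow> f = (\<lambda>x. 0)"
  by (induction "0::nat" f rule: poly_below.induct) auto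

lemma poly_below_scale: "poly_below n f \<Longrightarrow> poly_below n (\<lambda>x. c * f x)"
proof (induction rule: poly_below.induct)
  case (coord b n f)
  then show ?case using poly_below.coord[of b n "\<lambda>x. c * f x"] by (simp add: mult.left_commute)
qed (auto intro: poly_below.intros simp: distrib_left)

lemma poly_below_diff: "poly_below n f \<Longrightarrow> poly_below n g \<Longrightarrow> poly_below n (\<lambda>x. f x - g x)"
  using poly_below.add[of n f "\<lambda>x. (-1) * g x"] poly_below_scale[of n g "-1"] by simp

lemma poly_below_Suc: "poly_below n f \<Longrightarrow> poly_below (Suc n) f"
  by (induction rule: poly_below.induct) (auto intro: poly_below.intros)

lemma poly_below_mono: "poly_below m f \<Longrightarrow> m \<le> n \<Longrightarrow> poly_below n f"
  by (rotate_tac, induction n rule: dec_induct) (auto intro: poly_below_Suc)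

lemma poly_below_sum: "(\<And>i. i \<in> I \<Longrightarrow> poly_below n (f i)) \<Longrightarrow> poly_below n (\<lambda>x. \<Sum>i\<in>I. f i x)"
  by (induction I rule: infinite_finite_induct) (auto intro: poly_below.intros)

lemma poly_below_inner:
  assumes "poly_below n f"
  shows "poly_below (Suc n) (\<lambda>x. (x \<bullet> v) * f x)"
proof -
  have "poly_below (Suc n) (\<lambda>x. \<Sum>b\<in>Basis. (v \<bullet> b) * ((x \<bullet> b) * f x))"
    by (rule poly_below_sum, rule poly_below_scale, rule poly_below.coord, assumption, rule assms)
  also have "(\<lambda>x. \<Sum>b\<in>Basis. (v \<bullet> b) * ((x \<bullet> b) * f x)) = (\<lambda>x. (x \<bullet> v) * f x)"
    by (auto simp: euclidean_inner[of _ v] sum_distrib_left mult_ac)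
  finally show ?thesis .
qed

lemma poly_below_orthogonal:
  fixes T :: "'a::euclidean_space \<Rightarrow> 'a"
  assumes T: "orthogonal_transformation T" and f: "poly_below n f"
  shows "poly_below n (\<lambda>x. f (T x))"
  using f
proof (induction rule: poly_below.induct)
  case (coord b n f)
  have "T x \<bullet> b = x \<bullet> inv T b" for x
    using T orthogonal_transformation_surj[OF T]
    by (metis orthogonal_transformation_def surj_f_inv_f)
  then show ?case using poly_below_inner[OF coord.IH, of "inv T b"] by simp
qed (auto intro: poly_below.intros)

lemma poly_below_mult:
  assumes "poly_below m f" "poly_below n g"
  shows "poly_below (m + n) (\<lambda>x. f x * g x)"
  using assms
proof (induction rule: poly_below.induct)
  case (const m c)
  then show ?case by (auto intro: poly_below_mono[OF poly_below_scale])
next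
  case (coord b m f)
  then show ?case using poly_below.coord[of b "m + n" "\<lambda>x. f x * g x"] by (simp add: mult_ac)
qed (auto intro: poly_below.intros simp: distrib_right)

lemma real_polynomial_function_poly_below:
  "real_polynomial_function f \<Longrightarrow> \<exists>n. poly_below n f"
proof (induction rule: real_polynomial_function.induct)
  case (linear f)
  then interpret bounded_linear f .
  have eq: "(\<lambda>x. \<Sum>b\<in>Basis. f b * ((x \<bullet> b) * 1)) = f"
  proof
    fix x
    have "f x = f (\<Sum>b\<in>Basis. (x \<bullet> b) *\<^sub>R b)" by (simp only: euclidean_representation)
    then show "(\<Sum>b\<in>Basis. f b * ((x \<bullet> b) * 1)) = f x" by (simp add: sum scaleR mult.commute)
  qed
  have "poly_below (Suc (Suc 0)) (\<lambda>x. \<Sum>b\<in>Basis. f b * ((x \<bullet> b) * 1))"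
    by (rule poly_below_sum, rule poly_below_scale, rule poly_below.coord, assumption, rule poly_below.const)
  then show ?case unfolding eq ..
next
  case (add f g)
  then obtain m n where "poly_below m f" "poly_below n g" by auto
  then have "poly_below (max m n) (\<lambda>x. f x + g x)"
    by (auto intro!: poly_below.add intro: poly_below_mono)
  then show ?case ..
qed (auto intro: poly_below.intros poly_below_mult)

text \<open>
  Modulo polynomials of lower degree, the Euler field \<open>x \<bullet> \<nabla>\<close> multiplies a polynomial of degree
  \<open>n\<close> by \<open>n\<close>.
\<close>

lemma poly_below_derivative:
  assumes "poly_below m f" "m = Suc n"
  shows "\<exists>f'. (\<forall>x. (f has_derivative (\<lambda>v. f' v x)) (at x)) \<and> (\<forall>v. poly_below n (f' v)) \<and>
    poly_below n (\<lambda>x. f' x x - real n * f x)"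
  using assms
proof (induction arbitrary: n rule: poly_below.induct)
  case (zero m)
  show ?case by (rule exI[of _ "\<lambda>v x. 0"]) (auto intro: poly_below.intros)
next
  case (const m c)
  show ?case
  proof (rule exI[of _ "\<lambda>v x. 0"], intro conjI allI)
    show "poly_below n (\<lambda>x. 0 - real n * c)"
      by (cases n) (auto intro: poly_below.intros)
  qed (auto intro: poly_below.intros)
next
  case (add m f g)
  from add.IH(1)[OF add.prems] add.IH(2)[OF add.prems] obtain f' g' where
    "\<forall>x. (f has_derivative (\<lambda>v. f' v x)) (at x)" "\<forall>v. poly_below n (f' v)"
    "poly_below n (\<lambda>x. f' x x - real n * f x)"
    "\<forall>x. (g has_derivative (\<lambda>v. g' v x)) (at x)" "\<forall>v. poly_below n (g' v)"
    "poly_below n (\<lambda>x. g' x x - real n * g x)" by blast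
  then show ?case
    using poly_below.add[of n "\<lambda>x. f' x x - real n * f x" "\<lambda>x. g' x x - real n * g x"]
    by (intro exI[of _ "\<lambda>v x. f' v x + g' v x"])
      (auto intro!: has_derivative_add poly_below.add simp: algebra_simps)
next
  case (coord b m f)
  then have m: "m = n" by simp
  show ?case
  proof (cases n)
    case 0
    then have "f = (\<lambda>x. 0)" using coord.hyps m poly_below_0 by blast
    then show ?thesis by (intro exI[of _ "\<lambda>v x. 0"]) (auto intro: poly_below.intros)
  next
    case (Suc k)
    from coord.IH[of k] m Suc obtain f' where f': "\<forall>x. (f has_derivative (\<lambda>v. f' v x)) (at x)" "\<forall>v. poly_below k (f' v)"
      "poly_below k (\<lambda>x. f' x x - real k * f x)" by blast
    show ?thesis
    proof (rule exI[of _ "\<lambda>v x. (x \<bullet> b) * f' v x + (v \<bullet> b) * f x"], intro conjI allI)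
      show "((\<lambda>x. (x \<bullet> b) * f x) has_derivative (\<lambda>v. (x \<bullet> b) * f' v x + (v \<bullet> b) * f x)) (at x)" for x
        using f'(1) by (intro has_derivative_mult has_derivative_inner_left has_derivative_ident) auto
      show "poly_below n (\<lambda>x. (x \<bullet> b) * f' v x + (v \<bullet> b) * f x)" for v
        using f' coord m Suc by (auto intro!: poly_below.add poly_below.coord poly_below_scale)
      have "poly_below n (\<lambda>x. (x \<bullet> b) * (f' x x - real k * f x))"
        using f' coord m Suc by (auto intro!: poly_below.coord)
      then show "poly_below n (\<lambda>x. (x \<bullet> b) * f' x x + (x \<bullet> b) * f x - real n * ((x \<bullet> b) * f x))"
        by (simp add: Suc algebra_simps)
    qed
  qed
qed

lemma poly_below_has_derivative:
  assumes "poly_below n f"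
  shows "\<exists>f'. (\<forall>x. (f has_derivative (\<lambda>v. f' v x)) (at x)) \<and> (\<forall>v. poly_below n (f' v))"
  using poly_below_derivative[OF poly_below_Suc[OF assms] refl] by blast

lemma poly_below_continuous_on:
  assumes "poly_below n f"
  shows "continuous_on S f"
proof -
  obtain f' where "\<forall>x. (f has_derivative (\<lambda>v. f' v x)) (at x)" "\<forall>v. poly_below n (f' v)"
    using poly_below_has_derivative[OF assms] by blast
  then show ?thesis
    by (auto intro!: has_derivative_continuous_on[where f' = "\<lambda>x v. f' v x"] intro: has_derivative_at_withinI)
qed

lemma poly_below_Ck_on_1:
  assumes f: "poly_below n f"
  shows "Ck_on (Suc 0) f S"
proof -
  obtain f' where f'0: "\<forall>x. (f has_derivative (\<lambda>v. f' v x)) (at x)" "\<forall>v. poly_below n (f' v)"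
    using poly_below_has_derivative[OF f] by blast
  note f' = f'0(1)[rule_format] f'0(2)[rule_format]
  show ?thesis
    by (intro Ck_on_1_I[OF f'(1)] poly_below_continuous_on[OF f'(2)])
qed

text \<open>The differentiability that integration by parts needs of a function on the sphere.\<close>

definition sphere_C1 :: "('a::euclidean_space \<Rightarrow> real) \<Rightarrow> bool" where
  "sphere_C1 f \<longleftrightarrow> Ck_on (Suc 0) (\<lambda>y. f (sgn y)) (- {0})"

lemma has_derivative_sgn:
  fixes x :: "'a::euclidean_space"
  assumes "x \<noteq> 0"
  shows "(sgn has_derivative (\<lambda>v. inverse (norm x) *\<^sub>R (v - (v \<bullet> sgn x) *\<^sub>R sgn x))) (at x)"
proof -
  have "norm x \<noteq> 0" using assms by simp
  from has_derivative_scaleR[OF Deriv.has_derivative_inverse[OF this has_derivative_norm[OF assms]] has_derivative_ident]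
  have "((\<lambda>y. inverse (norm y) *\<^sub>R y) has_derivative
      (\<lambda>v. inverse (norm x) *\<^sub>R v + (- (inverse (norm x) * (v \<bullet> sgn x) * inverse (norm x))) *\<^sub>R x)) (at x)" .
  also have "(\<lambda>v. inverse (norm x) *\<^sub>R v + (- (inverse (norm x) * (v \<bullet> sgn x) * inverse (norm x))) *\<^sub>R x) =
      (\<lambda>v. inverse (norm x) *\<^sub>R (v - (v \<bullet> sgn x) *\<^sub>R sgn x))"
    by (auto simp: sgn_div_norm algebra_simps)
  also have "(\<lambda>y. inverse (norm y) *\<^sub>R y) = (sgn :: 'a \<Rightarrow> 'a)"
    by (auto simp: sgn_div_norm)
  finally show ?thesis .
qed

lemma continuous_on_sgn_nonzero: "continuous_on (- {0}) (sgn :: 'a::euclidean_space \<Rightarrow> 'a)"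
  by (intro continuous_intros) auto

lemma sphere_eq_sgn: "x \<in> sphere 0 1 \<Longrightarrow> sgn x = x" for x :: "'a::euclidean_space"
  by (simp add: sgn_div_norm)

lemma has_derivative_compose_sgn:
  fixes f :: "'a::euclidean_space \<Rightarrow> real"
  assumes f': "\<And>x. (f has_derivative (\<lambda>v. f' v x)) (at x)" and x: "x \<noteq> 0"
  shows "((\<lambda>y. f (sgn y)) has_derivative
    (\<lambda>v. f' (inverse (norm x) *\<^sub>R (v - (v \<bullet> sgn x) *\<^sub>R sgn x)) (sgn x))) (at x)"
  using has_derivative_compose[OF has_derivative_sgn[OF x] f'] .

lemma derivative_expand:
  fixes f :: "'a::euclidean_space \<Rightarrow> real"
  assumes f': "\<And>x. (f has_derivative (\<lambda>v. f' v x)) (at x)"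
  shows "f' v x = (\<Sum>b\<in>Basis. (v \<bullet> b) * f' b x)"
proof -
  have lin: "linear (\<lambda>v. f' v x)" using f' by (rule has_derivative_linear)
  have "f' v x = f' (\<Sum>b\<in>Basis. (v \<bullet> b) *\<^sub>R b) x" by (simp add: euclidean_representation)
  then show ?thesis by (simp add: linear_sum[OF lin] linear_scale[OF lin])
qed

lemma sphere_C1_poly_below:
  assumes f: "poly_below n f"
  shows "sphere_C1 f"
proof -
  obtain f' where f'0: "\<forall>x. (f has_derivative (\<lambda>v. f' v x)) (at x)" "\<forall>v. poly_below n (f' v)"
    using poly_below_has_derivative[OF f] by blast
  note f' = f'0(1)[rule_format] f'0(2)[rule_format]
  note expand = derivative_expand[OF f'(1)]
  have c: "continuous_on (- {0}) (\<lambda>x. f' b (sgn x))" for b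
    by (rule continuous_on_compose2[OF poly_below_continuous_on[OF f'(2), of UNIV] continuous_on_sgn_nonzero])
      auto
  show ?thesis
    unfolding sphere_C1_def
  proof (rule Ck_on_1_I)
    show "((\<lambda>y. f (sgn y)) has_derivative
        (\<lambda>v. f' (inverse (norm x) *\<^sub>R (v - (v \<bullet> sgn x) *\<^sub>R sgn x)) (sgn x))) (at x)" if "x \<in> - {0}" for x
      using has_derivative_compose_sgn[OF f'(1)] that by blast
    show "continuous_on (- {0}) (\<lambda>x. f' (inverse (norm x) *\<^sub>R (v - (v \<bullet> sgn x) *\<^sub>R sgn x)) (sgn x))" for v
      by (subst expand) (auto intro!: continuous_intros c continuous_on_sgn_nonzero)
  qed
qed

lemma sphere_C1_smooth: "sphere_smooth f \<Longrightarrow> sphere_C1 f"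
  unfolding sphere_C1_def sphere_smooth_def by blast

lemma sphere_C1_continuous_on:
  assumes "sphere_C1 f"
  shows "continuous_on (sphere 0 1) f"
proof (rule continuous_on_eq)
  show "continuous_on (sphere 0 1) (\<lambda>y. f (sgn y))"
    using Ck_on_1_continuous_on[OF assms[unfolded sphere_C1_def]] by (rule continuous_on_subset) auto
qed (simp add: sphere_eq_sgn)

lemma sphere_C1_grad_continuous_on:
  assumes "sphere_C1 f"
  shows "continuous_on (sphere 0 1) (sphere_grad f)"
  unfolding sphere_grad_def
  by (intro continuous_intros continuous_on_sphere_derivative assms[unfolded sphere_C1_def])

text \<open>
  The extension of a function on the sphere is constant along rays. This turns the tangential
  gradient into an ordinary one in Green's formula.
\<close>

lemma radial_derivative_zero:
  fixes f :: "'a::euclidean_space \<Rightarrow> real"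
  assumes f: "sphere_C1 f" and x: "x \<in> sphere 0 1"
  shows "frechet_derivative (\<lambda>y. f (sgn y)) (at x) x = 0"
proof -
  let ?F = "\<lambda>y. f (sgn y)"
  have "x \<noteq> 0" using x by auto
  then have d: "(?F has_derivative frechet_derivative ?F (at ((1 + 0) *\<^sub>R x))) (at ((1 + 0) *\<^sub>R x))"
    using Ck_on_1_has_derivative[OF f[unfolded sphere_C1_def]] by simp
  have "((\<lambda>t. (1 + t) *\<^sub>R x) has_vector_derivative x) (at (0::real))"
    by (auto intro!: derivative_eq_intros)
  from vector_derivative_diff_chain_within[OF this has_derivative_at_withinI[OF d]]
  have "((\<lambda>t. ?F ((1 + t) *\<^sub>R x)) has_real_derivative frechet_derivative ?F (at x) x) (at 0)"
    by (simp add: o_def has_real_derivative_iff_has_vector_derivative)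
  moreover have "((\<lambda>t. ?F ((1 + t) *\<^sub>R x)) has_real_derivative 0) (at 0)"
  proof (rule has_field_derivative_transform_within_open[OF DERIV_const])
    show "open {-1<..<(1::real)}" "0 \<in> {-1<..<(1::real)}" by auto
    show "?F x = ?F ((1 + t) *\<^sub>R x)" if "t \<in> {-1<..<1}" for t
      using that by (simp add: sgn_scaleR)
  qed
  ultimately show ?thesis by (rule DERIV_unique)
qed

lemma sphere_grad_inner:
  assumes f: "sphere_C1 f" and x: "x \<in> sphere 0 1"
  shows "sphere_grad f x \<bullet> v = frechet_derivative (\<lambda>y. f (sgn y)) (at x) v"
proof -
  have lin: "linear (frechet_derivative (\<lambda>y. f (sgn y)) (at x))"
    using f[unfolded sphere_C1_def] x by (rule Ck_on_1_derivative_linear)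
  have "frechet_derivative (\<lambda>y. f (sgn y)) (at x) v =
      frechet_derivative (\<lambda>y. f (sgn y)) (at x) (\<Sum>b\<in>Basis. (v \<bullet> b) *\<^sub>R b)"
    by (simp add: euclidean_representation)
  then show ?thesis
    by (simp add: linear_sum[OF lin] linear_scale[OF lin] sphere_grad_def inner_sum_left
        inner_commute[of v] mult.commute)
qed

lemma sphere_grad_eq:
  fixes f :: "'a::euclidean_space \<Rightarrow> real"
  assumes f': "\<And>x. (f has_derivative (\<lambda>v. f' v x)) (at x)" and x: "x \<in> sphere 0 1"
  shows "sphere_grad f x = (\<Sum>b\<in>Basis. f' b x *\<^sub>R b) - f' x x *\<^sub>R x"
proof -
  have x0: "x \<noteq> 0" using x by auto
  have lin: "linear (\<lambda>v. f' v x)" using f' by (rule has_derivative_linear)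
  have "frechet_derivative (\<lambda>y. f (sgn y)) (at x) v = f' v x - (v \<bullet> x) * f' x x" for v
    using frechet_derivative_at[OF has_derivative_compose_sgn[OF f' x0]] x
    by (simp add: sphere_eq_sgn linear_diff[OF lin] linear_scale[OF lin])
      (metis)
  then have "sphere_grad f x = (\<Sum>b\<in>Basis. f' b x *\<^sub>R b) - f' x x *\<^sub>R (\<Sum>b\<in>Basis. (x \<bullet> b) *\<^sub>R b)"
    unfolding sphere_grad_def by (simp add: sum_subtractf scaleR_diff_left scaleR_sum_right inner_commute mult.commute)
  then show ?thesis by (simp add: euclidean_representation)
qed

text \<open>The eigenvalue \<open>n (n + d - 1)\<close>, where \<open>d + 1\<close> is the dimension of the ambient space.\<close>

abbreviation sphere_ev :: "'a::euclidean_space itself \<Rightarrow> nat \<Rightarrow> real" where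
  "sphere_ev _ n \<equiv> real n * (real n + real DIM('a) - 2)"

text \<open>
  The Laplacian of the sphere maps polynomials of degree at most \<open>n\<close> to themselves and acts on
  them, modulo lower degree, as multiplication by \<open>- n (n + d - 1)\<close>. This is its weak form, with
  \<open>- q\<close> as the lower order part. It comes from integrating the products of \<open>\<phi>\<close> with the partial
  derivatives of \<open>p\<close> by parts. The radial derivatives that appear are evaluated by Euler's relation,
  for \<open>p\<close> and for its partial derivatives, and contribute \<open>n d\<close> and \<open>n (n - 1)\<close>.
\<close>

lemma sphere_Green_poly:
  fixes p :: "'a::euclidean_space \<Rightarrow> real"
  assumes p: "poly_below (Suc n) p"
  obtains q where "poly_below n q"
    "\<And>\<phi>. sphere_C1 \<phi> \<Longrightarrow> (LINT x|surface_measure. sphere_grad \<phi> x \<bullet> sphere_grad p x) =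
      (LINT x|surface_measure. \<phi> x * (sphere_ev TYPE('a) n * p x + q x))"
proof -
  obtain p' where p'0: "\<forall>x. (p has_derivative (\<lambda>v. p' v x)) (at x)" "\<forall>v. poly_below n (p' v)"
    "poly_below n (\<lambda>x. p' x x - real n * p x)"
    using poly_below_derivative[OF p refl] by blast
  note p' = p'0(1)[rule_format] p'0(2)[rule_format] p'0(3)
  have ex: "\<exists>p''. (\<forall>x. (p' i has_derivative (\<lambda>v. p'' v x)) (at x)) \<and> (\<forall>v. poly_below n (p'' v)) \<and>
    poly_below n (\<lambda>x. (x \<bullet> i) * (p'' x x - (real n - 1) * p' i x))" for i
  proof (cases n)
    case 0
    then have "p' i = (\<lambda>x. 0)" using p'(2) poly_below_0 by blast
    then show ?thesis by (intro exI[of _ "\<lambda>v x. 0"]) (auto intro: poly_below.intros)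
  next
    case (Suc k)
    then obtain p'' where "\<forall>x. (p' i has_derivative (\<lambda>v. p'' v x)) (at x)" "\<forall>v. poly_below k (p'' v)"
      "poly_below k (\<lambda>x. p'' x x - real k * p' i x)"
      using poly_below_derivative[of n "p' i" k] p'(2) by auto
    then show ?thesis
      using Suc by (intro exI[of _ p'']) (auto intro: poly_below_Suc poly_below_inner)
  qed
  from choice[OF allI[OF ex]] obtain p'' where p''0:
    "\<forall>i. (\<forall>x. (p' i has_derivative (\<lambda>v. p'' i v x)) (at x)) \<and> (\<forall>v. poly_below n (p'' i v)) \<and>
      poly_below n (\<lambda>x. (x \<bullet> i) * (p'' i x x - (real n - 1) * p' i x))" ..
  note p'' = p''0[rule_format, THEN conjunct1, rule_format] p''0[rule_format, THEN conjunct2, THEN conjunct1, rule_format]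
    p''0[rule_format, THEN conjunct2, THEN conjunct2]
  define D where "D = real DIM('a)"
  define q where "q = (\<lambda>x. (D - 1 + (real n - 1)) * (p' x x - real n * p x) +
      ((\<Sum>i\<in>Basis. (x \<bullet> i) * (p'' i x x - (real n - 1) * p' i x)) - (\<Sum>i\<in>Basis. p'' i i x)))"
  have q: "poly_below n q"
    unfolding q_def
    by (rule poly_below.add, rule poly_below_scale, rule p', rule poly_below_diff;
        rule poly_below_sum, rule p'')
  have id: "(D - 1) * p' x x + ((\<Sum>i\<in>Basis. (x \<bullet> i) * p'' i x x) - (\<Sum>i\<in>Basis. p'' i i x)) =
      sphere_ev TYPE('a) n * p x + q x" for x
  proof -
    have e: "(\<Sum>i\<in>Basis. (x \<bullet> i) * (p'' i x x - (real n - 1) * p' i x)) =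
        (\<Sum>i\<in>Basis. (x \<bullet> i) * p'' i x x) - (real n - 1) * p' x x"
      by (subst (2) derivative_expand[OF p'(1)])
        (simp add: sum_subtractf[symmetric] sum_distrib_left algebra_simps)
    show ?thesis unfolding q_def e D_def[symmetric] by (simp add: algebra_simps)
  qed
  show thesis
  proof (rule that[OF q])
    fix \<phi> :: "'a \<Rightarrow> real" assume \<phi>: "sphere_C1 \<phi>"
    define F where "F = (\<lambda>y. \<phi> (sgn y))"
    define dF where "dF = (\<lambda>x. frechet_derivative F (at x))"
    have F: "Ck_on (Suc 0) F (- {0})" using \<phi> by (simp add: F_def sphere_C1_def)
    have pi: "Ck_on (Suc 0) (p' i) (- {0})" for i by (rule poly_below_Ck_on_1[OF p'(2)])
    have dpi: "frechet_derivative (p' i) (at x) = (\<lambda>v. p'' i v x)" for i x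
      using frechet_derivative_at[OF p''(1)] by simp
    let ?H = "\<lambda>i y. F y * p' i y"
    have H: "Ck_on (Suc 0) (?H i) (- {0})" for i by (intro Ck_on_1_mult F pi)
    have dH: "frechet_derivative (?H i) (at x) v = F x * p'' i v x + dF x v * p' i x"
      if "x \<in> sphere 0 1" for i x v
    proof -
      have "x \<noteq> 0" using that by auto
      then show ?thesis using Ck_on_1_mult(2)[OF F pi, of x i] by (simp add: dF_def dpi)
    qed
    have cH: "continuous_on (sphere 0 1) (?H i)" for i
      using Ck_on_1_continuous_on[OF H] by (rule continuous_on_subset) auto
    have c\<phi>: "continuous_on (sphere 0 1) \<phi>" using \<phi> by (rule sphere_C1_continuous_on)
    note int = continuous_on_sphere_integrable[OF _ order_refl borel_closed[OF closed_sphere]]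
    have "(LINT x|surface_measure. (\<Sum>i\<in>Basis. frechet_derivative (?H i) (at x) (i - (x \<bullet> i) *\<^sub>R x))) =
        (\<Sum>i\<in>Basis. (LINT x|surface_measure. frechet_derivative (?H i) (at x) (i - (x \<bullet> i) *\<^sub>R x)))"
      by (intro Bochner_Integration.integral_sum int continuous_on_sphere_derivative H continuous_intros)
    also have "\<dots> = (\<Sum>i\<in>Basis. (D - 1) * (LINT x|surface_measure. (x \<bullet> i) * ?H i x))"
      unfolding D_def by (intro sum.cong refl surface_integration_by_parts H)
    also have "\<dots> = (LINT x|surface_measure. (D - 1) * (\<Sum>i\<in>Basis. (x \<bullet> i) * ?H i x))"
      using cH by (simp add: sum_distrib_left[symmetric] int continuous_intros)
    finally have main: "(LINT x|surface_measure. (\<Sum>i\<in>Basis. frechet_derivative (?H i) (at x) (i - (x \<bullet> i) *\<^sub>R x))) =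
        (LINT x|surface_measure. (D - 1) * (\<Sum>i\<in>Basis. (x \<bullet> i) * ?H i x))" .
    \<comment> \<open>The product rule. Only the tangential gradient of \<open>p\<close> is seen by \<open>\<phi>\<close>, whose radial derivative vanishes.\<close>
    have pt: "(\<Sum>i\<in>Basis. frechet_derivative (?H i) (at x) (i - (x \<bullet> i) *\<^sub>R x)) =
        sphere_grad \<phi> x \<bullet> sphere_grad p x - \<phi> x * ((\<Sum>i\<in>Basis. (x \<bullet> i) * p'' i x x) - (\<Sum>i\<in>Basis. p'' i i x))"
      if x: "x \<in> sphere 0 1" for x
    proof -
      have lin: "linear (dF x)"
        unfolding dF_def using F x by (rule Ck_on_1_derivative_linear)
      have lin': "linear (\<lambda>v. p'' i v x)" for i using p''(1) by (rule has_derivative_linear)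
      have rad: "dF x x = 0" unfolding dF_def F_def by (rule radial_derivative_zero[OF \<phi> x])
      have Fx: "F x = \<phi> x" using x by (simp add: F_def sphere_eq_sgn)
      have "sphere_grad \<phi> x \<bullet> sphere_grad p x = dF x (sphere_grad p x)"
        unfolding dF_def F_def by (rule sphere_grad_inner[OF \<phi> x])
      also have "\<dots> = (\<Sum>i\<in>Basis. p' i x * dF x i)"
        unfolding sphere_grad_eq[OF p'(1) x]
        by (simp add: linear_diff[OF lin] linear_sum[OF lin] linear_scale[OF lin] rad)
      finally have g: "sphere_grad \<phi> x \<bullet> sphere_grad p x = (\<Sum>i\<in>Basis. p' i x * dF x i)" .
      show ?thesis
        unfolding g
        by (simp add: dH[OF x] Fx linear_diff[OF lin] linear_scale[OF lin] linear_diff[OF lin']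
            linear_scale[OF lin'] rad sum.distrib sum_subtractf sum_distrib_left algebra_simps)
    qed
    have ig: "integrable surface_measure (\<lambda>x. sphere_grad \<phi> x \<bullet> sphere_grad p x)"
      by (intro int continuous_intros sphere_C1_grad_continuous_on \<phi> sphere_C1_poly_below[OF p])
    have cp'': "continuous_on (sphere 0 1) (\<lambda>x. p'' i x x)" for i
      by (subst derivative_expand[OF p''(1)])
        (intro continuous_intros poly_below_continuous_on[OF p''(2)])
    have ir: "integrable surface_measure
        (\<lambda>x. \<phi> x * ((\<Sum>i\<in>Basis. (x \<bullet> i) * p'' i x x) - (\<Sum>i\<in>Basis. p'' i i x)))"
      by (intro int continuous_intros c\<phi> cp'' poly_below_continuous_on[OF p''(2)])
    have il: "integrable surface_measure (\<lambda>x. (D - 1) * (\<Sum>i\<in>Basis. (x \<bullet> i) * ?H i x))"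
      by (intro int continuous_intros cH)
    have eq: "(LINT x|surface_measure. (\<Sum>i\<in>Basis. frechet_derivative (?H i) (at x) (i - (x \<bullet> i) *\<^sub>R x))) =
        (LINT x|surface_measure. sphere_grad \<phi> x \<bullet> sphere_grad p x) -
        (LINT x|surface_measure. \<phi> x * ((\<Sum>i\<in>Basis. (x \<bullet> i) * p'' i x x) - (\<Sum>i\<in>Basis. p'' i i x)))"
      by (subst Bochner_Integration.integral_diff[OF ig ir, symmetric])
        (intro Bochner_Integration.integral_cong refl pt, simp)
    have "(LINT x|surface_measure. sphere_grad \<phi> x \<bullet> sphere_grad p x) =
        (LINT x|surface_measure. (D - 1) * (\<Sum>i\<in>Basis. (x \<bullet> i) * ?H i x)) +
        (LINT x|surface_measure. \<phi> x * ((\<Sum>i\<in>Basis. (x \<bullet> i) * p'' i x x) - (\<Sum>i\<in>Basis. p'' i i x)))"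
      using main eq by linarith
    also have "\<dots> = (LINT x|surface_measure. (D - 1) * (\<Sum>i\<in>Basis. (x \<bullet> i) * ?H i x) +
        \<phi> x * ((\<Sum>i\<in>Basis. (x \<bullet> i) * p'' i x x) - (\<Sum>i\<in>Basis. p'' i i x)))"
      by (rule Bochner_Integration.integral_add[OF il ir, symmetric])
    also have "\<dots> = (LINT x|surface_measure. \<phi> x * (sphere_ev TYPE('a) n * p x + q x))"
    proof (intro Bochner_Integration.integral_cong refl)
      fix x :: 'a assume "x \<in> space surface_measure"
      then have Fx: "F x = \<phi> x" by (simp add: F_def sphere_eq_sgn)
      have "(\<Sum>i\<in>Basis. (x \<bullet> i) * ?H i x) = \<phi> x * p' x x"
        by (subst (2) derivative_expand[OF p'(1)]) (simp add: Fx sum_distrib_left mult_ac)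
      then show "(D - 1) * (\<Sum>i\<in>Basis. (x \<bullet> i) * ?H i x) +
          \<phi> x * ((\<Sum>i\<in>Basis. (x \<bullet> i) * p'' i x x) - (\<Sum>i\<in>Basis. p'' i i x)) =
          \<phi> x * (sphere_ev TYPE('a) n * p x + q x)"
        by (subst id[symmetric]) (simp add: algebra_simps)
    qed
    finally show "(LINT x|surface_measure. sphere_grad \<phi> x \<bullet> sphere_grad p x) =
      (LINT x|surface_measure. \<phi> x * (sphere_ev TYPE('a) n * p x + q x))" .
  qed
qed

section \<open>Spherical harmonics\<close>

text \<open>The monomials of degree \<open>n\<close> in the coordinates listed in \<open>bs\<close>.\<close>

fun monomials :: "'a::euclidean_space list \<Rightarrow> nat \<Rightarrow> ('a \<Rightarrow> real) list" where
  "monomials [] 0 = [\<lambda>x. 1]"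
| "monomials [] (Suc n) = []"
| "monomials (b # bs) 0 = monomials bs 0"
| "monomials (b # bs) (Suc n) = monomials bs (Suc n) @ map (\<lambda>f x. (x \<bullet> b) * f x) (monomials (b # bs) n)"

lemma length_monomials: "length (monomials (b # bs) n) = (n + length bs) choose n"
proof (induction "b # bs" n arbitrary: b bs rule: monomials.induct)
  case (3 b bs)
  then show ?case by (cases bs) auto
next
  case (4 b bs n)
  show ?case
  proof (cases bs)
    case (Cons c cs)
    then show ?thesis using 4(1)[OF Cons] 4(2) by (simp add: add.commute)
  qed (use 4(2) in simp)
qed

lemma monomials_0: "monomials bs 0 = [\<lambda>x. 1]"
  by (induction bs) auto

lemma monomials_poly_below:
  "set bs \<subseteq> Basis \<Longrightarrow> f \<in> set (monomials bs n) \<Longrightarrow> poly_below (Suc n) f"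
proof (induction bs n arbitrary: f rule: monomials.induct)
  case (4 b bs n)
  then show ?case by (auto intro!: poly_below.coord)
qed (auto simp: monomials_0 intro: poly_below.const)

lemma monomials_coord:
  "c \<in> set bs \<Longrightarrow> f \<in> set (monomials bs n) \<Longrightarrow> (\<lambda>x. (x \<bullet> c) * f x) \<in> set (monomials bs (Suc n))"
proof (induction bs n arbitrary: f rule: monomials.induct)
  case (3 b bs)
  then show ?case by (cases "c = b") auto
next
  case (4 b bs n)
  show ?case
  proof (cases "c = b")
    case True
    then show ?thesis using 4(4) by auto
  next
    case False
    then have c: "c \<in> set bs" using 4(3) by simp
    consider "f \<in> set (monomials bs (Suc n))"
      | g where "g \<in> set (monomials (b # bs) n)" "f = (\<lambda>x. (x \<bullet> b) * g x)"
      using 4(4) by auto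
    then show ?thesis
    proof cases
      case 1
      then show ?thesis using 4(1)[OF c] by auto
    next
      case 2
      then have "(\<lambda>x. (x \<bullet> c) * g x) \<in> set (monomials (b # bs) (Suc n))"
        using 4(2)[of g] c by auto
      then have "(\<lambda>x. (x \<bullet> b) * ((x \<bullet> c) * g x)) \<in> set (monomials (b # bs) (Suc (Suc n)))"
        by (subst monomials.simps(4)) (auto simp del: monomials.simps)
      then show ?thesis by (simp only: 2 mult.left_commute)
    qed
  qed
qed auto

definition basis_list :: "'a::euclidean_space list" where
  "basis_list = (SOME bs. distinct bs \<and> set bs = Basis)"

lemma basis_list: "distinct (basis_list :: 'a::euclidean_space list)" "set (basis_list :: 'a list) = Basis"
proof -
  have "\<exists>bs. distinct bs \<and> set bs = (Basis :: 'a set)"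
    using finite_distinct_list[OF finite_Basis] by blast
  from someI_ex[OF this] show "distinct (basis_list :: 'a list)" "set (basis_list :: 'a list) = Basis"
    by (auto simp: basis_list_def)
qed

lemma basis_list_Cons:
  obtains b bs where "hd (basis_list :: 'a::euclidean_space list) = b" "tl (basis_list :: 'a list) = bs"
    "b \<in> Basis" "set bs \<subseteq> Basis" "b \<notin> set bs" "Basis = insert b (set bs)" "Suc (length bs) = DIM('a)"
proof (cases "basis_list :: 'a list")
  case Nil
  then show ?thesis using basis_list(2)[where 'a = 'a] nonempty_Basis[where 'a = 'a] by simp
next
  case (Cons b bs)
  have d: "distinct (b # bs)" and S: "set (b # bs) = Basis"
    using basis_list[where 'a = 'a] unfolding Cons by blast+
  have "hd (basis_list :: 'a list) = b" "tl (basis_list :: 'a list) = bs" unfolding Cons by auto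
  moreover have "Suc (length bs) = DIM('a)"
    using distinct_card[OF d] S by simp
  moreover have "Basis = insert b (set bs)" "b \<notin> set bs" using d S by auto
  ultimately show ?thesis by (intro that[of b bs]) auto
qed

text \<open>
  On the sphere the square of the first coordinate can be eliminated. The monomials of degree \<open>n\<close>
  in which that coordinate occurs at most once therefore generate, modulo lower degree. Their number
  is the dimension of the space of spherical harmonics of degree \<open>n\<close>.
\<close>

fun harmonic_gens :: "nat \<Rightarrow> ('a::euclidean_space \<Rightarrow> real) list" where
  "harmonic_gens 0 = monomials (tl basis_list) 0"
| "harmonic_gens (Suc n) = monomials (tl basis_list) (Suc n) @
     map (\<lambda>f x. (x \<bullet> hd basis_list) * f x) (monomials (tl basis_list) n)"

definition gen_list :: "nat \<Rightarrow> ('a::euclidean_space \<Rightarrow> real) list" where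
  "gen_list n = concat (map harmonic_gens [0..<n])"

lemma gen_list_Suc: "gen_list (Suc n) = gen_list n @ harmonic_gens n"
  by (simp add: gen_list_def)

lemma set_gen_list: "set (gen_list n) = (\<Union>k<n. set (harmonic_gens k))"
  by (auto simp: gen_list_def)

lemma harmonic_gens_poly_below:
  fixes f :: "'a::euclidean_space \<Rightarrow> real"
  assumes "f \<in> set (harmonic_gens n)"
  shows "poly_below (Suc n) f"
proof -
  obtain b bs where b: "hd (basis_list :: 'a list) = b" "tl (basis_list :: 'a list) = bs"
    "b \<in> Basis" "set bs \<subseteq> Basis"
    by (rule basis_list_Cons)
  show ?thesis
  proof (cases n)
    case 0
    then show ?thesis using assms by (auto simp: monomials_0 intro: poly_below.const)
  next
    case (Suc k)
    then show ?thesis using assms b by (auto intro: poly_below.coord monomials_poly_below)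
  qed
qed

lemma gen_list_poly_below: "f \<in> set (gen_list n) \<Longrightarrow> poly_below n f"
  by (auto simp: set_gen_list dest!: harmonic_gens_poly_below intro: poly_below_mono)

text \<open>Linear combinations of members of \<open>A\<close>, as functions on the sphere only.\<close>

inductive sphere_span :: "('a::euclidean_space \<Rightarrow> real) set \<Rightarrow> ('a \<Rightarrow> real) \<Rightarrow> bool"
  for A where
  zero: "(\<And>x. x \<in> sphere 0 1 \<Longrightarrow> f x = 0) \<Longrightarrow> sphere_span A f"
| step: "g \<in> A \<Longrightarrow> sphere_span A h \<Longrightarrow> (\<And>x. x \<in> sphere 0 1 \<Longrightarrow> f x = c * g x + h x) \<Longrightarrow> sphere_span A f"

lemma sphere_span_base: "g \<in> A \<Longrightarrow> sphere_span A g"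
  by (rule sphere_span.step[where h = "\<lambda>x. 0" and c = 1]) (auto intro: sphere_span.zero)

lemma sphere_span_add:
  "sphere_span A f \<Longrightarrow> sphere_span A g \<Longrightarrow> (\<And>x. x \<in> sphere 0 1 \<Longrightarrow> h x = f x + g x) \<Longrightarrow> sphere_span A h"
proof (induction f arbitrary: h rule: sphere_span.induct)
  case (zero f)
  from \<open>sphere_span A g\<close> show ?case
  proof cases
    case zero
    then show ?thesis using \<open>\<And>x. x \<in> sphere 0 1 \<Longrightarrow> f x = 0\<close> \<open>\<And>x. x \<in> sphere 0 1 \<Longrightarrow> h x = f x + g x\<close>
      by (auto intro: sphere_span.zero)
  next
    case (step g' h' c)
    show ?thesis
      by (rule sphere_span.step[OF step(1,2), of _ c])
        (use step zero in auto)
  qed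
next
  case (step g' h' f c)
  have "sphere_span A (\<lambda>x. h' x + g x)" using step.IH[OF step.prems(1)] by simp
  then show ?case
    by (rule sphere_span.step[OF step.hyps(1), of _ _ c]) (simp add: step)
qed

lemma sphere_span_cong:
  "sphere_span A f \<Longrightarrow> (\<And>x. x \<in> sphere 0 1 \<Longrightarrow> g x = f x) \<Longrightarrow> sphere_span A g"
  by (rule sphere_span_add[of A f "\<lambda>x. 0"]) (auto intro: sphere_span.zero)

lemma sphere_span_scale: "sphere_span A f \<Longrightarrow> sphere_span A (\<lambda>x. c * f x)"
proof (induction f rule: sphere_span.induct)
  case (zero f)
  then show ?case by (auto intro: sphere_span.zero)
next
  case (step g h f c')
  show ?case by (rule sphere_span.step[OF step.hyps(1) step.IH, of _ "c * c'"]) (simp add: step algebra_simps)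
qed

lemma sphere_span_sum:
  "(\<And>i. i \<in> I \<Longrightarrow> sphere_span A (f i)) \<Longrightarrow> sphere_span A (\<lambda>x. \<Sum>i\<in>I. f i x)"
proof (induction I rule: infinite_finite_induct)
  case (insert i I)
  then show ?case by - (rule sphere_span_add[of A "f i" "\<lambda>x. \<Sum>i\<in>I. f i x"], auto)
qed (auto intro: sphere_span.zero)

lemma sphere_span_trans:
  "sphere_span A f \<Longrightarrow> (\<And>g. g \<in> A \<Longrightarrow> sphere_span B g) \<Longrightarrow> sphere_span B f"
proof (induction f rule: sphere_span.induct)
  case (zero f)
  then show ?case by (auto intro: sphere_span.zero)
next
  case (step g h f c)
  show ?case
    by (rule sphere_span_add[OF sphere_span_scale[OF step.prems[OF step.hyps(1)], of c] step.IH[OF step.prems]])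
      (simp_all add: step)
qed

lemma sphere_span_coeffs:
  assumes "sphere_span (Y ` {..<n}) f"
  shows "\<exists>c. \<forall>x\<in>sphere 0 1. f x = (\<Sum>i<n::nat. c i * Y i x)"
  using assms
proof (induction f rule: sphere_span.induct)
  case (zero f)
  then show ?case by (intro exI[of _ "\<lambda>i. 0"]) auto
next
  case (step g h f c)
  then obtain i c' where i: "i < n" "g = Y i" and c': "\<forall>x\<in>sphere 0 1. h x = (\<Sum>i<n. c' i * Y i x)" by blast
  have "(\<Sum>j<n. (c' j + (if j = i then c else 0)) * Y j x) = c * Y i x + (\<Sum>j<n. c' j * Y j x)" for x
    using i by (simp add: distrib_right sum.distrib if_distrib[of "\<lambda>a. a * _"] cong: if_cong)
  then show ?case using i c' step.hyps by (intro exI[of _ "\<lambda>j. c' j + (if j = i then c else 0)"]) auto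
qed

text \<open>
  The only product that leaves the generators is that of the first coordinate \<open>b\<close> with a generator
  that already contains it. There \<open>(x \<bullet> b)\<^sup>2\<close> is replaced by \<open>1\<close> minus the other squares.
\<close>

lemma harmonic_gens_coord_span:
  fixes g :: "'a::euclidean_space \<Rightarrow> real"
  assumes g: "g \<in> set (gen_list n)" and c: "c \<in> Basis"
  shows "sphere_span (set (gen_list (Suc n))) (\<lambda>x. (x \<bullet> c) * g x)"
proof -
  obtain b bs where b: "hd (basis_list :: 'a list) = b" "tl (basis_list :: 'a list) = bs"
    "b \<in> Basis" "b \<notin> set bs" "Basis = insert b (set bs)"
    by (rule basis_list_Cons)
  obtain k where k: "k < n" "g \<in> set (harmonic_gens k)" using g by (auto simp: set_gen_list)
  have up: "f \<in> set (gen_list (Suc n))" if "f \<in> set (harmonic_gens j)" "j \<le> Suc k" for f :: "'a \<Rightarrow> real" and j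
    using that k by (auto simp: set_gen_list intro: bexI[of _ j])
  have mono: "f \<in> set (gen_list (Suc n))" if "f \<in> set (monomials bs j)" "j \<le> Suc k" for f j
    using that by (intro up[of f j]) (cases j; auto simp: b)
  have mono': "(\<lambda>x. (x \<bullet> b) * f x) \<in> set (gen_list (Suc n))" if "f \<in> set (monomials bs k)" for f
    using that by (intro up[of _ "Suc k"]) (auto simp: b)
  consider "g \<in> set (monomials bs k)" | m j where "k = Suc j" "m \<in> set (monomials bs j)" "g = (\<lambda>x. (x \<bullet> b) * m x)"
    using k(2) by (cases k) (auto simp: b)
  then show ?thesis
  proof cases
    case 1
    show ?thesis
    proof (cases "c = b")
      case True
      then show ?thesis using mono'[OF 1] by (auto intro: sphere_span_base)
    next
      case False
      then have "c \<in> set bs" using c b by auto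
      from mono[OF monomials_coord[OF this 1]] show ?thesis by (auto intro: sphere_span_base)
    qed
  next
    case 2
    show ?thesis
    proof (cases "c = b")
      case False
      then have "c \<in> set bs" using c b by auto
      from mono'[OF monomials_coord[OF this 2(2), folded 2(1)]]
      have "sphere_span (set (gen_list (Suc n))) (\<lambda>x. (x \<bullet> b) * ((x \<bullet> c) * m x))"
        by (rule sphere_span_base)
      then show ?thesis by (simp only: 2(3) mult.left_commute)
    next
      case True
      have 1: "sphere_span (set (gen_list (Suc n))) m"
        using mono[OF 2(2)] 2(1) by (intro sphere_span_base) auto
      have 3: "sphere_span (set (gen_list (Suc n))) (\<lambda>x. (x \<bullet> a) * ((x \<bullet> a) * m x))" if "a \<in> set bs" for a
        using mono[OF monomials_coord[OF that monomials_coord[OF that 2(2)]]] 2(1)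
        by (intro sphere_span_base) auto
      show ?thesis
      proof (rule sphere_span_add[OF 1 sphere_span_scale[OF sphere_span_sum[OF 3], where c = "-1"]])
        fix x :: 'a assume x: "x \<in> sphere 0 1"
        have "1 = x \<bullet> x" using x by (simp add: norm_eq_1)
        also have "\<dots> = (\<Sum>a\<in>insert b (set bs). (x \<bullet> a) * (x \<bullet> a))"
          unfolding b(5)[symmetric] by (rule euclidean_inner)
        also have "\<dots> = (x \<bullet> b) * (x \<bullet> b) + (\<Sum>a\<in>set bs. (x \<bullet> a) * (x \<bullet> a))" using b(4) by simp
        finally have e: "(x \<bullet> b) * (x \<bullet> b) = 1 - (\<Sum>a\<in>set bs. (x \<bullet> a) * (x \<bullet> a))" by simp
        have "(x \<bullet> c) * g x = ((x \<bullet> b) * (x \<bullet> b)) * m x" using True 2(3) by simp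
        then show "(x \<bullet> c) * g x = m x + - 1 * (\<Sum>a\<in>set bs. (x \<bullet> a) * ((x \<bullet> a) * m x))"
          unfolding e by (simp add: left_diff_distrib sum_distrib_right mult.assoc)
      qed
    qed
  qed
qed

lemma poly_below_span:
  "poly_below n p \<Longrightarrow> sphere_span (set (gen_list n)) p"
proof (induction rule: poly_below.induct)
  case (const n c)
  have "(\<lambda>x. 1) \<in> set (gen_list (Suc n))"
    by (auto simp: set_gen_list monomials_0 intro: bexI[of _ 0])
  from sphere_span_scale[OF sphere_span_base[OF this], of c] show ?case by simp
next
  case (add n f g)
  then show ?case by - (rule sphere_span_add[of _ f g], auto)
next
  case (coord b n f)
  from coord.IH show ?case
  proof (induction f rule: sphere_span.induct)
    case (zero f)
    then show ?case by (intro sphere_span.zero) auto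
  next
    case (step g h f c)
    show ?case
      by (rule sphere_span_add[OF sphere_span_scale[OF harmonic_gens_coord_span[OF step.hyps(1) coord.hyps(1)], of c]
            step.IH]) (simp add: step algebra_simps)
  qed
qed (auto intro: sphere_span.zero)

definition harm_count :: "'a::euclidean_space itself \<Rightarrow> nat \<Rightarrow> nat" where
  "harm_count _ n = length (gen_list n :: ('a \<Rightarrow> real) list)"

lemma harm_count_0 [simp]: "harm_count TYPE('a::euclidean_space) 0 = 0"
  by (simp add: harm_count_def gen_list_def)

lemma harm_count_Suc:
  "harm_count TYPE('a::euclidean_space) (Suc n) =
     harm_count TYPE('a) n + length (harmonic_gens n :: ('a \<Rightarrow> real) list)"
  by (simp add: harm_count_def gen_list_Suc)

lemma length_harmonic_gens:
  assumes "DIM('a::euclidean_space) = Suc (Suc d)"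
  shows "length (harmonic_gens n :: ('a \<Rightarrow> real) list) =
    ((n + d) choose d) + (if n = 0 then 0 else (n - 1 + d) choose d)"
proof -
  obtain b bs where b: "tl (basis_list :: 'a list) = bs" "Suc (length bs) = DIM('a)"
    by (rule basis_list_Cons)
  then obtain c cs where bs: "bs = c # cs" "length cs = d" using assms by (cases bs) auto
  have "length (monomials (tl (basis_list :: 'a list)) k) = (k + d) choose d" for k
    using b bs by (simp add: length_monomials binomial_symmetric[of d "k + d"])
  then show ?thesis by (cases n) auto
qed

lemma harmonic_gens_nonempty:
  assumes "DIM('a::euclidean_space) \<ge> 2"
  shows "0 < length (harmonic_gens n :: ('a \<Rightarrow> real) list)"
proof -
  obtain d where "DIM('a) = Suc (Suc d)" using assms by (metis Suc_le_D numeral_2_eq_2 Suc_le_mono)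
  from length_harmonic_gens[OF this] show ?thesis by simp
qed

lemma harm_count_mono: "m \<le> n \<Longrightarrow> harm_count TYPE('a::euclidean_space) m \<le> harm_count TYPE('a) n"
  by (induction n rule: dec_induct) (auto simp: harm_count_Suc)

lemma harm_count_ge:
  assumes "DIM('a::euclidean_space) \<ge> 2"
  shows "n \<le> harm_count TYPE('a) n"
proof (induction n)
  case (Suc n)
  then show ?case using harmonic_gens_nonempty[OF assms, of n] unfolding harm_count_Suc by linarith
qed simp

text \<open>
  The generators are enumerated by degree. An index of degree at most \<open>n\<close> is one below
  \<open>harm_count _ (Suc n)\<close>.
\<close>

definition harm_gen :: "nat \<Rightarrow> 'a::euclidean_space \<Rightarrow> real" where
  "harm_gen i = gen_list (Suc i) ! i"

definition harm_deg :: "'a::euclidean_space itself \<Rightarrow> nat \<Rightarrow> nat" where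
  "harm_deg _ i = (LEAST n. i < harm_count TYPE('a) (Suc n))"

text \<open>
  Orthonormalising in order of degree makes each \<open>harmonic i\<close> orthogonal to all polynomials of lower
  degree, which characterises spherical harmonics among the polynomials of degree at most \<open>harm_deg _ i\<close>.
\<close>

definition harmonic :: "nat \<Rightarrow> 'a::euclidean_space \<Rightarrow> real" where
  "harmonic = gram_schmidt surface_measure harm_gen"

lemma gen_list_nth:
  "m \<le> n \<Longrightarrow> i < length (gen_list m :: ('a::euclidean_space \<Rightarrow> real) list) \<Longrightarrow>
   (gen_list n :: ('a \<Rightarrow> real) list) ! i = gen_list m ! i"
proof (induction n rule: dec_induct)
  case (step n)
  then have "i < length (gen_list n :: ('a \<Rightarrow> real) list)"
    using harm_count_mono[of m n, where 'a = 'a] by (simp add: harm_count_def)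
  then show ?case using step by (simp add: gen_list_Suc nth_append)
qed simp

context
  assumes dim2: "DIM('a::euclidean_space) \<ge> 2"
begin

lemma harm_gen_nth:
  assumes "i < harm_count TYPE('a) n"
  shows "(harm_gen i :: 'a \<Rightarrow> real) = gen_list n ! i"
proof (cases "n \<le> Suc i")
  case True
  then show ?thesis using assms gen_list_nth[OF True] by (simp add: harm_gen_def harm_count_def)
next
  case False
  have "i < harm_count TYPE('a) (Suc i)" using harm_count_ge[OF dim2, of "Suc i"] by simp
  then show ?thesis using False gen_list_nth[of "Suc i" n i, where 'a = 'a] by (simp add: harm_gen_def harm_count_def)
qed

lemma harm_gen_image: "(harm_gen :: nat \<Rightarrow> 'a \<Rightarrow> real) ` {..<harm_count TYPE('a) n} = set (gen_list n)"
  using harm_gen_nth[of _ n] by (force simp: set_conv_nth harm_count_def)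

lemma harm_deg:
  "i < harm_count TYPE('a) (Suc (harm_deg TYPE('a) i))" "harm_deg TYPE('a) i < n \<longleftrightarrow> i < harm_count TYPE('a) n"
proof -
  have ex: "i < harm_count TYPE('a) (Suc i)" using harm_count_ge[OF dim2, of "Suc i"] by simp
  then show 1: "i < harm_count TYPE('a) (Suc (harm_deg TYPE('a) i))"
    unfolding harm_deg_def by (rule LeastI)
  show "harm_deg TYPE('a) i < n \<longleftrightarrow> i < harm_count TYPE('a) n"
  proof
    assume "harm_deg TYPE('a) i < n"
    then have "harm_count TYPE('a) (Suc (harm_deg TYPE('a) i)) \<le> harm_count TYPE('a) n"
      by (intro harm_count_mono) simp
    then show "i < harm_count TYPE('a) n" using 1 by simp
  next
    assume i: "i < harm_count TYPE('a) n"
    then obtain m where m: "n = Suc m" by (cases n) auto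
    then have "harm_deg TYPE('a) i \<le> m" unfolding harm_deg_def using i by (intro Least_le) simp
    then show "harm_deg TYPE('a) i < n" using m by simp
  qed
qed

lemma harm_gen_poly_below:
  "i < harm_count TYPE('a) n \<Longrightarrow> poly_below n (harm_gen i :: 'a \<Rightarrow> real)"
  by (intro gen_list_poly_below) (auto simp flip: harm_gen_image)

lemma harmonic_poly_below:
  assumes "i < harm_count TYPE('a) n"
  shows "poly_below n (harmonic i :: 'a \<Rightarrow> real)" "poly_below n (gs_residual surface_measure harm_gen i :: 'a \<Rightarrow> real)"
proof -
  have f: "poly_below n (harm_gen k :: 'a \<Rightarrow> real)" if "k \<le> i" for k
    using that assms by (intro harm_gen_poly_below) simp
  note gs = gram_schmidt_induct[where P = "poly_below n", OF poly_below.zero poly_below.add poly_below_scale f]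
  show "poly_below n (harmonic i :: 'a \<Rightarrow> real)"
    unfolding harmonic_def by (rule gs(2))
  show "poly_below n (gs_residual surface_measure harm_gen i :: 'a \<Rightarrow> real)"
    by (rule gs(1))
qed

lemma harmonic_poly_below_deg: "poly_below (Suc (harm_deg TYPE('a) i)) (harmonic i :: 'a \<Rightarrow> real)"
  by (intro harmonic_poly_below harm_deg)

lemma sqint_poly_below:
  "poly_below n f \<Longrightarrow> sqint surface_measure f"
  by (intro continuous_on_surface_sqint poly_below_continuous_on)

lemma sqint_harm_gen: "sqint surface_measure (harm_gen i :: 'a \<Rightarrow> real)"
  by (rule sqint_poly_below[OF harm_gen_poly_below[OF harm_deg(1)]])

lemma sqint_harmonic: "sqint surface_measure (harmonic i :: 'a \<Rightarrow> real)"
  by (rule sqint_poly_below[OF harmonic_poly_below_deg])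

lemma harmonic_normed:
  "ip surface_measure (harmonic i :: 'a \<Rightarrow> real) (harmonic i) = 1 \<or> (harmonic i :: 'a \<Rightarrow> real) = (\<lambda>x. 0)"
  unfolding harmonic_def by (intro gram_schmidt_normed sqint_harm_gen)

lemma harmonic_norm_le: "ip surface_measure (harmonic i :: 'a \<Rightarrow> real) (harmonic i) \<le> 1"
  using harmonic_normed[of i] by (auto simp: ip_def)

lemma harmonic_orthogonal:
  "i \<noteq> j \<Longrightarrow> ip surface_measure (harmonic i :: 'a \<Rightarrow> real) (harmonic j) = 0"
  unfolding harmonic_def by (intro gram_schmidt_orthogonal sqint_harm_gen)

text \<open>
  A residual of norm zero vanishes on the whole sphere by continuity, so that the generators are
  recovered pointwise and not only almost everywhere.
\<close>

lemma harm_gen_span: "sphere_span (harmonic ` {..i}) (harm_gen i :: 'a \<Rightarrow> real)"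
proof -
  let ?r = "gs_residual surface_measure harm_gen i :: 'a \<Rightarrow> real"
  have Y: "sphere_span (harmonic ` {..i}) (harmonic k :: 'a \<Rightarrow> real)" if "k \<le> i" for k
    using that by (intro sphere_span_base) auto
  have r: "sphere_span (harmonic ` {..i}) ?r"
  proof (cases "ip surface_measure ?r ?r = 0")
    case True
    have cr: "continuous_on (sphere 0 1) ?r"
      by (rule poly_below_continuous_on[OF harmonic_poly_below(2)[OF harm_deg(1)]])
    have "(?r x)\<^sup>2 = 0" if "x \<in> sphere 0 1" for x
      using surface_integral_zero_imp[of "\<lambda>x. (?r x)\<^sup>2" x] cr that True
      by (auto simp: ip_self intro!: continuous_intros)
    then show ?thesis by (intro sphere_span.zero) simp
  next
    case False
    then have "\<And>x. ?r x = sqrt (ip surface_measure ?r ?r) * harmonic i x"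
      unfolding harmonic_def by (subst gram_schmidt_eq) simp
    then show ?thesis by (rule sphere_span_cong[OF sphere_span_scale[OF Y[OF order_refl]]])
  qed
  show ?thesis
    by (rule sphere_span_add[OF r sphere_span_sum[OF sphere_span_scale[OF Y],
            where I = "{..<i}" and c1 = "\<lambda>k. ip surface_measure (harm_gen i) (harmonic k :: 'a \<Rightarrow> real)"]])
      (auto simp: gs_residual_def harmonic_def)
qed

lemma poly_below_expansion:
  fixes p :: "'a \<Rightarrow> real"
  assumes p: "poly_below n p" and x: "x \<in> sphere 0 1"
  shows "p x = (\<Sum>i<harm_count TYPE('a) n. ip surface_measure p (harmonic i) * harmonic i x)"
proof -
  let ?M = "harm_count TYPE('a) n"
  have "sphere_span (harmonic ` {..<?M}) p"
  proof (rule sphere_span_trans[OF poly_below_span[OF p]])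
    fix g assume "g \<in> set (gen_list n :: ('a \<Rightarrow> real) list)"
    then obtain i where i: "i < ?M" "g = harm_gen i" by (auto simp flip: harm_gen_image)
    show "sphere_span (harmonic ` {..<?M}) g"
      unfolding i(2) by (rule sphere_span_trans[OF harm_gen_span]) (use i in \<open>auto intro: sphere_span_base\<close>)
  qed
  then obtain c where c: "\<forall>x\<in>sphere 0 1. p x = (\<Sum>i<?M. c i * harmonic i x)"
    using sphere_span_coeffs by blast
  have "ip surface_measure p (harmonic k) * harmonic k x = c k * harmonic k x" if k: "k < ?M" for k
  proof -
    have "ip surface_measure p (harmonic k) = ip surface_measure (\<lambda>x::'a. \<Sum>i<?M. c i *\<^sub>R harmonic i x) (harmonic k)"
      using c by (intro ip_cong) auto
    also have "\<dots> = (\<Sum>i<?M. c i * ip surface_measure (harmonic i :: 'a \<Rightarrow> real) (harmonic k))"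
      by (intro ip_lincomb_left sqint_harmonic)
    also have "\<dots> = (\<Sum>i<?M. if i = k then c k * ip surface_measure (harmonic k :: 'a \<Rightarrow> real) (harmonic k) else 0)"
      by (intro sum.cong) (auto simp: harmonic_orthogonal)
    finally show ?thesis using k harmonic_normed[of k] by auto
  qed
  then have "(\<Sum>i<?M. ip surface_measure p (harmonic i) * harmonic i x) = (\<Sum>i<?M. c i * harmonic i x)"
    by (intro sum.cong) auto
  then show ?thesis using c x by simp
qed

lemma harmonic_orthogonal_poly_below:
  fixes p :: "'a \<Rightarrow> real"
  assumes p: "poly_below n p" and i: "harm_count TYPE('a) n \<le> i"
  shows "ip surface_measure p (harmonic i) = 0"
proof -
  have "ip surface_measure p (harmonic i) =
      ip surface_measure (\<lambda>x::'a. \<Sum>k<harm_count TYPE('a) n. ip surface_measure p (harmonic k) *\<^sub>R harmonic k x) (harmonic i)"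
    using poly_below_expansion[OF p] by (intro ip_cong) auto
  also have "\<dots> = (\<Sum>k<harm_count TYPE('a) n. ip surface_measure p (harmonic k) * ip surface_measure (harmonic k :: 'a \<Rightarrow> real) (harmonic i))"
    by (intro ip_lincomb_left sqint_harmonic)
  also have "\<dots> = 0"
    using i by (intro sum.neutral) (auto simp: harmonic_orthogonal)
  finally show ?thesis .
qed

text \<open>
  By the weak formula for the Laplacian, \<open>\<Delta>Y + \<Lambda> Y\<close> is a polynomial \<open>-q\<close> of lower degree
  than \<open>Y\<close>. Since the Laplacian is symmetric and does not raise degrees, \<open>q\<close> is orthogonal to itself.
\<close>

lemma harmonic_eigenfunction:
  fixes \<phi> :: "'a \<Rightarrow> real"
  assumes \<phi>: "sphere_C1 \<phi>"
  shows "ip surface_measure (sphere_grad \<phi>) (sphere_grad (harmonic i)) =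
    sphere_ev TYPE('a) (harm_deg TYPE('a) i) * ip surface_measure \<phi> (harmonic i)"
proof -
  let ?n = "harm_deg TYPE('a) i" and ?Y = "harmonic i :: 'a \<Rightarrow> real"
  have in_: "harm_count TYPE('a) ?n \<le> i" using harm_deg(2)[of i ?n] by simp
  obtain q where q: "poly_below ?n q"
    "\<And>\<phi>. sphere_C1 \<phi> \<Longrightarrow> (LINT x|surface_measure. sphere_grad \<phi> x \<bullet> sphere_grad ?Y x) =
      (LINT x|surface_measure. \<phi> x * (sphere_ev TYPE('a) ?n * ?Y x + q x))"
    using sphere_Green_poly[OF harmonic_poly_below_deg] by blast
  have green: "ip surface_measure (sphere_grad \<phi>) (sphere_grad ?Y) =
      sphere_ev TYPE('a) ?n * ip surface_measure \<phi> ?Y + ip surface_measure \<phi> q" if "sphere_C1 \<phi>" for \<phi>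
  proof -
    have s: "sqint surface_measure \<phi>"
      by (intro continuous_on_surface_sqint sphere_C1_continuous_on that)
    have "ip surface_measure (sphere_grad \<phi>) (sphere_grad ?Y) =
        ip surface_measure \<phi> (\<lambda>x. sphere_ev TYPE('a) ?n *\<^sub>R ?Y x + q x)"
      unfolding ip_def using q(2)[OF that] by simp
    also have "\<dots> = ip surface_measure \<phi> (\<lambda>x. sphere_ev TYPE('a) ?n *\<^sub>R ?Y x) + ip surface_measure \<phi> q"
      by (intro ip_add_right sqint_scale sqint_harmonic sqint_poly_below[OF q(1)] s)
    also have "ip surface_measure \<phi> (\<lambda>x. sphere_ev TYPE('a) ?n *\<^sub>R ?Y x) = sphere_ev TYPE('a) ?n * ip surface_measure \<phi> ?Y"
      by (rule ip_scale_right)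
    finally show ?thesis .
  qed
  have qq: "ip surface_measure q q = 0"
  proof (cases ?n)
    case 0
    then have "q = (\<lambda>x. 0)" using q(1) poly_below_0 by simp
    then show ?thesis by (simp add: ip_def)
  next
    case (Suc m)
    then have "poly_below (Suc m) q" using q(1) by simp
    then obtain q' where q': "poly_below m q'"
      "\<And>\<phi>. sphere_C1 \<phi> \<Longrightarrow> (LINT x|surface_measure. sphere_grad \<phi> x \<bullet> sphere_grad q x) =
        (LINT x|surface_measure. \<phi> x * (sphere_ev TYPE('a) m * q x + q' x))"
      using sphere_Green_poly by blast
    have "poly_below ?n (\<lambda>x. sphere_ev TYPE('a) m * q x + q' x)"
      unfolding Suc
      by (rule poly_below.add[OF poly_below_scale[OF \<open>poly_below (Suc m) q\<close>] poly_below_Suc[OF q'(1)]])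
    from harmonic_orthogonal_poly_below[OF this in_]
    have "ip surface_measure ?Y (\<lambda>x. sphere_ev TYPE('a) m * q x + q' x) = 0" by (simp add: ip_commute)
    then have "ip surface_measure (sphere_grad ?Y) (sphere_grad q) = 0"
      using q'(2)[OF sphere_C1_poly_below[OF harmonic_poly_below_deg]] by (simp add: ip_def)
    moreover have "ip surface_measure q ?Y = 0" by (rule harmonic_orthogonal_poly_below[OF q(1) in_])
    ultimately show ?thesis
      using green[OF sphere_C1_poly_below[OF q(1)]] by (simp add: ip_commute)
  qed
  have "ip surface_measure \<phi> q = 0"
    by (rule ip_eq_zero_if_norm_zero[OF continuous_on_surface_sqint[OF sphere_C1_continuous_on[OF \<phi>]]
          sqint_poly_below[OF q(1)] qq])
  with green[OF \<phi>] show ?thesis by simp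
qed

end

section \<open>The addition theorem\<close>

lemma reflection_exists:
  fixes x y :: "'a::euclidean_space"
  assumes "norm x = 1" "norm y = 1"
  obtains T where "orthogonal_transformation T" "\<And>z. T (T z) = z" "T x = y"
proof (cases "x = y")
  case True
  show ?thesis by (rule that[of "\<lambda>z. z"]) (auto simp: True)
next
  case False
  define v where "v = x - y"
  define k where "k = 2 / (v \<bullet> v)"
  have v: "v \<bullet> v \<noteq> 0" using False by (simp add: v_def)
  then have k: "k * (v \<bullet> v) = 2" by (simp add: k_def)
  define T where "T = (\<lambda>z. z - (k * (z \<bullet> v)) *\<^sub>R v)"
  have Tv: "T z \<bullet> v = - (z \<bullet> v)" for z
  proof -
    have "T z \<bullet> v = z \<bullet> v - (z \<bullet> v) * (k * (v \<bullet> v))" by (simp add: T_def inner_diff_left)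
    then show ?thesis unfolding k by simp
  qed
  show ?thesis
  proof (rule that[of T])
    show "orthogonal_transformation T"
      unfolding orthogonal_transformation_def
    proof (intro conjI allI)
      show "linear T"
        by (rule linearI) (simp_all add: T_def inner_add_left scaleR_left_distrib scaleR_right_diff_distrib distrib_left)
      fix a b
      have "T a \<bullet> T b = T a \<bullet> b - k * (b \<bullet> v) * (T a \<bullet> v)"
        by (subst (2) T_def) (simp add: inner_diff_right)
      also have "\<dots> = a \<bullet> b"
        unfolding Tv by (simp add: T_def inner_diff_left inner_commute[of v])
      finally show "T a \<bullet> T b = a \<bullet> b" .
    qed
    show "T (T z) = z" for z
      by (subst T_def) (simp add: Tv, simp add: T_def)
    have "x \<bullet> x = 1" "y \<bullet> y = 1" using assms by (simp_all add: norm_eq_1)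
    then have "2 * (x \<bullet> v) = v \<bullet> v"
      by (simp add: v_def inner_diff_left inner_diff_right inner_commute)
    then have "k * (x \<bullet> v) = 1" using v by (simp add: k_def)
    then show "T x = y" by (simp add: T_def v_def)
  qed
qed

context
  assumes dim2: "DIM('a::euclidean_space) \<ge> 2"
begin

text \<open>
  A reflection \<open>T\<close> acts on the polynomials of bounded degree by a matrix \<open>a\<close> that is symmetric,
  because \<open>T\<close> is an isometry and its own inverse. This moves \<open>T\<close> from one factor to the other in
  the sum of squares, where it cancels. Reflections act transitively on the sphere.
\<close>

lemma harmonic_sum_squares_constant:
  fixes x y :: 'a
  assumes x: "x \<in> sphere 0 1" and y: "y \<in> sphere 0 1"
  shows "(\<Sum>i<harm_count TYPE('a) n. (harmonic i x)\<^sup>2) = (\<Sum>i<harm_count TYPE('a) n. (harmonic i y)\<^sup>2)"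
proof -
  let ?M = "harm_count TYPE('a) n" and ?Y = "harmonic :: nat \<Rightarrow> 'a \<Rightarrow> real"
  obtain T where T: "orthogonal_transformation T" and TT: "\<And>z. T (T z) = z" and Tx: "T x = y"
    using reflection_exists[of x y] x y by auto
  define a where "a = (\<lambda>i k. ip surface_measure (\<lambda>z. ?Y i (T z)) (?Y k))"
  have pb: "poly_below n (\<lambda>z. ?Y i (T z))" if "i < ?M" for i
    by (intro poly_below_orthogonal[OF T] harmonic_poly_below dim2 that)
  have cont: "continuous_on (sphere 0 1) (\<lambda>z. ?Y i (T z))" "continuous_on (sphere 0 1) (?Y i)" if "i < ?M" for i
    using pb[OF that] harmonic_poly_below(1)[OF dim2 that] by (auto intro: poly_below_continuous_on)
  have sym: "a i k = a k i" if "i < ?M" "k < ?M" for i k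
  proof -
    have "a i k = (LINT z|surface_measure. ?Y i (T z) * ?Y k z)" by (simp add: a_def ip_def)
    also have "\<dots> = (LINT z|surface_measure. ?Y i (T (T z)) * ?Y k (T z))"
      by (rule surface_integral_orthogonal[OF T, symmetric]) (intro continuous_intros cont that)
    also have "\<dots> = a k i" by (simp add: a_def ip_def TT mult.commute)
    finally show ?thesis .
  qed
  have exp: "?Y i (T z) = (\<Sum>k<?M. a i k * ?Y k z)" if "i < ?M" "z \<in> sphere 0 1" for i z
    unfolding a_def by (rule poly_below_expansion[OF dim2 pb[OF that(1)] that(2)])
  have "(\<Sum>i<?M. (?Y i y)\<^sup>2) = (\<Sum>i<?M. \<Sum>k<?M. ?Y i y * (a i k * ?Y k x))"
    using exp[OF _ x] by (auto simp: Tx power2_eq_square sum_distrib_left[symmetric] intro!: sum.cong)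
  also have "\<dots> = (\<Sum>k<?M. \<Sum>i<?M. ?Y i y * (a i k * ?Y k x))" by (rule sum.swap)
  also have "\<dots> = (\<Sum>k<?M. ?Y k x * (\<Sum>i<?M. a k i * ?Y i y))"
    by (auto simp: sum_distrib_left sym mult_ac intro!: sum.cong)
  also have "\<dots> = (\<Sum>k<?M. ?Y k x * ?Y k (T y))"
    using exp[OF _ y] by (auto intro!: sum.cong)
  also have "\<dots> = (\<Sum>k<?M. (?Y k x)\<^sup>2)"
    using TT[of x] by (simp add: Tx power2_eq_square)
  finally show ?thesis by simp
qed

text \<open>
  The sum of the squares of the harmonics is a constant. Its integral over the whole sphere is the
  number of nonzero harmonics, which determines its integral over \<open>\<Omega>\<close>.
\<close>

lemma harmonic_local_mass_le:
  fixes \<Omega> :: "'a set"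
  assumes \<Omega>: "\<Omega> \<subseteq> sphere 0 1" "\<Omega> \<in> sets borel"
  shows "measure sphere_measure (sphere (0::'a) 1) *
      (\<Sum>i<harm_count TYPE('a) n. ip (domain_measure \<Omega>) (harmonic i) (harmonic i)) \<le>
    real (harm_count TYPE('a) n) * measure sphere_measure \<Omega>"
proof -
  let ?M = "harm_count TYPE('a) n" and ?Y = "harmonic :: nat \<Rightarrow> 'a \<Rightarrow> real"
  obtain x0 :: 'a where x0: "x0 \<in> sphere 0 1"
    using nonempty_Basis by (metis ex_in_conv mem_sphere_0 norm_Basis)
  define K where "K = (\<Sum>i<?M. (?Y i x0)\<^sup>2)"
  have cont: "continuous_on (sphere 0 1) (?Y i)" for i
    by (rule poly_below_continuous_on[OF harmonic_poly_below_deg[OF dim2]])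
  have *: "(\<Sum>i<?M. ip (domain_measure U) (?Y i) (?Y i)) = K * measure sphere_measure U"
    if U: "U \<subseteq> sphere 0 1" "U \<in> sets borel" for U
  proof -
    have "(\<Sum>i<?M. ip (domain_measure U) (?Y i) (?Y i)) = (LINT x|domain_measure U. (\<Sum>i<?M. (?Y i x)\<^sup>2))"
      unfolding ip_self real_norm_def power2_abs
      by (rule Bochner_Integration.integral_sum[symmetric])
        (intro continuous_on_sphere_integrable U continuous_intros cont)
    also have "\<dots> = (LINT x|domain_measure U. K)"
      unfolding K_def using U harmonic_sum_squares_constant[OF _ x0]
      by (intro Bochner_Integration.integral_cong) auto
    also have "\<dots> = K * measure sphere_measure U"
      using U by (simp add: measure_restrict_space)
    finally show ?thesis .
  qed
  have "K * measure sphere_measure (sphere (0::'a) 1) = (\<Sum>i<?M. ip surface_measure (?Y i) (?Y i))"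
    using *[of "sphere 0 1"] by simp
  also have "\<dots> \<le> (\<Sum>i<?M. 1)" by (intro sum_mono harmonic_norm_le[OF dim2])
  finally have "K * measure sphere_measure (sphere (0::'a) 1) * measure sphere_measure \<Omega> \<le>
      real ?M * measure sphere_measure \<Omega>"
    by (intro mult_right_mono) auto
  then show ?thesis by (simp add: *[OF \<Omega>] mult_ac)
qed

section \<open>The spectral inequality on the sphere\<close>

lemma sphere_ev_mono: "m \<le> n \<Longrightarrow> sphere_ev TYPE('a) m \<le> sphere_ev TYPE('a) n"
proof (cases "m = 0")
  case True
  then show ?thesis using dim2 by simp
next
  case False
  assume "m \<le> n"
  then show ?thesis using dim2 by (intro mult_mono) auto
qed

lemma sphere_ev_nonneg: "0 \<le> sphere_ev TYPE('a) n"
  using sphere_ev_mono[of 0 n] by simp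

text \<open>
  The norm of \<open>\<phi>\<close> is exhausted by its harmonic coefficients, by polynomial approximation, while that
  of its gradient is bounded below by Bessel's inequality. Degrees above \<open>N\<close> have eigenvalues at
  least \<open>z\<close> and contribute nonpositive terms.
\<close>

lemma sphere_spectral_inequality:
  fixes \<phi> :: "'a \<Rightarrow> real"
  assumes \<phi>: "sphere_C1 \<phi>" and z: "0 \<le> z" "z \<le> sphere_ev TYPE('a) (Suc N)"
  shows "z * ip surface_measure \<phi> \<phi> - ip surface_measure (sphere_grad \<phi>) (sphere_grad \<phi>) \<le>
    (\<Sum>i<harm_count TYPE('a) (Suc N). (z - sphere_ev TYPE('a) (harm_deg TYPE('a) i)) *
      (ip surface_measure \<phi> (harmonic i))\<^sup>2)" (is "?L \<le> ?R")
proof (rule field_le_epsilon)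
  fix \<epsilon> :: real assume \<epsilon>: "\<epsilon> > 0"
  let ?Y = "harmonic :: nat \<Rightarrow> 'a \<Rightarrow> real" and ?\<Lambda> = "\<lambda>i. sphere_ev TYPE('a) (harm_deg TYPE('a) i)"
  define a where "a = (\<lambda>i. ip surface_measure \<phi> (?Y i))"
  define \<sigma> where "\<sigma> = measure sphere_measure (sphere (0::'a) 1)"
  have \<sigma>: "\<sigma> \<ge> 0" by (simp add: \<sigma>_def)
  \<comment> \<open>An approximation up to \<open>\<delta>\<close> costs at most \<open>z \<sigma> \<delta>\<^sup>2 \<le> \<epsilon>\<close>.\<close>
  define \<delta> where "\<delta> = sqrt (\<epsilon> / (z * \<sigma> + 1))"
  have den: "z * \<sigma> + 1 > 0" using z \<sigma> by (simp add: add_nonneg_pos)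
  have \<delta>: "\<delta> > 0" using \<epsilon> den by (simp add: \<delta>_def)
  have "\<delta>\<^sup>2 = \<epsilon> / (z * \<sigma> + 1)" using \<epsilon> den by (simp add: \<delta>_def)
  then have "z * (\<delta>\<^sup>2 * \<sigma>) = \<epsilon> * ((z * \<sigma>) / (z * \<sigma> + 1))" by simp
  also have "\<dots> \<le> \<epsilon> * 1" using \<epsilon> den by (intro mult_left_mono) auto
  finally have small: "z * (\<delta>\<^sup>2 * \<sigma>) \<le> \<epsilon>" by simp
  have c\<phi>: "continuous_on (sphere 0 1) \<phi>" using \<phi> by (rule sphere_C1_continuous_on)
  obtain p where p: "real_polynomial_function p" "\<And>x. x \<in> sphere 0 1 \<Longrightarrow> \<bar>\<phi> x - p x\<bar> < \<delta>"
    using Stone_Weierstrass_real_polynomial_function[OF compact_sphere c\<phi> \<delta>] by blast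
  obtain n0 where "poly_below n0 p" using real_polynomial_function_poly_below[OF p(1)] by blast
  define n where "n = max n0 (Suc N)"
  have pn: "poly_below n p" by (rule poly_below_mono[OF \<open>poly_below n0 p\<close>]) (simp add: n_def)
  let ?M = "harm_count TYPE('a) n"
  define c where "c = (\<lambda>i. ip surface_measure p (?Y i))"
  have s\<phi>: "sqint surface_measure \<phi>" using c\<phi> by (rule continuous_on_surface_sqint)
  have sp: "sqint surface_measure p" by (rule sqint_poly_below[OF dim2 pn])
  have sY: "sqint surface_measure (?Y i)" for i by (rule sqint_harmonic[OF dim2])
  have expand: "ip surface_measure h p = (\<Sum>i<?M. c i * ip surface_measure h (?Y i))"
    if "sqint surface_measure h" for h
  proof -
    have "ip surface_measure h p = ip surface_measure h (\<lambda>x::'a. \<Sum>i<?M. c i *\<^sub>R ?Y i x)"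
      using poly_below_expansion[OF dim2 pn] by (intro ip_cong) (auto simp: c_def)
    also have "\<dots> = (\<Sum>i<?M. c i * ip surface_measure h (?Y i))"
      by (intro ip_lincomb_right sY that)
    finally show ?thesis .
  qed
  have "ip surface_measure (\<lambda>x. \<phi> x - p x) (\<lambda>x. \<phi> x - p x) =
      ip surface_measure \<phi> \<phi> - 2 * (\<Sum>i<?M. c i * a i) + (\<Sum>i<?M. c i * c i)"
    unfolding ip_self_diff[OF s\<phi> sp] expand[OF s\<phi>] expand[OF sp] by (simp add: a_def c_def)
  also have "\<dots> = ip surface_measure \<phi> \<phi> - (\<Sum>i<?M. (a i)\<^sup>2) + (\<Sum>i<?M. (a i - c i)\<^sup>2)"
  proof -
    have "(\<Sum>i<?M. (a i - c i)\<^sup>2) = (\<Sum>i<?M. (a i)\<^sup>2 - 2 * (c i * a i) + c i * c i)"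
      by (intro sum.cong) (auto simp: algebra_simps power2_eq_square)
    then show ?thesis by (simp add: sum.distrib sum_subtractf sum_distrib_left)
  qed
  also have "\<dots> \<ge> ip surface_measure \<phi> \<phi> - (\<Sum>i<?M. (a i)\<^sup>2)"
    by (simp add: sum_nonneg)
  finally have "ip surface_measure \<phi> \<phi> - (\<Sum>i<?M. (a i)\<^sup>2) \<le>
      ip surface_measure (\<lambda>x. \<phi> x - p x) (\<lambda>x. \<phi> x - p x)" .
  also have "\<dots> \<le> integral\<^sup>L surface_measure (\<lambda>x::'a. \<delta>\<^sup>2)"
    unfolding ip_self
  proof (rule integral_mono)
    show "integrable surface_measure (\<lambda>x. (norm (\<phi> x - p x))\<^sup>2)"
      using sqint_diff[OF s\<phi> sp] by (simp add: sqint_def)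
    show "integrable (surface_measure :: 'a measure) (\<lambda>x. \<delta>\<^sup>2)"
      by (intro continuous_on_sphere_integrable) auto
    fix x :: 'a assume "x \<in> space surface_measure"
    then have "\<bar>\<phi> x - p x\<bar> \<le> \<delta>" using p(2)[of x] by simp
    then show "(norm (\<phi> x - p x))\<^sup>2 \<le> \<delta>\<^sup>2" by (intro power_mono) auto
  qed
  also have "\<dots> = \<delta>\<^sup>2 * \<sigma>"
    by (simp add: \<sigma>_def measure_restrict_space)
  finally have parseval: "ip surface_measure \<phi> \<phi> \<le> (\<Sum>i<?M. (a i)\<^sup>2) + \<delta>\<^sup>2 * \<sigma>" by simp
  have bessel: "(\<Sum>i<?M. ?\<Lambda> i * (a i)\<^sup>2) \<le> ip surface_measure (sphere_grad \<phi>) (sphere_grad \<phi>)"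
  proof (rule weighted_Bessel[where e = "\<lambda>i. sphere_grad (?Y i)"])
    have C1Y: "sphere_C1 (?Y i)" for i by (rule sphere_C1_poly_below[OF harmonic_poly_below_deg[OF dim2]])
    show "sqint surface_measure (sphere_grad \<phi>)" "\<And>i. sqint surface_measure (sphere_grad (?Y i))"
      by (intro continuous_on_surface_sqint sphere_C1_grad_continuous_on \<phi> C1Y)+
    show "ip surface_measure (sphere_grad (?Y i)) (sphere_grad (?Y j)) = 0" if "i \<noteq> j" for i j
      using harmonic_eigenfunction[OF dim2 C1Y, of i j] harmonic_orthogonal[OF dim2 that] by simp
    show "ip surface_measure (sphere_grad \<phi>) (sphere_grad (?Y i)) = ?\<Lambda> i * a i" for i
      using harmonic_eigenfunction[OF dim2 \<phi>] by (simp add: a_def)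
    show "ip surface_measure (sphere_grad (?Y i)) (sphere_grad (?Y i)) \<le> ?\<Lambda> i" for i
      using harmonic_eigenfunction[OF dim2 C1Y, of i i]
        mult_left_mono[OF harmonic_norm_le[OF dim2, of i] sphere_ev_nonneg[of "harm_deg TYPE('a) i"]]
      by simp
  qed simp
  have "z * ip surface_measure \<phi> \<phi> \<le> z * ((\<Sum>i<?M. (a i)\<^sup>2) + \<delta>\<^sup>2 * \<sigma>)"
    using parseval z(1) by (rule mult_left_mono)
  then have "?L \<le> (\<Sum>i<?M. z * (a i)\<^sup>2) + z * (\<delta>\<^sup>2 * \<sigma>) - (\<Sum>i<?M. ?\<Lambda> i * (a i)\<^sup>2)"
    using bessel by (simp add: distrib_left sum_distrib_left)
  also have "\<dots> = (\<Sum>i<?M. (z - ?\<Lambda> i) * (a i)\<^sup>2) + z * (\<delta>\<^sup>2 * \<sigma>)"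
    by (simp add: left_diff_distrib sum_subtractf)
  also have "\<dots> \<le> (\<Sum>i<harm_count TYPE('a) (Suc N). (z - ?\<Lambda> i) * (a i)\<^sup>2) + \<epsilon>"
  proof (rule add_mono[OF _ small])
    have sub: "{..<harm_count TYPE('a) (Suc N)} \<subseteq> {..<?M}"
      using harm_count_mono[of "Suc N" n, where 'a = 'a] by (simp add: n_def)
    have neg: "(z - ?\<Lambda> i) * (a i)\<^sup>2 \<le> 0" if "i \<in> {..<?M} - {..<harm_count TYPE('a) (Suc N)}" for i
    proof -
      have "Suc N \<le> harm_deg TYPE('a) i" using that harm_deg(2)[OF dim2, of i "Suc N"] by auto
      then have "sphere_ev TYPE('a) (Suc N) \<le> ?\<Lambda> i" by (rule sphere_ev_mono)
      then show ?thesis using z by (intro mult_nonpos_nonneg) auto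
    qed
    have "(\<Sum>i<?M. (z - ?\<Lambda> i) * (a i)\<^sup>2) =
        (\<Sum>i\<in>{..<?M} - {..<harm_count TYPE('a) (Suc N)}. (z - ?\<Lambda> i) * (a i)\<^sup>2) +
        (\<Sum>i<harm_count TYPE('a) (Suc N). (z - ?\<Lambda> i) * (a i)\<^sup>2)"
      by (rule sum.subset_diff[OF sub]) simp
    then show "(\<Sum>i<?M. (z - ?\<Lambda> i) * (a i)\<^sup>2) \<le> (\<Sum>i<harm_count TYPE('a) (Suc N). (z - ?\<Lambda> i) * (a i)\<^sup>2)"
    proof -
      have "(\<Sum>i\<in>{..<?M} - {..<harm_count TYPE('a) (Suc N)}. (z - ?\<Lambda> i) * (a i)\<^sup>2) \<le> 0"
        by (rule sum_nonpos) (rule neg)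
      with \<open>(\<Sum>i<?M. (z - ?\<Lambda> i) * (a i)\<^sup>2) = _\<close> show ?thesis by linarith
    qed
  qed
  finally show "?L \<le> ?R + \<epsilon>" by (simp add: a_def)
qed

end

section \<open>Sobolev functions on a domain\<close>

lemma L2_iff_sqint: "f \<in> L2 \<Omega> \<longleftrightarrow> sqint (domain_measure \<Omega>) f"
  by (simp add: L2_def sqint_def)

lemma sphere_grad_zero_outside:
  fixes \<phi> :: "'a::euclidean_space \<Rightarrow> real"
  assumes K: "compact K" "\<And>x. x \<in> sphere 0 1 - K \<Longrightarrow> \<phi> x = 0" and x: "x \<in> sphere 0 1 - K"
  shows "sphere_grad \<phi> x = 0"
proof -
  define U where "U = sgn -` (- K) \<inter> (- {0::'a})"
  have "open U"
    unfolding U_def using K(1) continuous_on_sgn_nonzero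
    by (metis compact_imp_closed continuous_on_open_vimage open_Compl closed_singleton)
  moreover have "x \<in> U" using x by (auto simp: U_def sphere_eq_sgn)
  moreover have "0 = \<phi> (sgn y)" if "y \<in> U" for y
    using K(2)[of "sgn y"] that by (auto simp: U_def norm_sgn)
  ultimately have "((\<lambda>y. \<phi> (sgn y)) has_derivative (\<lambda>v. 0)) (at x)"
    by (rule has_derivative_transform_within_open[OF has_derivative_const])
  from frechet_derivative_at[OF this, symmetric] show ?thesis
    by (simp add: sphere_grad_def)
qed

lemma test_function_C1: "\<phi> \<in> test_functions \<Omega> \<Longrightarrow> sphere_C1 \<phi>" for \<phi> :: "'a::euclidean_space \<Rightarrow> real"
  by (auto simp: test_functions_def intro: sphere_C1_smooth)

lemma test_function_ip:
  fixes \<phi> \<psi> :: "'a::euclidean_space \<Rightarrow> real"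
  assumes \<phi>: "\<phi> \<in> test_functions \<Omega>" and \<Omega>: "\<Omega> \<subseteq> sphere 0 1" "\<Omega> \<in> sets borel"
  shows "ip (domain_measure \<Omega>) \<phi> \<psi> = ip surface_measure \<phi> \<psi>"
    and "ip (domain_measure \<Omega>) (sphere_grad \<phi>) (sphere_grad \<psi>) =
      ip surface_measure (sphere_grad \<phi>) (sphere_grad \<psi>)"
proof -
  obtain K where K: "compact K" "K \<subseteq> \<Omega>" "\<And>x. x \<in> sphere 0 1 - K \<Longrightarrow> \<phi> x = 0"
    using \<phi> by (auto simp: test_functions_def)
  show "ip (domain_measure \<Omega>) \<phi> \<psi> = ip surface_measure \<phi> \<psi>"
    unfolding ip_def using K by (intro integral_domain_eq_surface \<Omega>) auto
  show "ip (domain_measure \<Omega>) (sphere_grad \<phi>) (sphere_grad \<psi>) =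
      ip surface_measure (sphere_grad \<phi>) (sphere_grad \<psi>)"
    unfolding ip_def
  proof (rule integral_domain_eq_surface[OF \<Omega>])
    fix x assume "x \<in> sphere 0 1 - \<Omega>"
    then have "x \<in> sphere 0 1 - K" using K(2) by auto
    from sphere_grad_zero_outside[OF K(1) K(3) this]
    show "sphere_grad \<phi> x \<bullet> sphere_grad \<psi> x = 0" by simp
  qed
qed

lemma H1_norm_eq:
  "H1_norm \<Omega> (u, g) = sqrt (ip (domain_measure \<Omega>) u u + ip (domain_measure \<Omega>) g g)"
  by (simp add: H1_norm_def ip_self)

lemma H1_norm_tendsto_iff:
  "((\<lambda>n. H1_norm \<Omega> (u n, g n)) \<longlonglongrightarrow> 0) \<longleftrightarrow>
     ((\<lambda>n. ip (domain_measure \<Omega>) (u n) (u n)) \<longlonglongrightarrow> 0) \<and> ((\<lambda>n. ip (domain_measure \<Omega>) (g n) (g n)) \<longlonglongrightarrow> 0)"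
  (is "?L \<longleftrightarrow> ?U \<and> ?G")
proof
  assume ?L
  then have "(\<lambda>n. (H1_norm \<Omega> (u n, g n))\<^sup>2) \<longlonglongrightarrow> 0" using tendsto_power[of _ 0 _ 2] by fastforce
  then have s: "(\<lambda>n. ip (domain_measure \<Omega>) (u n) (u n) + ip (domain_measure \<Omega>) (g n) (g n)) \<longlonglongrightarrow> 0"
    by (simp add: H1_norm_eq ip_self_nonneg)
  show "?U \<and> ?G"
    by (intro conjI; rule tendsto_sandwich[OF _ _ tendsto_const s]; simp add: ip_self_nonneg)
next
  assume "?U \<and> ?G"
  then have "(\<lambda>n. ip (domain_measure \<Omega>) (u n) (u n) + ip (domain_measure \<Omega>) (g n) (g n)) \<longlonglongrightarrow> 0 + 0"
    by (intro tendsto_add) auto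
  from tendsto_real_sqrt[OF this] show ?L by (simp add: H1_norm_eq)
qed

lemma H10_approx:
  assumes "(u, g) \<in> H10 \<Omega>"
  obtains \<phi> where "\<And>n. \<phi> n \<in> test_functions \<Omega>"
    "(\<lambda>n. ip (domain_measure \<Omega>) (\<lambda>x. u x - \<phi> n x) (\<lambda>x. u x - \<phi> n x)) \<longlonglongrightarrow> 0"
    "(\<lambda>n. ip (domain_measure \<Omega>) (\<lambda>x. g x - sphere_grad (\<phi> n) x) (\<lambda>x. g x - sphere_grad (\<phi> n) x)) \<longlonglongrightarrow> 0"
  using assms by (auto simp: H10_def H1_norm_tendsto_iff)

lemma H10_sqint:
  assumes "(u, g) \<in> H10 \<Omega>"
  shows "sqint (domain_measure \<Omega>) u" "sqint (domain_measure \<Omega>) g"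
  using assms by (auto simp: H10_def H1_def L2_iff_sqint)

text \<open>
  For test functions the integrals over \<open>\<Omega>\<close> and over the sphere agree. Both sides are continuous in
  the norm of \<open>H1\<close>.
\<close>

lemma H10_spectral_inequality:
  fixes u :: "'a::euclidean_space \<Rightarrow> real"
  assumes dim2: "DIM('a) \<ge> 2" and \<Omega>: "\<Omega> \<subseteq> sphere 0 1" "\<Omega> \<in> sets borel" and u: "(u, g) \<in> H10 \<Omega>"
    and z: "0 \<le> z" "z \<le> sphere_ev TYPE('a) (Suc N)"
  shows "z * ip (domain_measure \<Omega>) u u - ip (domain_measure \<Omega>) g g \<le>
    (\<Sum>i<harm_count TYPE('a) (Suc N). (z - sphere_ev TYPE('a) (harm_deg TYPE('a) i)) *
      (ip (domain_measure \<Omega>) u (harmonic i))\<^sup>2)"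
proof -
  let ?M = "domain_measure \<Omega>"
  obtain \<phi> where \<phi>: "\<And>n. \<phi> n \<in> test_functions \<Omega>"
    "(\<lambda>n. ip ?M (\<lambda>x. u x - \<phi> n x) (\<lambda>x. u x - \<phi> n x)) \<longlonglongrightarrow> 0"
    "(\<lambda>n. ip ?M (\<lambda>x. g x - sphere_grad (\<phi> n) x) (\<lambda>x. g x - sphere_grad (\<phi> n) x)) \<longlonglongrightarrow> 0"
    using H10_approx[OF u] by blast
  have C1: "sphere_C1 (\<phi> n)" for n by (rule test_function_C1[OF \<phi>(1)])
  have s: "sqint ?M (\<phi> n)" "sqint ?M (sphere_grad (\<phi> n))" for n
    by (intro continuous_on_sphere_sqint \<Omega> sphere_C1_continuous_on sphere_C1_grad_continuous_on C1)+
  have sY: "sqint ?M (harmonic i :: 'a \<Rightarrow> real)" for i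
    by (intro continuous_on_sphere_sqint \<Omega> poly_below_continuous_on[OF harmonic_poly_below_deg[OF dim2]])
  note su = H10_sqint[OF u]
  show ?thesis
  proof (rule LIMSEQ_le)
    show "(\<lambda>n. z * ip ?M (\<phi> n) (\<phi> n) - ip ?M (sphere_grad (\<phi> n)) (sphere_grad (\<phi> n))) \<longlonglongrightarrow>
        z * ip ?M u u - ip ?M g g"
      by (intro tendsto_intros ip_self_tendsto su s \<phi>)
    show "(\<lambda>n. \<Sum>i<harm_count TYPE('a) (Suc N). (z - sphere_ev TYPE('a) (harm_deg TYPE('a) i)) *
        (ip ?M (\<phi> n) (harmonic i))\<^sup>2) \<longlonglongrightarrow>
      (\<Sum>i<harm_count TYPE('a) (Suc N). (z - sphere_ev TYPE('a) (harm_deg TYPE('a) i)) *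
        (ip ?M u (harmonic i))\<^sup>2)"
      by (intro tendsto_intros ip_tendsto su s \<phi> sY)
    show "\<exists>n0. \<forall>n\<ge>n0. z * ip ?M (\<phi> n) (\<phi> n) - ip ?M (sphere_grad (\<phi> n)) (sphere_grad (\<phi> n)) \<le>
        (\<Sum>i<harm_count TYPE('a) (Suc N). (z - sphere_ev TYPE('a) (harm_deg TYPE('a) i)) *
        (ip ?M (\<phi> n) (harmonic i))\<^sup>2)"
      unfolding test_function_ip[OF \<phi>(1) \<Omega>]
      using sphere_spectral_inequality[OF dim2 C1 z] by blast
  qed
qed

lemma sphere_div_continuous_on:
  fixes X :: "'a::euclidean_space \<Rightarrow> 'a"
  assumes "X \<in> test_fields \<Omega>"
  shows "continuous_on (sphere 0 1) (sphere_div X)"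
proof -
  have "Ck_on (Suc 0) (\<lambda>y. X (sgn y)) (- {0})"
    using assms unfolding test_fields_def test_functions_def sphere_smooth_def by blast
  then have "continuous_on (sphere 0 1) (\<lambda>x. frechet_derivative (\<lambda>y. X (sgn y)) (at x) v)" for v
    by (auto intro: continuous_on_subset)
  then show ?thesis unfolding sphere_div_def by (intro continuous_intros)
qed

lemma test_field_continuous_on:
  fixes X :: "'a::euclidean_space \<Rightarrow> 'a"
  assumes "X \<in> test_fields \<Omega>"
  shows "continuous_on (sphere 0 1) X"
proof (rule continuous_on_eq)
  have "Ck_on 0 (\<lambda>y. X (sgn y)) (- {0})"
    using assms unfolding test_fields_def test_functions_def sphere_smooth_def by blast
  then show "continuous_on (sphere 0 1) (\<lambda>y. X (sgn y))" by (auto intro: continuous_on_subset)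
qed (simp add: sphere_eq_sgn)

lemma Ck_on_lincomb:
  fixes f g :: "'a::euclidean_space \<Rightarrow> real"
  shows "Ck_on k f S \<Longrightarrow> Ck_on k g S \<Longrightarrow> open S \<Longrightarrow> Ck_on k (\<lambda>x. f x + c * g x) S"
proof (induction k arbitrary: f g)
  case 0
  then show ?case by (auto intro!: continuous_intros)
next
  case (Suc k)
  have d: "frechet_derivative (\<lambda>x. f x + c * g x) (at x) =
      (\<lambda>v. frechet_derivative f (at x) v + c * frechet_derivative g (at x) v)" if "x \<in> S" for x
    using Suc.prems that
    by (intro frechet_derivative_at[symmetric] has_derivative_add has_derivative_mult_right)
      (auto simp: frechet_derivative_works)
  have cong: "Ck_on k f' S" if "Ck_on k f S" "\<And>x. x \<in> S \<Longrightarrow> f' x = f x" for f f' :: "'a \<Rightarrow> real" and k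
    using that
  proof (induction k arbitrary: f f')
    case 0
    then show ?case by (auto cong: continuous_on_cong)
  next
    case (Suc k)
    have d: "(f' has_derivative frechet_derivative f (at x)) (at x)" if "x \<in> S" for x
      by (rule has_derivative_transform_within_open[OF _ \<open>open S\<close> that])
        (use Suc.prems that in \<open>auto simp: frechet_derivative_works\<close>)
    show ?case
      unfolding Ck_on.simps
    proof (intro conjI ballI allI)
      show "f' differentiable at x" if "x \<in> S" for x
        using d[OF that] by (auto simp: differentiable_def)
      show "Ck_on k (\<lambda>x. frechet_derivative f' (at x) v) S" for v
      proof (rule Suc.IH)
        show "Ck_on k (\<lambda>x. frechet_derivative f (at x) v) S" using Suc.prems(1) by simp
        show "frechet_derivative f' (at x) v = frechet_derivative f (at x) v" if "x \<in> S" for x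
          using frechet_derivative_at[OF d[OF that]] by simp
      qed
    qed
  qed
  have "Ck_on k (\<lambda>x. frechet_derivative (\<lambda>x. f x + c * g x) (at x) v) S" for v
    by (rule cong[OF Suc.IH[of "\<lambda>x. frechet_derivative f (at x) v" "\<lambda>x. frechet_derivative g (at x) v"]])
      (use Suc.prems d in auto)
  then show ?case using Suc.prems by (auto intro!: derivative_intros)
qed

lemma test_functions_lincomb:
  fixes \<phi> \<psi> :: "'a::euclidean_space \<Rightarrow> real"
  assumes \<phi>: "\<phi> \<in> test_functions \<Omega>" and \<psi>: "\<psi> \<in> test_functions \<Omega>"
  shows "(\<lambda>x. \<phi> x + c * \<psi> x) \<in> test_functions \<Omega>"
proof -
  obtain K L where "compact K" "K \<subseteq> \<Omega>" "\<forall>x\<in>sphere 0 1 - K. \<phi> x = 0" "compact L" "L \<subseteq> \<Omega>" "\<forall>x\<in>sphere 0 1 - L. \<psi> x = 0"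
    using \<phi> \<psi> by (auto simp: test_functions_def)
  then have "\<exists>K. compact K \<and> K \<subseteq> \<Omega> \<and> (\<forall>x\<in>sphere 0 1 - K. \<phi> x + c * \<psi> x = 0)"
    by (intro exI[of _ "K \<union> L"]) auto
  moreover have "sphere_smooth (\<lambda>x. \<phi> x + c * \<psi> x)"
    unfolding sphere_smooth_def
    using \<phi> \<psi> by (auto simp: test_functions_def sphere_smooth_def intro!: Ck_on_lincomb)
  ultimately show ?thesis by (simp add: test_functions_def)
qed

lemma sphere_grad_lincomb:
  fixes \<phi> \<psi> :: "'a::euclidean_space \<Rightarrow> real"
  assumes "sphere_C1 \<phi>" "sphere_C1 \<psi>" "x \<in> sphere 0 1"
  shows "sphere_grad (\<lambda>x. \<phi> x + c * \<psi> x) x = sphere_grad \<phi> x + c *\<^sub>R sphere_grad \<psi> x"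
proof -
  have "x \<noteq> 0" using assms by auto
  then have "((\<lambda>y. \<phi> (sgn y) + c * \<psi> (sgn y)) has_derivative
      (\<lambda>v. frechet_derivative (\<lambda>y. \<phi> (sgn y)) (at x) v + c * frechet_derivative (\<lambda>y. \<psi> (sgn y)) (at x) v)) (at x)"
    using Ck_on_1_has_derivative[of "\<lambda>y. \<phi> (sgn y)" "- {0}" x] Ck_on_1_has_derivative[of "\<lambda>y. \<psi> (sgn y)" "- {0}" x] assms
    by (intro has_derivative_add has_derivative_mult_right) (auto simp: sphere_C1_def)
  from frechet_derivative_at[OF this, symmetric] show ?thesis
    by (simp add: sphere_grad_def scaleR_left_distrib sum.distrib scaleR_sum_right)
qed

lemma H10_lincomb:
  fixes \<Omega> :: "'a::euclidean_space set"
  assumes \<Omega>: "\<Omega> \<subseteq> sphere 0 1" "\<Omega> \<in> sets borel" and u: "(u, g) \<in> H10 \<Omega>" and v: "(v, h) \<in> H10 \<Omega>"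
  shows "(\<lambda>x. u x + c * v x, \<lambda>x. g x + c *\<^sub>R h x) \<in> H10 \<Omega>"
proof -
  let ?M = "domain_measure \<Omega>"
  note su = H10_sqint[OF u] and sv = H10_sqint[OF v]
  have "(\<lambda>x. u x + c * v x, \<lambda>x. g x + c *\<^sub>R h x) \<in> H1 \<Omega>"
    unfolding H1_def L2_iff_sqint mem_Collect_eq prod.case
  proof (intro conjI ballI)
    show "sqint ?M (\<lambda>x. u x + c * v x)"
      using sqint_add[OF su(1) sqint_scale[OF sv(1), of c]] by simp
    show "sqint ?M (\<lambda>x. g x + c *\<^sub>R h x)" by (intro sqint_add sqint_scale su sv)
    show "(g x + c *\<^sub>R h x) \<bullet> x = 0" if "x \<in> \<Omega>" for x
      using u v that by (auto simp: H10_def H1_def inner_add_left)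
    fix X assume X: "X \<in> test_fields \<Omega>"
    have sX: "sqint ?M X" and sD: "sqint ?M (sphere_div X)"
      by (intro continuous_on_sphere_sqint test_field_continuous_on[OF X] sphere_div_continuous_on[OF X] \<Omega>)+
    have "ip ?M (\<lambda>x. g x + c *\<^sub>R h x) X = ip ?M g X + c * ip ?M h X"
      using su sv sX by (simp add: ip_add_left sqint_scale ip_scale_left)
    also have "\<dots> = - (ip ?M u (sphere_div X) + c * ip ?M v (sphere_div X))"
      using u v X by (auto simp: H10_def H1_def ip_def)
    also have "ip ?M u (sphere_div X) + c * ip ?M v (sphere_div X) = ip ?M (\<lambda>x. u x + c *\<^sub>R v x) (sphere_div X)"
      using su sv sD by (simp add: ip_add_left sqint_scale ip_scale_left del: real_scaleR_def)
    finally show "(LINT x|?M. (g x + c *\<^sub>R h x) \<bullet> X x) = - (LINT x|?M. (u x + c * v x) * sphere_div X x)"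
      by (simp add: ip_def)
  qed
  moreover obtain \<phi> where \<phi>: "\<And>n. \<phi> n \<in> test_functions \<Omega>"
    "(\<lambda>n. ip ?M (\<lambda>x. u x - \<phi> n x) (\<lambda>x. u x - \<phi> n x)) \<longlonglongrightarrow> 0"
    "(\<lambda>n. ip ?M (\<lambda>x. g x - sphere_grad (\<phi> n) x) (\<lambda>x. g x - sphere_grad (\<phi> n) x)) \<longlonglongrightarrow> 0"
    using H10_approx[OF u] by blast
  moreover obtain \<psi> where \<psi>: "\<And>n. \<psi> n \<in> test_functions \<Omega>"
    "(\<lambda>n. ip ?M (\<lambda>x. v x - \<psi> n x) (\<lambda>x. v x - \<psi> n x)) \<longlonglongrightarrow> 0"
    "(\<lambda>n. ip ?M (\<lambda>x. h x - sphere_grad (\<psi> n) x) (\<lambda>x. h x - sphere_grad (\<psi> n) x)) \<longlonglongrightarrow> 0"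
    using H10_approx[OF v] by blast
  moreover have "(\<lambda>n. H1_norm \<Omega> (\<lambda>x. (u x + c * v x) - (\<phi> n x + c * \<psi> n x),
      \<lambda>x. (g x + c *\<^sub>R h x) - sphere_grad (\<lambda>x. \<phi> n x + c * \<psi> n x) x)) \<longlonglongrightarrow> 0"
  proof -
    have C1: "sphere_C1 (\<phi> n)" "sphere_C1 (\<psi> n)" for n by (intro test_function_C1[OF \<phi>(1)] test_function_C1[OF \<psi>(1)])+
    have s: "sqint ?M (\<phi> n)" "sqint ?M (sphere_grad (\<phi> n))" "sqint ?M (\<psi> n)" "sqint ?M (sphere_grad (\<psi> n))" for n
      by (intro continuous_on_sphere_sqint \<Omega> sphere_C1_continuous_on sphere_C1_grad_continuous_on C1)+
    have lin: "(\<lambda>n. ip ?M (\<lambda>x. a n x + c *\<^sub>R b n x) (\<lambda>x. a n x + c *\<^sub>R b n x)) \<longlonglongrightarrow> 0"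
      if "\<And>n. sqint ?M (a n)" "\<And>n. sqint ?M (b n)"
        "(\<lambda>n. ip ?M (a n) (a n)) \<longlonglongrightarrow> 0" "(\<lambda>n. ip ?M (b n) (b n)) \<longlonglongrightarrow> 0"
      for a b :: "nat \<Rightarrow> 'a \<Rightarrow> 'c::euclidean_space"
    proof (rule tendsto_sandwich[OF _ _ tendsto_const])
      show "\<forall>\<^sub>F n in sequentially. ip ?M (\<lambda>x. a n x + c *\<^sub>R b n x) (\<lambda>x. a n x + c *\<^sub>R b n x) \<le>
          2 * ip ?M (a n) (a n) + 2 * c\<^sup>2 * ip ?M (b n) (b n)"
      proof (intro always_eventually allI)
        fix n
        \<comment> \<open>the parallelogram law\<close>
        have "ip ?M (\<lambda>x. a n x + c *\<^sub>R b n x) (\<lambda>x. a n x + c *\<^sub>R b n x) +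
            ip ?M (\<lambda>x. a n x - c *\<^sub>R b n x) (\<lambda>x. a n x - c *\<^sub>R b n x) =
            2 * ip ?M (a n) (a n) + 2 * c\<^sup>2 * ip ?M (b n) (b n)"
          using that(1,2)[of n]
          by (simp add: ip_self_diff sqint_scale ip_add_left ip_add_right sqint_add ip_scale_left ip_scale_right
              power2_eq_square distrib_left ip_commute[of ?M "b n" "a n"])
        then show "ip ?M (\<lambda>x. a n x + c *\<^sub>R b n x) (\<lambda>x. a n x + c *\<^sub>R b n x) \<le>
            2 * ip ?M (a n) (a n) + 2 * c\<^sup>2 * ip ?M (b n) (b n)"
          using ip_self_nonneg[of ?M "\<lambda>x. a n x - c *\<^sub>R b n x"] by linarith
      qed
      have "(\<lambda>n. 2 * ip ?M (a n) (a n) + 2 * c\<^sup>2 * ip ?M (b n) (b n)) \<longlonglongrightarrow> 2 * 0 + 2 * c\<^sup>2 * 0"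
        by (intro tendsto_intros that)
      then show "(\<lambda>n. 2 * ip ?M (a n) (a n) + 2 * c\<^sup>2 * ip ?M (b n) (b n)) \<longlonglongrightarrow> 0" by simp
    qed (simp add: ip_self_nonneg)
    have 1: "(\<lambda>x. (u x + c * v x) - (\<phi> n x + c * \<psi> n x)) = (\<lambda>x. (u x - \<phi> n x) + c *\<^sub>R (v x - \<psi> n x))" for n
      by (auto simp: algebra_simps)
    have 2: "ip ?M (\<lambda>x. (g x + c *\<^sub>R h x) - sphere_grad (\<lambda>x. \<phi> n x + c * \<psi> n x) x)
        (\<lambda>x. (g x + c *\<^sub>R h x) - sphere_grad (\<lambda>x. \<phi> n x + c * \<psi> n x) x) =
      ip ?M (\<lambda>x. (g x - sphere_grad (\<phi> n) x) + c *\<^sub>R (h x - sphere_grad (\<psi> n) x))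
        (\<lambda>x. (g x - sphere_grad (\<phi> n) x) + c *\<^sub>R (h x - sphere_grad (\<psi> n) x))" for n
      using \<Omega>(1) by (intro ip_cong) (auto simp: sphere_grad_lincomb[OF C1] algebra_simps subset_iff)
    show ?thesis
      unfolding H1_norm_tendsto_iff 1 2
      by (intro conjI lin sqint_diff su sv s \<phi> \<psi>)
  qed
  ultimately show ?thesis
    unfolding H10_def using test_functions_lincomb[OF \<phi>(1) \<psi>(1), where c = c]
    by (auto intro!: exI[of _ "\<lambda>n x. \<phi> n x + c * \<psi> n x"])
qed

section \<open>Orthonormal eigenfunctions\<close>

lemma dirichlet_eigenspace_iff:
  "u \<in> dirichlet_eigenspace \<Omega> \<mu> \<longleftrightarrow> (\<exists>g. (u, g) \<in> H10 \<Omega> \<and>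
    (\<forall>\<phi> h. (\<phi>, h) \<in> H10 \<Omega> \<longrightarrow> ip (domain_measure \<Omega>) g h = \<mu> * ip (domain_measure \<Omega>) u \<phi>))"
  by (auto simp: dirichlet_eigenspace_def ip_def)

lemma dirichlet_eigenspace_sqint: "u \<in> dirichlet_eigenspace \<Omega> \<mu> \<Longrightarrow> sqint (domain_measure \<Omega>) u"
  by (auto simp: dirichlet_eigenspace_def dest: H10_sqint)

lemma dirichlet_eigenspace_lincomb:
  fixes \<Omega> :: "'a::euclidean_space set"
  assumes \<Omega>: "\<Omega> \<subseteq> sphere 0 1" "\<Omega> \<in> sets borel"
    and u: "u \<in> dirichlet_eigenspace \<Omega> \<mu>" and v: "v \<in> dirichlet_eigenspace \<Omega> \<mu>"
  shows "(\<lambda>x. u x + c * v x) \<in> dirichlet_eigenspace \<Omega> \<mu>"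
proof -
  let ?M = "domain_measure \<Omega>"
  obtain g where g: "(u, g) \<in> H10 \<Omega>" "\<forall>\<phi> h. (\<phi>, h) \<in> H10 \<Omega> \<longrightarrow> ip ?M g h = \<mu> * ip ?M u \<phi>"
    using u unfolding dirichlet_eigenspace_iff by blast
  obtain k where k: "(v, k) \<in> H10 \<Omega>" "\<forall>\<phi> h. (\<phi>, h) \<in> H10 \<Omega> \<longrightarrow> ip ?M k h = \<mu> * ip ?M v \<phi>"
    using v unfolding dirichlet_eigenspace_iff by blast
  have eq: "ip ?M (\<lambda>x. g x + c *\<^sub>R k x) h = \<mu> * ip ?M (\<lambda>x. u x + c *\<^sub>R v x) \<phi>" if "(\<phi>, h) \<in> H10 \<Omega>" for \<phi> h
    using H10_sqint[OF g(1)] H10_sqint[OF k(1)] H10_sqint[OF that] g(2)[rule_format, OF that] k(2)[rule_format, OF that]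
    by (simp add: ip_add_left sqint_scale ip_scale_left distrib_left del: real_scaleR_def)
  show ?thesis
    unfolding dirichlet_eigenspace_iff
    using H10_lincomb[OF \<Omega> g(1) k(1), of c] eq by (intro exI[of _ "\<lambda>x. g x + c *\<^sub>R k x"]) simp
qed

text \<open>
  The residual at \<open>i\<close> is a linear combination of \<open>f 0, \<dots>, f i\<close> in which \<open>f i\<close> has coefficient
  \<open>1\<close>. If its norm were zero, independence would force this coefficient to vanish.
\<close>

lemma gram_schmidt_normed_if_independent:
  assumes f: "\<And>k. k < m \<Longrightarrow> sqint M (f k)"
    and indep: "\<And>c::nat \<Rightarrow> real. (AE x in M. (\<Sum>i<m. c i * f i x) = 0) \<Longrightarrow> \<forall>i<m. c i = 0"
    and i: "i < m"
  shows "ip M (gram_schmidt M f i) (gram_schmidt M f i) = 1"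
proof -
  let ?r = "gs_residual M f i"
  define P where "P = (\<lambda>u. \<exists>c::nat \<Rightarrow> real. \<forall>x. u x = (\<Sum>l<i. c l * f l x))"
  have zero: "P (\<lambda>x. 0)" unfolding P_def by (rule exI[of _ "\<lambda>l. 0"]) simp
  have add: "P (\<lambda>x. u x + v x)" if uv: "P u" "P v" for u v
  proof -
    obtain c c' where "\<forall>x. u x = (\<Sum>l<i. c l * f l x)" "\<forall>x. v x = (\<Sum>l<i. c' l * f l x)"
      using uv unfolding P_def by auto
    then show ?thesis
      unfolding P_def by (intro exI[of _ "\<lambda>l. c l + c' l"]) (simp add: distrib_right sum.distrib)
  qed
  have scale: "P (\<lambda>x. a * u x)" if u: "P u" for a u
  proof -
    obtain c where "\<forall>x. u x = (\<Sum>l<i. c l * f l x)"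
      using u unfolding P_def by auto
    then show ?thesis
      unfolding P_def by (intro exI[of _ "\<lambda>l. a * c l"]) (simp add: sum_distrib_left mult.assoc)
  qed
  have base: "P (f k)" if "k < i" for k
    unfolding P_def using that
    by (intro exI[of _ "\<lambda>l. if l = k then 1 else 0"]) (simp add: if_distrib[of "\<lambda>a. a * _"] cong: if_cong)
  have gs: "P (gram_schmidt M f k)" if "k < i" for k
    by (rule gram_schmidt_induct(2)[where P = P, OF zero add scale base]) (use that in auto)
  have sum: "P (\<lambda>x. \<Sum>k<n. a k * gram_schmidt M f k x)" if "n \<le> i" for n a
    using that
  proof (induction n)
    case (Suc n)
    have "P (\<lambda>x. (\<Sum>k<n. a k * gram_schmidt M f k x) + a n * gram_schmidt M f n x)"
      by (rule add[OF Suc.IH scale[OF gs]]) (use Suc.prems in auto)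
    then show ?case by simp
  qed (simp add: zero)
  obtain c where c: "\<forall>x. (\<Sum>k<i. ip M (f i) (gram_schmidt M f k) * gram_schmidt M f k x) = (\<Sum>l<i. c l * f l x)"
    using sum[of i "\<lambda>k. ip M (f i) (gram_schmidt M f k)"] unfolding P_def by auto
  define C where "C = (\<lambda>l. if l < i then - c l else if l = i then 1 else 0)"
  have r: "?r x = (\<Sum>l<m. C l * f l x)" for x
  proof -
    have "(\<Sum>l<m. C l * f l x) = (\<Sum>l<Suc i. C l * f l x)"
      by (rule sum.mono_neutral_right) (use i in \<open>auto simp: C_def\<close>)
    also have "\<dots> = f i x + (\<Sum>l<i. C l * f l x)" by (simp add: C_def)
    also have "(\<Sum>l<i. C l * f l x) = - (\<Sum>l<i. c l * f l x)"
      unfolding sum_negf[symmetric] by (rule sum.cong) (auto simp: C_def)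
    finally show ?thesis using c by (simp add: gs_residual_def)
  qed
  have s: "sqint M ?r" by (rule sqint_gram_schmidt(1)) (use f i in auto)
  have "ip M ?r ?r \<noteq> 0"
  proof
    assume "ip M ?r ?r = 0"
    then have "AE x in M. (norm (?r x))\<^sup>2 = 0"
      using s unfolding ip_self sqint_def by (subst (asm) integral_nonneg_eq_0_iff_AE) auto
    then have "AE x in M. (\<Sum>l<m. C l * f l x) = 0" by (simp add: r)
    from indep[OF this] i show False by (auto simp: C_def)
  qed
  then have pos: "ip M ?r ?r > 0" using ip_self_nonneg[of M ?r] by linarith
  then have "gram_schmidt M f i = (\<lambda>x. (1 / sqrt (ip M ?r ?r)) *\<^sub>R ?r x)"
    by (subst gram_schmidt_eq) simp
  then show ?thesis using pos by (simp only: ip_scale_left ip_scale_right) simp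
qed

lemma has_multiplicity_orthonormal:
  fixes \<Omega> :: "'a::euclidean_space set"
  assumes \<Omega>: "\<Omega> \<subseteq> sphere 0 1" "\<Omega> \<in> sets borel" and m: "has_multiplicity \<Omega> \<mu> m"
  shows "\<exists>w. (\<forall>i<m. w i \<in> dirichlet_eigenspace \<Omega> \<mu>) \<and>
    (\<forall>i<m. \<forall>j<m. ip (domain_measure \<Omega>) (w i) (w j) = (if i = j then 1 else 0))"
proof -
  let ?M = "domain_measure \<Omega>"
  obtain b where b: "\<And>i. i < m \<Longrightarrow> b i \<in> dirichlet_eigenspace \<Omega> \<mu>"
    "\<And>c::nat \<Rightarrow> real. (AE x in ?M. (\<Sum>i<m. c i * b i x) = 0) \<Longrightarrow> \<forall>i<m. c i = 0"
    using m by (auto simp: has_multiplicity_def)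
  have s: "sqint ?M (b i)" if "i < m" for i by (rule dirichlet_eigenspace_sqint[OF b(1)[OF that]])
  have mem: "gram_schmidt ?M b i \<in> dirichlet_eigenspace \<Omega> \<mu>" if i: "i < m" for i
  proof (rule gram_schmidt_induct(2)[where P = "\<lambda>u. u \<in> dirichlet_eigenspace \<Omega> \<mu>"])
    note lin = dirichlet_eigenspace_lincomb[OF \<Omega>]
    show zero: "(\<lambda>x. 0) \<in> dirichlet_eigenspace \<Omega> \<mu>" using lin[OF b(1)[OF i] b(1)[OF i], of "-1"] by simp
    show "(\<lambda>x. u x + v x) \<in> dirichlet_eigenspace \<Omega> \<mu>"
      if "u \<in> dirichlet_eigenspace \<Omega> \<mu>" "v \<in> dirichlet_eigenspace \<Omega> \<mu>" for u v
      using lin[OF that, of 1] by simp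
    show "(\<lambda>x. c * u x) \<in> dirichlet_eigenspace \<Omega> \<mu>" if "u \<in> dirichlet_eigenspace \<Omega> \<mu>" for c u
      using lin[OF zero that, of c] by simp
    show "b k \<in> dirichlet_eigenspace \<Omega> \<mu>" if "k \<le> i" for k using b(1) i that by simp
  qed
  have "ip ?M (gram_schmidt ?M b i) (gram_schmidt ?M b j) = (if i = j then 1 else 0)" if "i < m" "j < m" for i j
  proof (cases "i = j")
    case True
    then show ?thesis using gram_schmidt_normed_if_independent[OF s b(2) that(1)] by simp
  next
    case False
    have "ip ?M (gram_schmidt ?M b i) (gram_schmidt ?M b j) = 0"
      by (rule gram_schmidt_orthogonal[OF _ False]) (use that in \<open>auto intro: s\<close>)
    with False show ?thesis by simp
  qed
  with mem show ?thesis by (intro exI[of _ "gram_schmidt ?M b"]) auto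
qed

text \<open>
  Within one eigenvalue the indices \<open>j\<close> are matched with an orthonormal basis of the eigenspace by
  counting the earlier indices with the same eigenvalue. Different eigenspaces are orthogonal.
\<close>

lemma orthonormal_eigenfunctions:
  fixes \<Omega> :: "'a::euclidean_space set"
  assumes \<Omega>: "\<Omega> \<subseteq> sphere 0 1" "\<Omega> \<in> sets borel" and ev: "dirichlet_eigenvalue_sequence \<Omega> ev"
  obtains u g where "\<And>j. 1 \<le> j \<Longrightarrow> (u j, g j) \<in> H10 \<Omega>"
    "\<And>i j. 1 \<le> i \<Longrightarrow> 1 \<le> j \<Longrightarrow> ip (domain_measure \<Omega>) (u i) (u j) = (if i = j then 1 else 0)"
    "\<And>j. 1 \<le> j \<Longrightarrow> ip (domain_measure \<Omega>) (g j) (g j) = ev j"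
proof -
  let ?M = "domain_measure \<Omega>"
  let ?C = "\<lambda>\<mu>. {j\<in>{1..}. ev j = \<mu>}"
  have eigenvalue: "dirichlet_eigenvalue \<Omega> (ev j)" if "1 \<le> j" for j
    using ev that by (auto simp: dirichlet_eigenvalue_sequence_def)
  have mult: "finite (?C \<mu>)" "has_multiplicity \<Omega> \<mu> (card (?C \<mu>))" if "dirichlet_eigenvalue \<Omega> \<mu>" for \<mu>
    using ev that by (auto simp: dirichlet_eigenvalue_sequence_def)
  have "\<exists>W. \<forall>\<mu>. dirichlet_eigenvalue \<Omega> \<mu> \<longrightarrow>
      (\<forall>i<card (?C \<mu>). W \<mu> i \<in> dirichlet_eigenspace \<Omega> \<mu>) \<and>
      (\<forall>i<card (?C \<mu>). \<forall>j<card (?C \<mu>). ip ?M (W \<mu> i) (W \<mu> j) = (if i = j then 1 else 0))"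
    by (rule choice) (use has_multiplicity_orthonormal[OF \<Omega> mult(2)] in blast)
  then obtain W where W: "\<And>\<mu> i. dirichlet_eigenvalue \<Omega> \<mu> \<Longrightarrow> i < card (?C \<mu>) \<Longrightarrow> W \<mu> i \<in> dirichlet_eigenspace \<Omega> \<mu>"
    "\<And>\<mu> i j. dirichlet_eigenvalue \<Omega> \<mu> \<Longrightarrow> i < card (?C \<mu>) \<Longrightarrow> j < card (?C \<mu>) \<Longrightarrow>
      ip ?M (W \<mu> i) (W \<mu> j) = (if i = j then 1 else 0)"
    by blast
  define idx where "idx = (\<lambda>j. card {i \<in> ?C (ev j). i < j})"
  have idx_less: "idx j < card (?C (ev j))" if "1 \<le> j" for j
    unfolding idx_def by (rule psubset_card_mono) (use mult(1)[OF eigenvalue[OF that]] that in auto)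
  have idx_mono: "idx i < idx j" if "1 \<le> i" "i < j" "ev i = ev j" for i j
    unfolding idx_def by (rule psubset_card_mono) (use that mult(1)[OF eigenvalue[of j]] in auto)
  define u where "u = (\<lambda>j. W (ev j) (idx j))"
  have "\<exists>g. \<forall>j. 1 \<le> j \<longrightarrow> (u j, g j) \<in> H10 \<Omega> \<and>
      (\<forall>\<phi> h. (\<phi>, h) \<in> H10 \<Omega> \<longrightarrow> ip ?M (g j) h = ev j * ip ?M (u j) \<phi>)"
  proof (rule choice, intro allI)
    fix j
    show "\<exists>g. 1 \<le> j \<longrightarrow> (u j, g) \<in> H10 \<Omega> \<and>
      (\<forall>\<phi> h. (\<phi>, h) \<in> H10 \<Omega> \<longrightarrow> ip ?M g h = ev j * ip ?M (u j) \<phi>)"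
    proof (cases "1 \<le> j")
      case True
      have "u j \<in> dirichlet_eigenspace \<Omega> (ev j)"
        unfolding u_def by (rule W(1)[OF eigenvalue[OF True] idx_less[OF True]])
      then show ?thesis unfolding dirichlet_eigenspace_iff by blast
    qed simp
  qed
  then obtain g where g: "\<And>j. 1 \<le> j \<Longrightarrow> (u j, g j) \<in> H10 \<Omega>"
    "\<And>j \<phi> h. 1 \<le> j \<Longrightarrow> (\<phi>, h) \<in> H10 \<Omega> \<Longrightarrow> ip ?M (g j) h = ev j * ip ?M (u j) \<phi>"
    by blast
  have ortho: "ip ?M (u i) (u j) = (if i = j then 1 else 0)" if ij: "1 \<le> i" "1 \<le> j" for i j
  proof (cases "ev i = ev j")
    case True
    have "ip ?M (u i) (u j) = (if idx i = idx j then 1 else 0)"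
      unfolding u_def True
      by (rule W(2)[OF eigenvalue[OF ij(2)]]) (use idx_less[OF ij(1)] idx_less[OF ij(2)] True in auto)
    moreover have "idx i = idx j \<longleftrightarrow> i = j"
      using idx_mono[of i j] idx_mono[of j i] ij True by (cases i j rule: linorder_cases) auto
    ultimately show ?thesis by simp
  next
    case False
    have "ev i * ip ?M (u i) (u j) = ip ?M (g i) (g j)" using g(2)[OF ij(1) g(1)[OF ij(2)]] by simp
    also have "\<dots> = ip ?M (g j) (g i)" by (rule ip_commute)
    also have "\<dots> = ev j * ip ?M (u j) (u i)" by (rule g(2)[OF ij(2) g(1)[OF ij(1)]])
    also have "\<dots> = ev j * ip ?M (u i) (u j)" by (simp add: ip_commute)
    finally have "ip ?M (u i) (u j) = 0" using False by simp
    then show ?thesis using False by auto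
  qed
  show ?thesis
  proof (rule that[OF g(1) ortho])
    show "ip ?M (g j) (g j) = ev j" if "1 \<le> j" for j
      using g(2)[OF that g(1)[OF that]] ortho[OF that that] by simp
  qed
qed

section \<open>Comparison with the spectrum of the whole sphere\<close>

lemma sum_harm_count_Suc:
  fixes h :: "nat \<Rightarrow> real"
  defines "c \<equiv> harm_count TYPE('a::euclidean_space)"
  shows "(\<Sum>i<c (Suc n). h i) = (\<Sum>i<c n. h i) + (\<Sum>i\<in>{c n..<c (Suc n)}. h i)"
  using harm_count_mono[of n "Suc n", where 'a = 'a]
  by (simp add: c_def lessThan_atLeast0 sum.atLeastLessThan_concat)

lemma harm_deg_block:
  assumes "DIM('a::euclidean_space) \<ge> 2" "i \<in> {harm_count TYPE('a) n..<harm_count TYPE('a) (Suc n)}"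
  shows "harm_deg TYPE('a) i = n"
  using assms(2) harm_deg(2)[OF assms(1), of i n] harm_deg(2)[OF assms(1), of i "Suc n"] by auto

text \<open>Abel summation: decreasing weights preserve a bound on all partial sums over degrees.\<close>

lemma harmonic_weighted_sum_nonneg:
  fixes x :: "nat \<Rightarrow> real"
  assumes dim2: "DIM('a::euclidean_space) \<ge> 2"
    and part: "\<And>n. 0 \<le> (\<Sum>i<harm_count TYPE('a) n. x i)"
    and w: "\<And>n. n < N \<Longrightarrow> w (Suc n) \<le> w n" and wN: "0 \<le> w N"
  shows "0 \<le> (\<Sum>i<harm_count TYPE('a) (Suc N). w (harm_deg TYPE('a) i) * x i)"
proof -
  let ?c = "harm_count TYPE('a)" and ?d = "harm_deg TYPE('a)"
  note split = sum_harm_count_Suc[where 'a = 'a] and deg = harm_deg_block[OF dim2]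
  have "w n * (\<Sum>i<?c (Suc n). x i) \<le> (\<Sum>i<?c (Suc n). w (?d i) * x i)" if "n \<le> N" for n
    using that
  proof (induction n)
    case 0
    have "(\<Sum>i<?c (Suc 0). w (?d i) * x i) = (\<Sum>i<?c (Suc 0). w 0 * x i)"
      using deg[of _ 0] by (intro sum.cong) auto
    then show ?case by (simp add: sum_distrib_left)
  next
    case (Suc n)
    have "w (Suc n) * (\<Sum>i<?c (Suc (Suc n)). x i) =
        w (Suc n) * (\<Sum>i<?c (Suc n). x i) + (\<Sum>i\<in>{?c (Suc n)..<?c (Suc (Suc n))}. w (Suc n) * x i)"
      by (subst split) (simp add: distrib_left sum_distrib_left)
    also have "(\<Sum>i\<in>{?c (Suc n)..<?c (Suc (Suc n))}. w (Suc n) * x i) =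
        (\<Sum>i\<in>{?c (Suc n)..<?c (Suc (Suc n))}. w (?d i) * x i)"
      using deg[of _ "Suc n"] by (intro sum.cong) auto
    also have "w (Suc n) * (\<Sum>i<?c (Suc n). x i) \<le> w n * (\<Sum>i<?c (Suc n). x i)"
      using w[of n] Suc.prems part by (intro mult_right_mono) auto
    also have "\<dots> \<le> (\<Sum>i<?c (Suc n). w (?d i) * x i)" using Suc by simp
    also have "(\<Sum>i<?c (Suc n). w (?d i) * x i) + (\<Sum>i\<in>{?c (Suc n)..<?c (Suc (Suc n))}. w (?d i) * x i) =
        (\<Sum>i<?c (Suc (Suc n)). w (?d i) * x i)" by (rule split[symmetric])
    finally show ?case by simp
  qed
  from this[OF order_refl] show ?thesis
    using mult_nonneg_nonneg[OF wN part[of "Suc N"]] by linarith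
qed

text \<open>
  The variational argument: expand the eigenfunctions \<open>u j\<close> in spherical harmonics. Seen from the
  harmonics, Bessel's inequality for the orthonormal \<open>u j\<close> in \<open>L\<^sup>2(\<Omega>)\<close> bounds the total weight
  of each by its mass on \<open>\<Omega>\<close>, which on average over a degree is the fraction \<open>|\<Omega>| / |S\<^sup>d|\<close>.
\<close>

lemma Riesz_mean_le_sphere:
  fixes \<Omega> :: "'a::euclidean_space set"
  assumes dim2: "DIM('a) \<ge> 2" and \<Omega>: "\<Omega> \<subseteq> sphere 0 1" "\<Omega> \<in> sets borel"
    and ev: "dirichlet_eigenvalue_sequence \<Omega> ev"
    and J: "finite J" "J \<subseteq> {1..}"
    and z: "sphere_ev TYPE('a) N \<le> z" "z \<le> sphere_ev TYPE('a) (Suc N)"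
  shows "measure sphere_measure (sphere (0::'a) 1) * (\<Sum>j\<in>J. z - ev j) \<le>
    measure sphere_measure \<Omega> *
      (\<Sum>i<harm_count TYPE('a) (Suc N). z - sphere_ev TYPE('a) (harm_deg TYPE('a) i))"
proof -
  let ?M = "domain_measure \<Omega>" and ?\<Lambda> = "\<lambda>i. sphere_ev TYPE('a) (harm_deg TYPE('a) i)"
  let ?Y = "harmonic :: nat \<Rightarrow> 'a \<Rightarrow> real" and ?K = "harm_count TYPE('a) (Suc N)"
  define \<sigma> where "\<sigma> = measure sphere_measure (sphere (0::'a) 1)"
  obtain u g where ug: "\<And>j. 1 \<le> j \<Longrightarrow> (u j, g j) \<in> H10 \<Omega>"
    "\<And>i j. 1 \<le> i \<Longrightarrow> 1 \<le> j \<Longrightarrow> ip ?M (u i) (u j) = (if i = j then 1 else 0)"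
    "\<And>j. 1 \<le> j \<Longrightarrow> ip ?M (g j) (g j) = ev j"
    using orthonormal_eigenfunctions[OF \<Omega> ev] by blast
  have z0: "0 \<le> z" using z(1) sphere_ev_nonneg[OF dim2, of N] by linarith
  have sY: "sqint ?M (?Y i)" for i
    by (intro continuous_on_sphere_sqint \<Omega> poly_below_continuous_on[OF harmonic_poly_below_deg[OF dim2]])
  have pos: "0 \<le> z - ?\<Lambda> i" if "i < ?K" for i
  proof -
    have "harm_deg TYPE('a) i \<le> N" using that harm_deg(2)[OF dim2, of i "Suc N"] by simp
    then show ?thesis using sphere_ev_mono[OF dim2, of "harm_deg TYPE('a) i" N] z(1) by linarith
  qed
  have "(\<Sum>j\<in>J. z - ev j) = (\<Sum>j\<in>J. z * ip ?M (u j) (u j) - ip ?M (g j) (g j))"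
    using J ug by (intro sum.cong) (auto simp: subset_iff)
  also have "\<dots> \<le> (\<Sum>j\<in>J. \<Sum>i<?K. (z - ?\<Lambda> i) * (ip ?M (u j) (?Y i))\<^sup>2)"
    using J by (intro sum_mono H10_spectral_inequality[OF dim2 \<Omega> ug(1) z0 z(2)]) auto
  also have "\<dots> = (\<Sum>i<?K. (z - ?\<Lambda> i) * (\<Sum>j\<in>J. 1 * (ip ?M (u j) (?Y i))\<^sup>2))"
    by (subst sum.swap) (simp add: sum_distrib_left)
  also have "\<dots> \<le> (\<Sum>i<?K. (z - ?\<Lambda> i) * ip ?M (?Y i) (?Y i))"
  proof (intro sum_mono mult_left_mono)
    fix i assume "i \<in> {..<?K}"
    then show "0 \<le> z - ?\<Lambda> i" using pos by simp
    have J1: "1 \<le> j" if "j \<in> J" for j using J that by auto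
    show "(\<Sum>j\<in>J. 1 * (ip ?M (u j) (?Y i))\<^sup>2) \<le> ip ?M (?Y i) (?Y i)"
    proof (rule weighted_Bessel[OF J(1) sY, where e = u])
      show "sqint ?M (u j)" if "j \<in> J" for j by (rule H10_sqint(1)[OF ug(1)[OF J1[OF that]]])
      show "ip ?M (u i) (u j) = 0" if "i \<in> J" "j \<in> J" "i \<noteq> j" for i j
        using ug(2)[OF J1[OF that(1)] J1[OF that(2)]] that by simp
      show "ip ?M (?Y i) (u j) = 1 * ip ?M (u j) (?Y i)" if "j \<in> J" for j by (simp add: ip_commute)
      show "ip ?M (u j) (u j) \<le> 1" if "j \<in> J" for j using ug(2)[OF J1[OF that] J1[OF that]] by simp
    qed
  qed
  finally have "\<sigma> * (\<Sum>j\<in>J. z - ev j) \<le> \<sigma> * (\<Sum>i<?K. (z - ?\<Lambda> i) * ip ?M (?Y i) (?Y i))"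
    by (intro mult_left_mono) (auto simp: \<sigma>_def)
  also have "\<dots> \<le> measure sphere_measure \<Omega> * (\<Sum>i<?K. z - ?\<Lambda> i)"
  proof -
    have "0 \<le> (\<Sum>i<?K. (z - ?\<Lambda> i) * (measure sphere_measure \<Omega> - \<sigma> * ip ?M (?Y i) (?Y i)))"
    proof (rule harmonic_weighted_sum_nonneg[OF dim2, where w = "\<lambda>n. z - sphere_ev TYPE('a) n"])
      show "0 \<le> (\<Sum>i<harm_count TYPE('a) n. measure sphere_measure \<Omega> - \<sigma> * ip ?M (?Y i) (?Y i))" for n
        using harmonic_local_mass_le[OF dim2 \<Omega>, of n]
        by (simp add: sum_subtractf sum_distrib_left[symmetric] \<sigma>_def)
      show "z - sphere_ev TYPE('a) (Suc n) \<le> z - sphere_ev TYPE('a) n" if "n < N" for n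
        using sphere_ev_mono[OF dim2, of n "Suc n"] by simp
      show "0 \<le> z - sphere_ev TYPE('a) N" using z(1) by simp
    qed
    also have "\<dots> = measure sphere_measure \<Omega> * (\<Sum>i<?K. z - ?\<Lambda> i) - \<sigma> * (\<Sum>i<?K. (z - ?\<Lambda> i) * ip ?M (?Y i) (?Y i))"
      by (simp add: right_diff_distrib sum_subtractf sum_distrib_left mult_ac)
    finally show ?thesis by simp
  qed
  finally show ?thesis by (simp add: \<sigma>_def)
qed

section \<open>The Riesz mean of the whole sphere\<close>

lemma binomial_fact_pochhammer: "real ((n + k) choose k) * fact k = pochhammer (real n + 1) k"
proof -
  have "real ((n + k) choose k) = (of_nat (n + k) :: real) gchoose k" by (rule binomial_gbinomial)
  also have "\<dots> = pochhammer (real n + 1) k / fact k"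
    by (simp add: gbinomial_pochhammer')
  finally show ?thesis by simp
qed

lemma length_harmonic_gens_fact:
  assumes "DIM('a::euclidean_space) = Suc (Suc e)"
  shows "real (length (harmonic_gens (Suc n) :: ('a \<Rightarrow> real) list)) * fact e =
    pochhammer (real n + 2) e + pochhammer (real n + 1) e"
proof -
  have "pochhammer (real (Suc n) + 1) e = pochhammer (real n + 2) e" by (simp add: add.commute)
  then show ?thesis
    unfolding length_harmonic_gens[OF assms] of_nat_add distrib_right
    using binomial_fact_pochhammer[of "Suc n" e] binomial_fact_pochhammer[of n e] by simp
qed

text \<open>
  Both sides are the product of \<open>e + 1\<close> consecutive factors starting at \<open>x + 1\<close>.
\<close>

lemma pochhammer_shift: "(x + 1) * pochhammer (x + 2) e = (x + 1 + real e) * pochhammer (x + 1 :: real) e"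
  using pochhammer_rec[of "x + 1" e] pochhammer_Suc[of "x + 1" e] by (simp add: mult.commute add.assoc)

lemma harm_count_fact:
  assumes "DIM('a::euclidean_space) = Suc (Suc e)"
  shows "real (harm_count TYPE('a) (Suc N)) * fact (Suc e) = (2 * real N + real (Suc e)) * pochhammer (real N + 1) e"
proof (induction N)
  case 0
  have "harm_count TYPE('a) (Suc 0) = 1"
    using length_harmonic_gens[OF assms, of 0] by (simp add: harm_count_Suc)
  then show ?case by (simp add: pochhammer_fact[symmetric])
next
  case (Suc N)
  let ?P = "pochhammer (real N + 1) e" and ?P' = "pochhammer (real N + 2) e"
  have "real (harm_count TYPE('a) (Suc (Suc N))) * fact (Suc e) =
      (2 * real N + real (Suc e)) * ?P + real (length (harmonic_gens (Suc N) :: ('a \<Rightarrow> real) list)) * fact (Suc e)"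
    unfolding Suc[symmetric] by (subst harm_count_Suc) (simp add: distrib_right)
  also have "real (length (harmonic_gens (Suc N) :: ('a \<Rightarrow> real) list)) * fact (Suc e) = real (Suc e) * (?P' + ?P)"
    using length_harmonic_gens_fact[OF assms, of N] by simp
  also have "(2 * real N + real (Suc e)) * ?P + real (Suc e) * (?P' + ?P) = (2 * real (Suc N) + real (Suc e)) * ?P'"
    using pochhammer_shift[of "real N" e] by (simp add: algebra_simps)
  finally show ?case by (simp add: add.commute)
qed

text \<open>The mean of the eigenvalues of the sphere up to degree \<open>N\<close> is \<open>d / (d + 2) N (N + d)\<close>.\<close>

lemma sum_sphere_ev:
  assumes "DIM('a::euclidean_space) = Suc d" "d \<ge> 1"
  shows "(\<Sum>i<harm_count TYPE('a) (Suc N). sphere_ev TYPE('a) (harm_deg TYPE('a) i)) =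
    real d / (real d + 2) * (real N * (real N + real d)) * real (harm_count TYPE('a) (Suc N))"
proof -
  obtain e where d: "d = Suc e" using assms(2) by (cases d) auto
  have dim: "DIM('a) = Suc (Suc e)" using assms d by simp
  then have dim2: "DIM('a) \<ge> 2" by simp
  let ?c = "harm_count TYPE('a)" and ?\<Lambda> = "sphere_ev TYPE('a)"
  have step: "(\<Sum>i<?c (Suc n). ?\<Lambda> (harm_deg TYPE('a) i)) =
      (\<Sum>i<?c n. ?\<Lambda> (harm_deg TYPE('a) i)) + real (length (harmonic_gens n :: ('a \<Rightarrow> real) list)) * ?\<Lambda> n" for n
  proof -
    have "(\<Sum>i\<in>{?c n..<?c (Suc n)}. ?\<Lambda> (harm_deg TYPE('a) i)) = (\<Sum>i\<in>{?c n..<?c (Suc n)}. ?\<Lambda> n)"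
      using harm_deg_block[OF dim2, of _ n] by (intro sum.cong) auto
    then show ?thesis
      unfolding sum_harm_count_Suc[where 'a = 'a, of _ n] by (simp add: harm_count_Suc)
  qed
  show ?thesis
  proof (induction N)
    case 0
    show ?case using step[of 0] by simp
  next
    case (Suc N)
    \<comment> \<open>\<open>Q\<close> is the product of the factors common to the counts for \<open>N\<close> and \<open>N + 1\<close>.\<close>
    define P where "P = pochhammer (real N + 1) e"
    define Q where "Q = P / (real N + 1)"
    have P: "P = (real N + 1) * Q" by (simp add: Q_def)
    have P': "pochhammer (real N + 2) e = (real N + real d) * Q"
      using pochhammer_shift[of "real N" e] by (simp add: Q_def P_def d field_simps)
    have M: "real (?c (Suc N)) * fact d = (2 * real N + real d) * ((real N + 1) * Q)"
      using harm_count_fact[OF dim, of N] by (simp add: d P_def[symmetric] P)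
    have M': "real (?c (Suc (Suc N))) * fact d = (2 * real N + 2 + real d) * ((real N + real d) * Q)"
      using harm_count_fact[OF dim, of "Suc N"] P' by (simp add: d add.commute)
    have m: "real (length (harmonic_gens (Suc N) :: ('a \<Rightarrow> real) list)) * fact d = real d * ((2 * real N + 1 + real d) * Q)"
    proof -
      have "real (length (harmonic_gens (Suc N) :: ('a \<Rightarrow> real) list)) * fact d =
          real d * (real (length (harmonic_gens (Suc N) :: ('a \<Rightarrow> real) list)) * fact e)"
        by (simp add: d)
      then show ?thesis
        unfolding length_harmonic_gens_fact[OF dim] P' P_def[symmetric] P by (simp add: algebra_simps)
    qed
    have \<Lambda>: "?\<Lambda> (Suc N) = (real N + 1) * (real N + real d)" using assms by (simp add: algebra_simps)
    have arrange: "(a * m + l * v) * f = a * (m * f) + (l * f) * v" for a m l v f :: real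
      by (simp add: algebra_simps)
    let ?S' = "real d / (real d + 2) * (real N * (real N + real d)) * real (?c (Suc N)) +
        real (length (harmonic_gens (Suc N) :: ('a \<Rightarrow> real) list)) * ?\<Lambda> (Suc N)"
    have "?S' * fact d = real d / (real d + 2) * (real N * (real N + real d)) * (real (?c (Suc N)) * fact d) +
        (real (length (harmonic_gens (Suc N) :: ('a \<Rightarrow> real) list)) * fact d) * ?\<Lambda> (Suc N)"
      by (rule arrange)
    also have "\<dots> = real d * (real N + 1) * (real N + real d) * Q * (real N * (2 * real N + real d) / (real d + 2) + (2 * real N + 1 + real d))"
      unfolding M m \<Lambda> by (simp add: algebra_simps add_divide_distrib)
    also have "real N * (2 * real N + real d) / (real d + 2) + (2 * real N + 1 + real d) =
        (real N + 1 + real d) * (2 * real N + 2 + real d) / (real d + 2)"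
    proof -
      have "real d + 2 \<noteq> 0" using of_nat_0_le_iff[of d] by linarith
      then show ?thesis by (simp add: divide_add_eq_iff) (simp add: algebra_simps)
    qed
    also have "real d * (real N + 1) * (real N + real d) * Q * ((real N + 1 + real d) * (2 * real N + 2 + real d) / (real d + 2)) =
        real d / (real d + 2) * (real (Suc N) * (real (Suc N) + real d)) * (real (?c (Suc (Suc N))) * fact d)"
      unfolding M' by (simp add: mult_ac add_ac)
    finally have "?S' * fact d =
        (real d / (real d + 2) * (real (Suc N) * (real (Suc N) + real d)) * real (?c (Suc (Suc N)))) * fact d"
      by (simp only: mult.assoc)
    then have "?S' = real d / (real d + 2) * (real (Suc N) * (real (Suc N) + real d)) * real (?c (Suc (Suc N)))"
      by (subst (asm) mult_cancel_right) simp
    then show ?case unfolding step[of "Suc N"] Suc .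
  qed
qed

lemma sum_index_times_complement:
  "(\<Sum>i<k. real i * (D - real i)) = D * real k * (real k - 1) / 2 - (real k - 1) * real k * (2 * real k - 1) / 6"
  by (induction k) (auto simp: field_simps)

text \<open>
  The arithmetic-geometric mean inequality for the factors of the squared counting function, after
  pairing \<open>N + i\<close> with \<open>N + d - i\<close>. The arithmetic mean produces the shift \<open>z\<^sub>d\<close> exactly.
\<close>

lemma harm_count_AM_GM:
  assumes d: "d \<ge> 1"
  shows "((real N + real d / 2) * (\<Prod>i\<in>{1..<d}. real N + real i)) powr (2 / real d) \<le>
    real N * (real N + real d) + (2 * real d - 1) * (real d + 2) / 12"
proof -
  define x where "x = (\<lambda>i. if i = 0 then (real N + real d / 2)\<^sup>2 else (real N + real i) * (real N + (real d - real i)))"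
  let ?X = "(real N + real d / 2) * (\<Prod>i\<in>{1..<d}. real N + real i)"
  have split: "{..<d} = insert 0 {1..<d}" using d by auto
  have "(\<Prod>i\<in>{1..<d}. real N + (real d - real i)) = (\<Prod>i\<in>{1..<d}. real N + real i)"
    by (rule prod.reindex_bij_witness[of _ "\<lambda>i. d - i" "\<lambda>i. d - i"]) auto
  then have prod: "(\<Prod>i<d. x i) = ?X\<^sup>2"
    unfolding split by (simp add: x_def prod.distrib power2_eq_square mult_ac)
  have Xpos: "?X > 0" using d by (intro mult_pos_pos prod_pos) auto
  have "(\<Prod>i<d. x i) powr (1 / real (card {..<d})) \<le> (\<Sum>i<d. x i / real (card {..<d}))"
  proof (rule arith_geom_mean)
    have "0 \<in> {..<d}" using d by simp
    then show "{..<d} \<noteq> {}" by blast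
    show "0 \<le> x i" if "i \<in> {..<d}" for i using that by (auto simp: x_def)
  qed simp
  also have "(\<Prod>i<d. x i) powr (1 / real (card {..<d})) = ?X powr (2 / real d)"
  proof -
    have "?X\<^sup>2 = ?X powr 2" using Xpos by simp
    then show ?thesis unfolding prod by (simp add: powr_powr)
  qed
  also have "(\<Sum>i<d. x i / real (card {..<d})) =
      real N * (real N + real d) + (2 * real d - 1) * (real d + 2) / 12"
  proof -
    have "(\<Sum>i<d. x i) = (\<Sum>i<d. real N * (real N + real d) + real i * (real d - real i)) + (real d)\<^sup>2 / 4"
      unfolding split by (simp add: x_def algebra_simps power2_eq_square sum.distrib)
    also have "\<dots> = real d * (real N * (real N + real d) + (2 * real d - 1) * (real d + 2) / 12)"
      unfolding sum.distrib sum_index_times_complement by (simp add: field_simps power2_eq_square)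
    finally show ?thesis using d by (simp add: sum_divide_distrib[symmetric])
  qed
  finally show ?thesis .
qed

text \<open>
  This is Young's inequality for the product of \<open>s\<close> and \<open>1\<close>.
\<close>

lemma Bernoulli_powr:
  fixes s p :: real
  assumes "s \<ge> 0" "p > 1"
  shows "1 + p * (s - 1) \<le> s powr p"
proof -
  define q where "q = p / (p - 1)"
  have q: "q > 1" "1 / p + 1 / q = 1" using assms by (auto simp: q_def field_simps)
  have "s * 1 \<le> s powr p / p + 1 powr q / q"
    using assms q by (intro Youngs_inequality) auto
  then have "p * s \<le> p * (s powr p / p + 1 / q)" using assms by (intro mult_left_mono) auto
  also have "\<dots> = s powr p + (p - 1)" using assms by (simp add: q_def distrib_left)
  finally show ?thesis by (simp add: algebra_simps)
qed

text \<open>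
  For fixed \<open>N\<close> the left-hand side is affine in \<open>t\<close>. By the inequality of the means it lies below
  the tangent of the right-hand side at \<open>t = A = (M d! / 2)\<^bsup>2/d\<^esup>\<close>, where \<open>M\<close> is the number of terms,
  and Bernoulli's inequality says that the tangent lies below the graph.
\<close>

lemma sphere_Riesz_mean_le:
  assumes dim: "DIM('a::euclidean_space) = Suc d" and d: "d \<ge> 1" and t: "t \<ge> 0"
  shows "(\<Sum>i<harm_count TYPE('a) (Suc N). t - (2 * real d - 1) * real d / 12 - sphere_ev TYPE('a) (harm_deg TYPE('a) i)) \<le>
    4 / ((real d + 2) * fact d) * t powr (real d / 2 + 1)"
proof -
  obtain e where e: "d = Suc e" using d by (cases d) auto
  define M where "M = real (harm_count TYPE('a) (Suc N))"
  define X where "X = (real N + real d / 2) * (\<Prod>i\<in>{1..<d}. real N + real i)"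
  have X: "X > 0" unfolding X_def using d by (intro mult_pos_pos prod_pos) auto
  define A where "A = X powr (2 / real d)"
  have A: "A > 0" using X by (simp add: A_def)
  have "(\<Prod>i\<in>{1..<d}. real N + real i) = pochhammer (real N + 1) e"
    unfolding pochhammer_prod e One_nat_def prod.atLeast_Suc_lessThan_Suc_shift by (simp add: add_ac)
  then have MX: "M * fact d = 2 * X"
    using harm_count_fact[of e N, where 'a = 'a] dim e by (simp add: M_def X_def)
  then have M: "M > 0" using X by (metis fact_gt_zero zero_less_mult_iff zero_less_numeral not_less_iff_gr_or_eq)
  have Apow: "A powr (real d / 2) = X" using X d by (simp add: A_def powr_powr)
  have "(\<Sum>i<harm_count TYPE('a) (Suc N). t - (2 * real d - 1) * real d / 12 - sphere_ev TYPE('a) (harm_deg TYPE('a) i)) =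
      M * (t - (2 * real d - 1) * real d / 12) - (\<Sum>i<harm_count TYPE('a) (Suc N). sphere_ev TYPE('a) (harm_deg TYPE('a) i))"
    by (simp add: sum_subtractf M_def)
  also have "\<dots> = M * (t - real d / (real d + 2) * (real N * (real N + real d) + (2 * real d - 1) * (real d + 2) / 12))"
    unfolding sum_sphere_ev[OF dim d] M_def[symmetric] by (simp add: field_simps)
  also have "\<dots> \<le> M * (t - real d / (real d + 2) * A)"
    using harm_count_AM_GM[OF d, of N] M
    by (intro mult_left_mono diff_left_mono) (auto simp: A_def X_def)
  also have "\<dots> = 2 * M * A / (real d + 2) * (1 + (real d / 2 + 1) * (t / A - 1))"
  proof -
    have "A * (1 + (real d / 2 + 1) * (t / A - 1)) = (real d + 2) / 2 * t - real d / 2 * A"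
      using A by (simp add: field_simps)
    then have "2 * M / (real d + 2) * (A * (1 + (real d / 2 + 1) * (t / A - 1))) =
        2 * M / (real d + 2) * ((real d + 2) / 2 * t - real d / 2 * A)" by simp
    also have "\<dots> = M * (t - real d / (real d + 2) * A)"
      using of_nat_0_le_iff[of d] by (simp add: field_simps)
    finally show ?thesis by simp
  qed
  also have "\<dots> \<le> 2 * M * A / (real d + 2) * (t / A) powr (real d / 2 + 1)"
    using Bernoulli_powr[of "t / A" "real d / 2 + 1"] t A M d by (intro mult_left_mono) auto
  also have "(t / A) powr (real d / 2 + 1) = t powr (real d / 2 + 1) / (X * A)"
    using t A by (simp add: powr_divide powr_add Apow)
  also have "2 * M * A / (real d + 2) * (t powr (real d / 2 + 1) / (X * A)) =
      (2 * M / X) / (real d + 2) * t powr (real d / 2 + 1)"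
    using A by (simp add: mult_ac)
  also have "2 * M / X = 4 / fact d"
    using MX X by (simp add: field_simps)
  finally show ?thesis by (simp add: mult.commute)
qed

section \<open>Constants\<close>

lemma Gamma_half_product:
  "Gamma ((real d + 1) / 2) * Gamma (real d / 2 + 1) * 2 ^ d = sqrt pi * fact d"
proof (induction d)
  case 0
  show ?case by (simp add: Gamma_one_half_real)
next
  case (Suc d)
  have "Gamma ((real d + 1) / 2 + 1) = (real d + 1) / 2 * Gamma ((real d + 1) / 2)"
    by (rule Gamma_plus1) (auto simp: nonpos_Ints_def)
  moreover have "(real (Suc d) + 1) / 2 = real d / 2 + 1" "real (Suc d) / 2 + 1 = (real d + 1) / 2 + 1"
    by auto
  ultimately have "Gamma ((real (Suc d) + 1) / 2) * Gamma (real (Suc d) / 2 + 1) * 2 ^ Suc d =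
      (real d + 1) * (Gamma ((real d + 1) / 2) * Gamma (real d / 2 + 1) * 2 ^ d)"
    by (simp only: power_Suc) simp
  then show ?case unfolding Suc by (simp add: algebra_simps)
qed

lemma L_class_1_eq: "L_class 1 d * (real d / 2 + 1) = unit_ball_vol (real d) / (2 * pi) ^ d"
proof -
  define P where "P = pi powr (real d / 2)"
  define a where "a = Gamma (real d / 2 + 1)"
  have P: "P > 0" by (simp add: P_def)
  have a: "a > 0" unfolding a_def by (rule Gamma_real_pos) (simp add: add_nonneg_pos)
  have d: "real d / 2 + 1 > 0" by (simp add: add_nonneg_pos)
  have "(4::real) powr (real d / 2) = 2 ^ d"
    using powr_powr[of 2 2 "real d / 2"] by (simp add: powr_realpow)
  then have 1: "(4 * pi) powr (- real d / 2) = 1 / (2 ^ d * P)"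
    by (simp add: powr_minus_divide powr_mult P_def)
  have "Gamma (real d / 2 + 1 + 1) = (real d / 2 + 1) * a"
    unfolding a_def by (rule Gamma_plus1) (auto simp: nonpos_Ints_def)
  then have 2: "Gamma (1 + 1 + real d / 2) = (real d / 2 + 1) * a" by (simp add: add_ac)
  have 3: "Gamma (1 + 1 :: real) = 1" using Gamma_fact[of 1, where 'a = real] by simp
  have "pi ^ d = P * P" unfolding P_def by (simp add: powr_add[symmetric] powr_realpow)
  then have 4: "(2 * pi) ^ d = 2 ^ d * (P * P)" by (simp add: power_mult_distrib)
  have "L_class 1 d * (real d / 2 + 1) = 1 / (2 ^ d * P) / a"
    unfolding L_class_def 1 2 3 using d a by simp
  also have "\<dots> = unit_ball_vol (real d) / (2 * pi) ^ d"
    unfolding 4 unit_ball_vol_def P_def[symmetric] a_def[symmetric] using P by simp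
  finally show ?thesis .
qed

lemma measure_sphere:
  "measure sphere_measure (sphere (0::'a::euclidean_space) 1) = real DIM('a) * unit_ball_vol (real DIM('a))"
  by (simp add: measure_def emeasure_sphere_measure_sphere)

text \<open>
  This identifies the bound for the sphere with the Weyl term: \<open>4 / ((d + 2) d!)\<close> is the
  coefficient of \<open>z\<^bsup>d/2 + 1\<^esup>\<close> in the asymptotics of its Riesz mean.
\<close>

lemma measure_sphere_L_class:
  assumes "DIM('a::euclidean_space) = Suc d"
  shows "measure sphere_measure (sphere (0::'a) 1) * L_class 1 d = 4 / ((real d + 2) * fact d)"
proof -
  have G: "Gamma ((real d + 1) / 2 + 1) = (real d + 1) / 2 * Gamma ((real d + 1) / 2)"
    by (rule Gamma_plus1) (auto simp: nonpos_Ints_def)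
  have "measure sphere_measure (sphere (0::'a) 1) =
      2 * pi powr ((real d + 1) / 2) / Gamma ((real d + 1) / 2)"
  proof -
    have arrange: "c * (p / (c / 2 * g)) = 2 * p / g" if "c \<noteq> 0" for c p g :: real
      using that by simp
    have S: "real (Suc d) = real d + 1" and nz: "real d + 1 \<noteq> 0" by auto
    show ?thesis
      unfolding measure_sphere assms unit_ball_vol_def S G by (rule arrange[OF nz])
  qed
  moreover have "L_class 1 d = unit_ball_vol (real d) / (2 * pi) ^ d / (real d / 2 + 1)"
  proof -
    have nz: "real d / 2 + 1 \<noteq> 0" using of_nat_0_le_iff[of d] by linarith
    show ?thesis unfolding L_class_1_eq[symmetric] using nz by simp
  qed
  moreover have "pi powr ((real d + 1) / 2) * pi powr (real d / 2) = pi ^ d * sqrt pi"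
  proof -
    have "(real d + 1) / 2 + real d / 2 = real d + 1 / 2" by (simp add: field_simps)
    then show ?thesis by (simp add: powr_add[symmetric] powr_realpow[symmetric] powr_half_sqrt[symmetric])
  qed
  ultimately have "measure sphere_measure (sphere (0::'a) 1) * L_class 1 d =
      2 * (pi ^ d * sqrt pi) / (Gamma ((real d + 1) / 2) * Gamma (real d / 2 + 1) * 2 ^ d) / (pi ^ d * (real d / 2 + 1))"
    unfolding unit_ball_vol_def by (simp add: power_mult_distrib mult_ac)
  also have "\<dots> = 4 / ((real d + 2) * fact d)"
  proof -
    have nz: "real d / 2 + 1 \<noteq> 0" using of_nat_0_le_iff[of d] by linarith
    have "2 * (pi ^ d * sqrt pi) / (sqrt pi * fact d) / (pi ^ d * (real d / 2 + 1)) = 2 / (fact d * (real d / 2 + 1))"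
      using nz by simp
    also have "fact d * (real d / 2 + 1) = (real d + 2) * fact d / 2" by (simp add: field_simps)
    finally show ?thesis unfolding Gamma_half_product by simp
  qed
  finally show ?thesis .
qed

text \<open>
  With \<open>z = t - z\<^sub>d\<close>, the degree \<open>N\<close> is chosen such that \<open>z\<close> lies between consecutive eigenvalues of
  the sphere. For negative \<open>z\<close> the left-hand side is not positive, because eigenvalues are nonnegative.
\<close>

lemma Riesz_mean_le:
  fixes \<Omega> :: "'a::euclidean_space set"
  assumes dim: "DIM('a) = Suc d" and d: "d \<ge> 1" and \<Omega>: "openin (top_of_set (sphere 0 1)) \<Omega>"
    and ev: "dirichlet_eigenvalue_sequence \<Omega> ev" and J: "finite J" "J \<subseteq> {1..}" and t: "t \<ge> 0"
  shows "(\<Sum>j\<in>J. t - (2 * real d - 1) * real d / 12 - ev j) \<le>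
    L_class 1 d * measure sphere_measure \<Omega> * t powr (real d / 2 + 1)"
proof -
  note \<Omega>' = openin_sphere_borel[OF \<Omega>]
  have dim2: "DIM('a) \<ge> 2" using dim d by simp
  define z where "z = t - (2 * real d - 1) * real d / 12"
  define \<sigma> where "\<sigma> = measure sphere_measure (sphere (0::'a) 1)"
  have \<sigma>: "\<sigma> > 0" by (simp add: \<sigma>_def measure_sphere)
  have L: "\<sigma> * L_class 1 d = 4 / ((real d + 2) * fact d)"
    unfolding \<sigma>_def by (rule measure_sphere_L_class[OF dim])
  show ?thesis
  proof (cases "z \<ge> 0")
    case True
    have ex: "\<exists>n. z \<le> sphere_ev TYPE('a) (Suc n)"
    proof -
      obtain n where "z \<le> real n" using real_arch_simple by blast
      also have "\<dots> \<le> real (Suc n) * 1" by simp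
      also have "\<dots> \<le> sphere_ev TYPE('a) (Suc n)" using dim d by (intro mult_left_mono) auto
      finally show ?thesis ..
    qed
    define N where "N = (LEAST n. z \<le> sphere_ev TYPE('a) (Suc n))"
    have N: "z \<le> sphere_ev TYPE('a) (Suc N)" unfolding N_def by (rule LeastI_ex[OF ex])
    have N': "sphere_ev TYPE('a) N \<le> z"
    proof (cases N)
      case (Suc m)
      then show ?thesis using not_less_Least[of m "\<lambda>n. z \<le> sphere_ev TYPE('a) (Suc n)"] by (simp add: N_def)
    qed (use True in simp)
    have "\<sigma> * (\<Sum>j\<in>J. z - ev j) \<le> measure sphere_measure \<Omega> *
        (\<Sum>i<harm_count TYPE('a) (Suc N). z - sphere_ev TYPE('a) (harm_deg TYPE('a) i))"
      unfolding \<sigma>_def by (rule Riesz_mean_le_sphere[OF dim2 \<Omega>' ev J N' N])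
    also have "\<dots> \<le> measure sphere_measure \<Omega> * (4 / ((real d + 2) * fact d) * t powr (real d / 2 + 1))"
      unfolding z_def by (intro mult_left_mono sphere_Riesz_mean_le[OF dim d t]) simp
    also have "\<dots> = \<sigma> * (L_class 1 d * measure sphere_measure \<Omega> * t powr (real d / 2 + 1))"
      unfolding L[symmetric] by (simp add: mult_ac)
    finally show ?thesis using \<sigma> by (simp add: z_def)
  next
    case False
    obtain u and g :: "nat \<Rightarrow> 'a \<Rightarrow> 'a" where ug: "\<And>j. 1 \<le> j \<Longrightarrow> (u j, g j) \<in> H10 \<Omega>"
      "\<And>i j. 1 \<le> i \<Longrightarrow> 1 \<le> j \<Longrightarrow> ip (domain_measure \<Omega>) (u i) (u j) = (if i = j then 1 else 0)"
      "\<And>j. 1 \<le> j \<Longrightarrow> ip (domain_measure \<Omega>) (g j) (g j) = ev j"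
      using orthonormal_eigenfunctions[OF \<Omega>' ev] by blast
    have "ev j \<ge> 0" if "j \<in> J" for j
      using ug(3)[of j] ip_self_nonneg[of "domain_measure \<Omega>" "g j"] J that by auto
    then have "(\<Sum>j\<in>J. z - ev j) \<le> 0" using False by (intro sum_nonpos) fastforce
    moreover have "0 \<le> L_class 1 d"
    proof -
      have "0 \<le> \<sigma> * L_class 1 d" unfolding L by simp
      then show ?thesis using \<sigma> by (simp add: zero_le_mult_iff)
    qed
    then have "0 \<le> L_class 1 d * measure sphere_measure \<Omega> * t powr (real d / 2 + 1)"
      by (intro mult_nonneg_nonneg) auto
    ultimately show ?thesis by (simp add: z_def)
  qed
qed

section \<open>Berezin--Li--Yau inequalities on the sphere\<close>

theorem theorem4p1p6:
  fixes d :: nat and \<Omega> :: "'a::euclidean_space set" and ev :: "nat \<Rightarrow> real" and zd vol :: real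
  assumes "d \<ge> 2"
    and "DIM('a) = d + 1"
    and "sphere_domain \<Omega>"
    and "dirichlet_eigenvalue_sequence \<Omega> ev"
    and "zd = (2 * real d - 1) * real d / 12"
    and "vol = measure sphere_measure \<Omega>"
  shows "(\<forall>z\<ge>0. (\<lambda>j. max (z - ev j) 0) summable_on {1..} \<and>
                 (\<Sum>\<^sub>\<infinity>j\<in>{1..}. max (z - ev j) 0) \<le> L_class 1 d * vol * (z + zd) powr (real d / 2 + 1)) \<and>
         (\<forall>k::nat\<ge>1. (\<Sum>j=1..k. ev j) / real k \<ge>
                 real d / (real d + 2) * (4 * pi\<^sup>2 / unit_ball_vol (real d) powr (2 / real d)) *
                 (real k / vol) powr (2 / real d) - zd)"
proof -
  have main: "(\<Sum>j\<in>J. t - zd - ev j) \<le> L_class 1 d * vol * t powr (real d / 2 + 1)"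
    if "finite J" "J \<subseteq> {1..}" "t \<ge> 0" for J t
    unfolding assms(5,6)
    by (rule Riesz_mean_le) (use assms(1-4) that in \<open>auto simp: sphere_domain_def\<close>)
  have zd: "zd \<ge> 0" using assms(1) unfolding assms(5) by (intro divide_nonneg_pos mult_nonneg_nonneg) auto
  show ?thesis
  proof (intro conjI allI impI)
    fix z :: real assume z: "0 \<le> z"
    let ?B = "L_class 1 d * vol * (z + zd) powr (real d / 2 + 1)"
    have fin: "(\<Sum>j\<in>F. max (z - ev j) 0) \<le> ?B" if F: "finite F" "F \<subseteq> {1..}" for F
    proof -
      have "(\<Sum>j\<in>F. max (z - ev j) 0) = (\<Sum>j\<in>{j\<in>F. ev j < z}. max (z - ev j) 0)"
        using F by (intro sum.mono_neutral_right) auto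
      also have "\<dots> = (\<Sum>j\<in>{j\<in>F. ev j < z}. (z + zd) - zd - ev j)"
        by (intro sum.cong) auto
      also have "\<dots> \<le> ?B" using F z zd by (intro main) auto
      finally show ?thesis .
    qed
    show sm: "(\<lambda>j. max (z - ev j) 0) summable_on {1..}"
      by (rule nonneg_bdd_above_summable_on) (use fin in \<open>auto intro!: bdd_aboveI2\<close>)
    show "(\<Sum>\<^sub>\<infinity>j\<in>{1..}. max (z - ev j) 0) \<le> ?B"
      by (rule infsum_le_finite_sums[OF sm]) (use fin in auto)
  next
    fix k :: nat assume k: "1 \<le> k"
    \<comment> \<open>\<open>t = B\<close> maximises \<open>k t - L vol t\<^bsup>d/2 + 1\<^esup>\<close>. If \<open>vol = 0\<close>, division by zero makes \<open>B = 0\<close>.\<close>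
    define B where "B = 4 * pi\<^sup>2 / unit_ball_vol (real d) powr (2 / real d) * (real k / vol) powr (2 / real d)"
    have B: "B \<ge> 0" by (simp add: B_def)
    have d: "real d > 0" using assms by simp
    have vol: "vol \<ge> 0" using assms by simp
    have "L_class 1 d * vol * B powr (real d / 2) \<le> real k / (real d / 2 + 1)"
    proof (cases "vol = 0")
      case False
      then have vp: "vol > 0" using vol by simp
      have "(4 * pi\<^sup>2) powr (real d / 2) = (2 * pi) ^ d"
      proof -
        have "4 * pi\<^sup>2 = (2 * pi) powr 2" by (simp add: power_mult_distrib)
        then show ?thesis by (simp only: powr_powr) (simp add: powr_realpow)
      qed
      then have "B powr (real d / 2) = (2 * pi) ^ d / unit_ball_vol (real d) * (real k / vol)"
        using vp k d unfolding B_def by (simp add: powr_mult powr_divide powr_powr)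
      then have "L_class 1 d * vol * B powr (real d / 2) = L_class 1 d * (2 * pi) ^ d / unit_ball_vol (real d) * real k"
        using vp by simp
      also have "L_class 1 d * (2 * pi) ^ d / unit_ball_vol (real d) = 1 / (real d / 2 + 1)"
      proof -
        have "unit_ball_vol (real d) > 0" by simp
        then have "unit_ball_vol (real d) \<noteq> 0" by (rule less_imp_neq[symmetric])
        then show ?thesis using L_class_1_eq[of d] d by (simp add: field_simps)
      qed
      finally show ?thesis by simp
    qed (use d in simp)
    then have "B * (L_class 1 d * vol * B powr (real d / 2)) \<le> B * (real k / (real d / 2 + 1))"
      using B by (intro mult_left_mono)
    moreover have "L_class 1 d * vol * B powr (real d / 2 + 1) = B * (L_class 1 d * vol * B powr (real d / 2))"
      using B by (simp add: powr_add)
    moreover have "(\<Sum>j\<in>{1..k}. B - zd - ev j) \<le> L_class 1 d * vol * B powr (real d / 2 + 1)"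
      using B by (intro main) auto
    moreover have "(\<Sum>j\<in>{1..k}. B - zd - ev j) = real k * (B - zd) - (\<Sum>j=1..k. ev j)"
      by (simp add: sum_subtractf)
    ultimately have "real k * (B - zd) - B * (real k / (real d / 2 + 1)) \<le> (\<Sum>j=1..k. ev j)"
      by linarith
    also have "real k * (B - zd) - B * (real k / (real d / 2 + 1)) = real k * (real d / (real d + 2) * B - zd)"
      using d by (simp add: field_simps)
    finally have "real d / (real d + 2) * B - zd \<le> (\<Sum>j=1..k. ev j) / real k"
      using k by (simp add: pos_le_divide_eq mult.commute)
    then show "(\<Sum>j=1..k. ev j) / real k \<ge>
        real d / (real d + 2) * (4 * pi\<^sup>2 / unit_ball_vol (real d) powr (2 / real d)) *
        (real k / vol) powr (2 / real d) - zd"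
      by (simp add: B_def mult.assoc)
  qed
qed

end
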